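(* Let $A$ be a small category, let $(C,F,u)$ be a left decomposition of $A$, and let $\mathscr D$ be a derivator. There is a morphism of derivators $$d\colon\mathscr D^A\to\mathscr D^{C^\rhd}$$ such that for every $X\in\mathscr D^A$ (i) the cocone $d(X)\in\mathscr D^{C^\rhd}$ is colimiting, (ii) there is a canonical isomorphism $d(X)_\infty\xrightarrow{\sim}\operatorname{colim}_A X$, and (iii) there are canonical isomorphisms $\operatorname{colim}_{F(c)}(X|_{F(c)})\xrightarrow{\sim} d(X)_c$ for $c\in C$, where $X|_{F(c)}$ is shorthand for $i_c^\ast u^\ast X$ and $i_c\colon F(c)\to\int_C F$ is the inclusion of the fiber over $c$.
   Context: Derivators. $\mathrm{Cat}$ is the 2-category of small categories, $\mathrm{CAT}$ that of not necessarily small categories, $\mathbb 1$ the terminal category. A prederivator is a strict 2-functor $\mathscr D\colon\mathrm{Cat}^{\mathrm{op}}\to\mathrm{CAT}$ (1-cells reversed); write $u^*=\mathscr D(u)$. It is a derivator if: (Der1) $\mathscr D(\coprod_i A_i)\to\prod_i\mathscr D(A_i)$ is an equivalence; (Der2) a morphism $f$ of $\mathscr D(A)$ is invertible iff $f_a:=a^*f$ is invertible for all objects $a\colon\mathbb 1\to A$; (Der3) every $u^*$ has a left adjoint $u_!$ and a right adjoint $u_*$; (Der4) for $u\colon A\to B$ and $b\in B$ the canonical maps $\operatorname{colim}_{(u/b)}p^*X\to (u_!X)_b$ and $(u_*X)_b\to\lim_{(b/u)}q^*X$ are isomorphisms, where $p\colon(u/b)\to A$, $q\colon (b/u)\to A$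 are the projections and $\operatorname{colim}_A=\pi_!$, $\lim_A=\pi_*$ for $\pi\colon A\to\mathbb 1$. Morphisms of derivators are pseudo-natural transformations; natural transformations between them are modifications. For $A\in\mathrm{Cat}$, $\mathscr D^A$ is the derivator $B\mapsto\mathscr D(A\times B)$; a functor $u\colon A\to B$ induces morphisms of derivators $u^*\colon\mathscr D^B\to\mathscr D^A$ and $u_!,u_*\colon\mathscr D^A\to\mathscr D^B$. "$X\in\mathscr D^A$" means $X\in\mathscr D^A(B)$ for some $B\in\mathrm{Cat}$ (objects with parameters), and $X_a=a^*X$. Homotopy finality. A functor $u\colon A\to B$ in $\mathrm{Cat}$ is homotopy final if for every derivator $\mathscr D$ the canonical map $\operatorname{colim}_A u^*X\to\operatorname{colim}_B X$ is an isomorphism for all $X\in\mathscr D^B$ (equivalently, all slice categories $(b/u)$ have weakly contractible nerve). Grothendieck construction. For $F\colon C\to\mathrm{Cat}$, $\int_C F$ has objects $(c,x)$ with $c\in C$, $x\in F(c)$; a morphism $(c,x)\to(c',x')$ is a pair $(f\colon c\to c',\ g\colon F(f)(x)\to x')$. For $c\in C$, $i_c\colon F(c)\to\int_CF$ is $x\mapsto(c,x)$, $g\mapsto(\mathrm{id}_c,g)$. Left decompositions. A left decomposition of a small category $A$ is a triple $(C,F,u)$ with $C$ a small category, $F\colon C\to\mathrm{Cat}$ a functor, and $u\colon\int_C F\to A$ a homotopy final functor. Cocones. $C^\rhd$ is obtained from $C$ by freely adjoining a new terminal object $\infty$; $i_C\colon C\to C^\rhd$ is the inclusion. A diagram in $\mathscr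 D^{C^\rhd}$ is a colimiting cocone if it lies in the essential image of $(i_C)_!\colon\mathscr D^C\to\mathscr D^{C^\rhd}$. *)

theory Defs
  imports Main "HOL-Library.FuncSet"
begin

section \<open>Categories, functors, natural transformations\<close>

text \<open>
  All data are normalised (set to \<open>undefined\<close> off their carriers), so that HOL equality of
  categories, functors and natural transformations is the strict equality that is needed to
  speak of strict 2-functors.
\<close>

record ('o, 'm) cat =
  Obj :: "'o set"
  Arr :: "'m set"
  Dom :: "'m \<Rightarrow> 'o"
  Cod :: "'m \<Rightarrow> 'o"
  Ident :: "'o \<Rightarrow> 'm"
  Comp :: "'m \<Rightarrow> 'm \<Rightarrow> 'm"  (infixl "\<cdot>\<index>" 70)

definition mk_cat ::
  "'o set \<Rightarrow> 'm set \<Rightarrow> ('m \<Rightarrow> 'o) \<Rightarrow> ('m \<Rightarrow> 'o) \<Rightarrow> ('o \<Rightarrow> 'm) \<Rightarrow> ('m \<Rightarrow> 'm \<Rightarrow> 'm) \<Rightarrow> ('o, 'm) cat" where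
  "mk_cat Ob Ar d c i k =
     \<lparr>Obj = Ob, Arr = Ar, Dom = restrict d Ar, Cod = restrict c Ar, Ident = restrict i Ob,
      Comp = (\<lambda>g f. if g \<in> Ar \<and> f \<in> Ar \<and> d g = c f then k g f else undefined)\<rparr>"

definition hom :: "('o, 'm) cat \<Rightarrow> 'o \<Rightarrow> 'o \<Rightarrow> 'm set" where
  "hom A x y = {f \<in> Arr A. Dom A f = x \<and> Cod A f = y}"

definition category :: "('o, 'm) cat \<Rightarrow> bool" where
  "category A \<longleftrightarrow>
     mk_cat (Obj A) (Arr A) (Dom A) (Cod A) (Ident A) (Comp A) = A \<and>
     (\<forall>f \<in> Arr A. Dom A f \<in> Obj A \<and> Cod A f \<in> Obj A) \<and>
     (\<forall>x \<in> Obj A. Ident A x \<in> hom A x x) \<and>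
     (\<forall>x y z f g. f \<in> hom A x y \<longrightarrow> g \<in> hom A y z \<longrightarrow> g \<cdot>\<^bsub>A\<^esub> f \<in> hom A x z) \<and>
     (\<forall>x y f. f \<in> hom A x y \<longrightarrow> Ident A y \<cdot>\<^bsub>A\<^esub> f = f \<and> f \<cdot>\<^bsub>A\<^esub> Ident A x = f) \<and>
     (\<forall>w x y z f g h. f \<in> hom A w x \<longrightarrow> g \<in> hom A x y \<longrightarrow> h \<in> hom A y z \<longrightarrow>
        h \<cdot>\<^bsub>A\<^esub> (g \<cdot>\<^bsub>A\<^esub> f) = h \<cdot>\<^bsub>A\<^esub> g \<cdot>\<^bsub>A\<^esub> f)"

definition iso :: "('o, 'm) cat \<Rightarrow> 'm \<Rightarrow> bool" where
  "iso A f \<longleftrightarrow> f \<in> Arr A \<and>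
     (\<exists>g \<in> hom A (Cod A f) (Dom A f).
        g \<cdot>\<^bsub>A\<^esub> f = Ident A (Dom A f) \<and> f \<cdot>\<^bsub>A\<^esub> g = Ident A (Cod A f))"

record ('o, 'm, 'p, 'n) func =
  Src :: "('o, 'm) cat"
  Tgt :: "('p, 'n) cat"
  omap :: "'o \<Rightarrow> 'p"
  amap :: "'m \<Rightarrow> 'n"

definition mk_func ::
  "('o, 'm) cat \<Rightarrow> ('p, 'n) cat \<Rightarrow> ('o \<Rightarrow> 'p) \<Rightarrow> ('m \<Rightarrow> 'n) \<Rightarrow> ('o, 'm, 'p, 'n) func" where
  "mk_func A B fo fa =
     \<lparr>Src = A, Tgt = B, omap = restrict fo (Obj A), amap = restrict fa (Arr A)\<rparr>"

definition is_func ::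
  "('o, 'm, 'p, 'n) func \<Rightarrow> ('o, 'm) cat \<Rightarrow> ('p, 'n) cat \<Rightarrow> bool" where
  "is_func F A B \<longleftrightarrow>
     category A \<and> category B \<and> mk_func A B (omap F) (amap F) = F \<and>
     (\<forall>x \<in> Obj A. omap F x \<in> Obj B) \<and>
     (\<forall>x y f. f \<in> hom A x y \<longrightarrow> amap F f \<in> hom B (omap F x) (omap F y)) \<and>
     (\<forall>x \<in> Obj A. amap F (Ident A x) = Ident B (omap F x)) \<and>
     (\<forall>x y z f g. f \<in> hom A x y \<longrightarrow> g \<in> hom A y z \<longrightarrow>
        amap F (g \<cdot>\<^bsub>A\<^esub> f) = amap F g \<cdot>\<^bsub>B\<^esub> amap F f)"

definition id_func :: "('o, 'm) cat \<Rightarrow> ('o, 'm, 'o, 'm) func" where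
  "id_func A = mk_func A A (\<lambda>x. x) (\<lambda>f. f)"

definition comp_func ::
  "('p, 'n, 'q, 'l) func \<Rightarrow> ('o, 'm, 'p, 'n) func \<Rightarrow> ('o, 'm, 'q, 'l) func"
  (infixl "\<odot>" 70) where
  "G \<odot> F = mk_func (Src F) (Tgt G) (\<lambda>x. omap G (omap F x)) (\<lambda>f. amap G (amap F f))"

record ('o, 'm, 'p, 'n) ntr =
  NSrc :: "('o, 'm, 'p, 'n) func"
  NTgt :: "('o, 'm, 'p, 'n) func"
  cmp :: "'o \<Rightarrow> 'n"

definition mk_ntr ::
  "('o, 'm, 'p, 'n) func \<Rightarrow> ('o, 'm, 'p, 'n) func \<Rightarrow> ('o \<Rightarrow> 'n) \<Rightarrow> ('o, 'm, 'p, 'n) ntr" where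
  "mk_ntr F G t = \<lparr>NSrc = F, NTgt = G, cmp = restrict t (Obj (Src F))\<rparr>"

definition is_ntr ::
  "('o, 'm, 'p, 'n) ntr \<Rightarrow> ('o, 'm, 'p, 'n) func \<Rightarrow> ('o, 'm, 'p, 'n) func \<Rightarrow> bool" where
  "is_ntr \<tau> F G \<longleftrightarrow>
     is_func F (Src F) (Tgt F) \<and> is_func G (Src F) (Tgt F) \<and> mk_ntr F G (cmp \<tau>) = \<tau> \<and>
     (\<forall>x \<in> Obj (Src F). cmp \<tau> x \<in> hom (Tgt F) (omap F x) (omap G x)) \<and>
     (\<forall>x y f. f \<in> hom (Src F) x y \<longrightarrow>
        cmp \<tau> y \<cdot>\<^bsub>Tgt F\<^esub> amap F f = amap G f \<cdot>\<^bsub>Tgt F\<^esub> cmp \<tau> x)"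

definition is_iso_ntr ::
  "('o, 'm, 'p, 'n) ntr \<Rightarrow> ('o, 'm, 'p, 'n) func \<Rightarrow> ('o, 'm, 'p, 'n) func \<Rightarrow> bool" where
  "is_iso_ntr \<tau> F G \<longleftrightarrow> is_ntr \<tau> F G \<and> (\<forall>x \<in> Obj (Src F). iso (Tgt F) (cmp \<tau> x))"

definition id_ntr :: "('o, 'm, 'p, 'n) func \<Rightarrow> ('o, 'm, 'p, 'n) ntr" where
  "id_ntr F = mk_ntr F F (\<lambda>x. Ident (Tgt F) (omap F x))"

definition vcomp ::
  "('o, 'm, 'p, 'n) ntr \<Rightarrow> ('o, 'm, 'p, 'n) ntr \<Rightarrow> ('o, 'm, 'p, 'n) ntr"
  (infixl "\<bullet>" 60) where
  "\<sigma> \<bullet> \<tau> = mk_ntr (NSrc \<tau>) (NTgt \<sigma>) (\<lambda>x. cmp \<sigma> x \<cdot>\<^bsub>Tgt (NSrc \<tau>)\<^esub> cmp \<tau> x)"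

text \<open>Horizontal composition \<open>\<beta> \<star> \<alpha> : w \<odot> u \<Rightarrow> w' \<odot> u'\<close> of \<open>\<alpha> : u \<Rightarrow> u'\<close> and \<open>\<beta> : w \<Rightarrow> w'\<close>.\<close>

definition hcomp ::
  "('p, 'n, 'q, 'l) ntr \<Rightarrow> ('o, 'm, 'p, 'n) ntr \<Rightarrow> ('o, 'm, 'q, 'l) ntr"
  (infixl "\<star>" 65) where
  "\<beta> \<star> \<alpha> = mk_ntr (NSrc \<beta> \<odot> NSrc \<alpha>) (NTgt \<beta> \<odot> NTgt \<alpha>)
     (\<lambda>x. cmp \<beta> (omap (NTgt \<alpha>) x) \<cdot>\<^bsub>Tgt (NSrc \<beta>)\<^esub> amap (NSrc \<beta>) (cmp \<alpha> x))"

definition equivalence ::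
  "('o, 'm, 'p, 'n) func \<Rightarrow> ('o, 'm) cat \<Rightarrow> ('p, 'n) cat \<Rightarrow> bool" where
  "equivalence F A B \<longleftrightarrow> is_func F A B \<and>
     (\<exists>G \<eta> \<epsilon>. is_func G B A \<and> is_iso_ntr \<eta> (id_func A) (G \<odot> F) \<and> is_iso_ntr \<epsilon> (F \<odot> G) (id_func B))"

definition adjunction ::
  "('o, 'm, 'p, 'n) func \<Rightarrow> ('p, 'n, 'o, 'm) func \<Rightarrow> ('o, 'm, 'o, 'm) ntr \<Rightarrow> ('p, 'n, 'p, 'n) ntr
   \<Rightarrow> bool" where
  "adjunction L R \<eta> \<epsilon> \<longleftrightarrow>
     is_func L (Src L) (Src R) \<and> is_func R (Src R) (Src L) \<and>
     is_ntr \<eta> (id_func (Src L)) (R \<odot> L) \<and> is_ntr \<epsilon> (L \<odot> R) (id_func (Src R)) \<and>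
     (\<forall>x \<in> Obj (Src L).
        cmp \<epsilon> (omap L x) \<cdot>\<^bsub>Src R\<^esub> amap L (cmp \<eta> x) = Ident (Src R) (omap L x)) \<and>
     (\<forall>y \<in> Obj (Src R).
        amap R (cmp \<epsilon> y) \<cdot>\<^bsub>Src L\<^esub> cmp \<eta> (omap R y) = Ident (Src L) (omap R y))"

definition prod_family ::
  "'i set \<Rightarrow> ('i \<Rightarrow> ('o, 'm) cat) \<Rightarrow> ('i \<Rightarrow> 'o, 'i \<Rightarrow> 'm) cat" where
  "prod_family I A = mk_cat
     (\<Pi>\<^sub>E i\<in>I. Obj (A i)) (\<Pi>\<^sub>E i\<in>I. Arr (A i))
     (\<lambda>f. \<lambda>i\<in>I. Dom (A i) (f i)) (\<lambda>f. \<lambda>i\<in>I. Cod (A i) (f i))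
     (\<lambda>x. \<lambda>i\<in>I. Ident (A i) (x i)) (\<lambda>g f. \<lambda>i\<in>I. g i \<cdot>\<^bsub>A i\<^esub> f i)"


section \<open>Small categories\<close>

text \<open>
  Small categories have their objects and arrows in the type \<open>'k elem\<close>, which contains an
  arbitrary type \<open>'k\<close> of atoms and is closed under the encodings used below.  Which subsets of
  this type count as small is governed by a predicate \<open>sm\<close>, of which only the closure properties
  of a class of sets of bounded cardinality are required.  For \<open>'k\<close> of inaccessible
  cardinality, "of cardinality less than that of \<open>'k\<close>" is a possible \<open>sm\<close>; this is smallness
  with respect to a Grothendieck universe.
\<close>

datatype 'k elem = Atom 'k | Pt | Old "'k elem" | Pair (pfst: "'k elem") (psnd: "'k elem")

definition smallness :: "('k elem set \<Rightarrow> bool) \<Rightarrow> bool" where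
  "smallness sm \<longleftrightarrow>
     sm {} \<and> (\<forall>x S. sm S \<longrightarrow> sm (insert x S)) \<and> (\<forall>S T. sm S \<longrightarrow> T \<subseteq> S \<longrightarrow> sm T) \<and>
     (\<forall>S f. sm S \<longrightarrow> sm (f ` S)) \<and>
     (\<forall>S T. sm S \<longrightarrow> (\<forall>i \<in> S. sm (T i)) \<longrightarrow> sm (\<Union>i \<in> S. T i))"

type_synonym 'k scat = "('k elem, 'k elem) cat"
type_synonym 'k sfunc = "('k elem, 'k elem, 'k elem, 'k elem) func"
type_synonym 'k sntr = "('k elem, 'k elem, 'k elem, 'k elem) ntr"

definition Cat :: "('k elem set \<Rightarrow> bool) \<Rightarrow> 'k scat set" where
  "Cat sm = {A. category A \<and> sm (Obj A) \<and> sm (Arr A)}"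

definition sfunc :: "('k elem set \<Rightarrow> bool) \<Rightarrow> 'k sfunc \<Rightarrow> 'k scat \<Rightarrow> 'k scat \<Rightarrow> bool" where
  "sfunc sm u A B \<longleftrightarrow> A \<in> Cat sm \<and> B \<in> Cat sm \<and> is_func u A B"

definition sntr :: "('k elem set \<Rightarrow> bool) \<Rightarrow> 'k sntr \<Rightarrow> 'k sfunc \<Rightarrow> 'k sfunc \<Rightarrow> bool" where
  "sntr sm \<alpha> u v \<longleftrightarrow> sfunc sm u (Src u) (Tgt u) \<and> is_ntr \<alpha> u v"

text \<open>The underlying 1-category of Cat, needed to speak of functors \<open>C \<rightarrow> Cat\<close>.\<close>

definition Cat1 :: "('k elem set \<Rightarrow> bool) \<Rightarrow> ('k scat, 'k sfunc) cat" where
  "Cat1 sm = mk_cat (Cat sm) {u. sfunc sm u (Src u) (Tgt u)} Src Tgt id_func (\<odot>)"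

definition one :: "'k scat" where
  "one = mk_cat {Pt} {Pt} (\<lambda>_. Pt) (\<lambda>_. Pt) (\<lambda>_. Pt) (\<lambda>_ _. Pt)"

definition to_one :: "'k scat \<Rightarrow> 'k sfunc" where
  "to_one A = mk_func A one (\<lambda>_. Pt) (\<lambda>_. Pt)"

definition pt :: "'k scat \<Rightarrow> 'k elem \<Rightarrow> 'k sfunc" where
  "pt A a = mk_func one A (\<lambda>_. a) (\<lambda>_. Ident A a)"

definition pt_ntr :: "'k scat \<Rightarrow> 'k elem \<Rightarrow> 'k sntr" where
  "pt_ntr A f = mk_ntr (pt A (Dom A f)) (pt A (Cod A f)) (\<lambda>_. f)"

definition prod_cat :: "'k scat \<Rightarrow> 'k scat \<Rightarrow> 'k scat"  (infixr "\<otimes>" 75) where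
  "A \<otimes> B = mk_cat
     {Pair a b | a b. a \<in> Obj A \<and> b \<in> Obj B} {Pair f g | f g. f \<in> Arr A \<and> g \<in> Arr B}
     (\<lambda>h. Pair (Dom A (pfst h)) (Dom B (psnd h))) (\<lambda>h. Pair (Cod A (pfst h)) (Cod B (psnd h)))
     (\<lambda>x. Pair (Ident A (pfst x)) (Ident B (psnd x)))
     (\<lambda>h k. Pair (pfst h \<cdot>\<^bsub>A\<^esub> pfst k) (psnd h \<cdot>\<^bsub>B\<^esub> psnd k))"

definition prod_func :: "'k sfunc \<Rightarrow> 'k sfunc \<Rightarrow> 'k sfunc"  (infixr "\<otimes>\<^sub>f" 75) where
  "u \<otimes>\<^sub>f v = mk_func (Src u \<otimes> Src v) (Tgt u \<otimes> Tgt v)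
     (\<lambda>x. Pair (omap u (pfst x)) (omap v (psnd x)))
     (\<lambda>h. Pair (amap u (pfst h)) (amap v (psnd h)))"

definition prod_ntr :: "'k sntr \<Rightarrow> 'k sntr \<Rightarrow> 'k sntr"  (infixr "\<otimes>\<^sub>n" 75) where
  "\<alpha> \<otimes>\<^sub>n \<beta> = mk_ntr (NSrc \<alpha> \<otimes>\<^sub>f NSrc \<beta>) (NTgt \<alpha> \<otimes>\<^sub>f NTgt \<beta>)
     (\<lambda>x. Pair (cmp \<alpha> (pfst x)) (cmp \<beta> (psnd x)))"

definition coprod :: "'k elem set \<Rightarrow> ('k elem \<Rightarrow> 'k scat) \<Rightarrow> 'k scat" where
  "coprod I A = mk_cat
     {Pair i a | i a. i \<in> I \<and> a \<in> Obj (A i)} {Pair i f | i f. i \<in> I \<and> f \<in> Arr (A i)}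
     (\<lambda>h. Pair (pfst h) (Dom (A (pfst h)) (psnd h)))
     (\<lambda>h. Pair (pfst h) (Cod (A (pfst h)) (psnd h)))
     (\<lambda>x. Pair (pfst x) (Ident (A (pfst x)) (psnd x)))
     (\<lambda>h k. Pair (pfst k) (psnd h \<cdot>\<^bsub>A (pfst k)\<^esub> psnd k))"

definition coprod_in :: "'k elem set \<Rightarrow> ('k elem \<Rightarrow> 'k scat) \<Rightarrow> 'k elem \<Rightarrow> 'k sfunc" where
  "coprod_in I A i = mk_func (A i) (coprod I A) (Pair i) (Pair i)"

text \<open>
  The slice \<open>(u/b)\<close> has the objects \<open>(a, f : u a \<rightarrow> b)\<close>.  The arrow
  \<open>h : (a, f' \<circ> u h) \<rightarrow> (a', f')\<close> is encoded as \<open>(h, f')\<close>.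
\<close>

definition slice :: "'k sfunc \<Rightarrow> 'k elem \<Rightarrow> 'k scat" where
  "slice u b = (let A = Src u; B = Tgt u in mk_cat
     {Pair a f | a f. a \<in> Obj A \<and> f \<in> hom B (omap u a) b}
     {Pair h f' | h f'. h \<in> Arr A \<and> f' \<in> hom B (omap u (Cod A h)) b}
     (\<lambda>k. Pair (Dom A (pfst k)) (psnd k \<cdot>\<^bsub>B\<^esub> amap u (pfst k)))
     (\<lambda>k. Pair (Cod A (pfst k)) (psnd k))
     (\<lambda>x. Pair (Ident A (pfst x)) (psnd x))
     (\<lambda>k' k. Pair (pfst k' \<cdot>\<^bsub>A\<^esub> pfst k) (psnd k')))"

definition slice_proj :: "'k sfunc \<Rightarrow> 'k elem \<Rightarrow> 'k sfunc" where
  "slice_proj u b = mk_func (slice u b) (Src u) pfst pfst"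

definition slice_ntr :: "'k sfunc \<Rightarrow> 'k elem \<Rightarrow> 'k sntr" where
  "slice_ntr u b = mk_ntr (u \<odot> slice_proj u b) (pt (Tgt u) b \<odot> to_one (slice u b)) psnd"

text \<open>
  The slice \<open>(b/u)\<close> has the objects \<open>(a, f : b \<rightarrow> u a)\<close>.  The arrow
  \<open>h : (a, f) \<rightarrow> (a', u h \<circ> f)\<close> is encoded as \<open>(h, f)\<close>.
\<close>

definition coslice :: "'k elem \<Rightarrow> 'k sfunc \<Rightarrow> 'k scat" where
  "coslice b u = (let A = Src u; B = Tgt u in mk_cat
     {Pair a f | a f. a \<in> Obj A \<and> f \<in> hom B b (omap u a)}
     {Pair h f | h f. h \<in> Arr A \<and> f \<in> hom B b (omap u (Dom A h))}
     (\<lambda>k. Pair (Dom A (pfst k)) (psnd k))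
     (\<lambda>k. Pair (Cod A (pfst k)) (amap u (pfst k) \<cdot>\<^bsub>B\<^esub> psnd k))
     (\<lambda>x. Pair (Ident A (pfst x)) (psnd x))
     (\<lambda>k' k. Pair (pfst k' \<cdot>\<^bsub>A\<^esub> pfst k) (psnd k)))"

definition coslice_proj :: "'k elem \<Rightarrow> 'k sfunc \<Rightarrow> 'k sfunc" where
  "coslice_proj b u = mk_func (coslice b u) (Src u) pfst pfst"

definition coslice_ntr :: "'k elem \<Rightarrow> 'k sfunc \<Rightarrow> 'k sntr" where
  "coslice_ntr b u = mk_ntr (pt (Tgt u) b \<odot> to_one (coslice b u)) (u \<odot> coslice_proj b u) psnd"

text \<open>
  The Grothendieck construction.  The arrow \<open>(f : c \<rightarrow> c', g : F f x \<rightarrow> x')\<close> from \<open>(c, x)\<close> to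
  \<open>(c', x')\<close> is encoded as \<open>(f, (x, g))\<close>, because \<open>f\<close> and \<open>g\<close> do not determine \<open>x\<close>.
\<close>

type_synonym 'k diag = "('k elem, 'k elem, 'k scat, 'k sfunc) func"

definition groth :: "'k diag \<Rightarrow> 'k scat" where
  "groth F = (let C = Src F in mk_cat
     {Pair c x | c x. c \<in> Obj C \<and> x \<in> Obj (omap F c)}
     {Pair f (Pair x g) | f x g. f \<in> Arr C \<and> x \<in> Obj (omap F (Dom C f)) \<and>
        g \<in> Arr (omap F (Cod C f)) \<and> Dom (omap F (Cod C f)) g = omap (amap F f) x}
     (\<lambda>k. Pair (Dom C (pfst k)) (pfst (psnd k)))
     (\<lambda>k. Pair (Cod C (pfst k)) (Cod (omap F (Cod C (pfst k))) (psnd (psnd k))))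
     (\<lambda>y. Pair (Ident C (pfst y)) (Pair (psnd y) (Ident (omap F (pfst y)) (psnd y))))
     (\<lambda>k' k. Pair (pfst k' \<cdot>\<^bsub>C\<^esub> pfst k)
        (Pair (pfst (psnd k))
           (psnd (psnd k') \<cdot>\<^bsub>omap F (Cod C (pfst k'))\<^esub> amap (amap F (pfst k')) (psnd (psnd k))))))"

definition fib :: "'k diag \<Rightarrow> 'k elem \<Rightarrow> 'k sfunc" where
  "fib F c = mk_func (omap F c) (groth F) (Pair c)
     (\<lambda>g. Pair (Ident (Src F) c) (Pair (Dom (omap F c) g) g))"

text \<open>For \<open>f : c \<rightarrow> c'\<close>, the transformation \<open>i\<^sub>c \<Rightarrow> i\<^sub>c\<^sub>' \<circ> F f\<close> with components \<open>(f, id)\<close>.\<close>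

definition fib_ntr :: "'k diag \<Rightarrow> 'k elem \<Rightarrow> 'k sntr" where
  "fib_ntr F f = (let C = Src F; c = Dom C f; c' = Cod C f in
     mk_ntr (fib F c) (fib F c' \<odot> amap F f)
       (\<lambda>x. Pair f (Pair x (Ident (omap F c') (omap (amap F f) x)))))"

text \<open>
  \<open>C\<^sup>\<rhd>\<close>: objects and arrows of \<open>C\<close> are tagged by \<open>Old\<close>, the new terminal object and its identity
  are \<open>Pt\<close>, and the unique arrow from \<open>Old c\<close> to \<open>Pt\<close> is \<open>Pair Pt c\<close>.
\<close>

definition rcone :: "'k scat \<Rightarrow> 'k scat" where
  "rcone C = mk_cat
     (insert Pt (Old ` Obj C)) (insert Pt (Old ` Arr C \<union> Pair Pt ` Obj C))
     (\<lambda>h. case h of Old f \<Rightarrow> Old (Dom C f) | Pair _ c \<Rightarrow> Old c | _ \<Rightarrow> Pt)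
     (\<lambda>h. case h of Old f \<Rightarrow> Old (Cod C f) | _ \<Rightarrow> Pt)
     (\<lambda>x. case x of Old c \<Rightarrow> Old (Ident C c) | _ \<Rightarrow> Pt)
     (\<lambda>h k. case k of
        Old f \<Rightarrow> (case h of Old g \<Rightarrow> Old (g \<cdot>\<^bsub>C\<^esub> f) | _ \<Rightarrow> Pair Pt (Dom C f))
      | _ \<Rightarrow> k)"

definition rcone_in :: "'k scat \<Rightarrow> 'k sfunc" where
  "rcone_in C = mk_func C (rcone C) Old Old"


section \<open>Derivators\<close>

text \<open>
  CAT consists of the categories with objects in \<open>'o\<close> and arrows in \<open>'m\<close>, of any size.
  A prederivator reverses 1-cells and preserves the direction of 2-cells.
\<close>

record ('k, 'o, 'm) pder =
  onc :: "'k scat \<Rightarrow> ('o, 'm) cat"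
  onf :: "'k sfunc \<Rightarrow> ('o, 'm, 'o, 'm) func"
  onn :: "'k sntr \<Rightarrow> ('o, 'm, 'o, 'm) ntr"

definition prederivator :: "('k elem set \<Rightarrow> bool) \<Rightarrow> ('k, 'o, 'm) pder \<Rightarrow> bool" where
  "prederivator sm D \<longleftrightarrow>
     (\<forall>A \<in> Cat sm. category (onc D A)) \<and>
     (\<forall>u A B. sfunc sm u A B \<longrightarrow> is_func (onf D u) (onc D B) (onc D A)) \<and>
     (\<forall>\<alpha> u v. sntr sm \<alpha> u v \<longrightarrow> is_ntr (onn D \<alpha>) (onf D u) (onf D v)) \<and>
     (\<forall>A \<in> Cat sm. onf D (id_func A) = id_func (onc D A)) \<and>
     (\<forall>u v A B C. sfunc sm u A B \<longrightarrow> sfunc sm v B C \<longrightarrow> onf D (v \<odot> u) = onf D u \<odot> onf D v) \<and>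
     (\<forall>u A B. sfunc sm u A B \<longrightarrow> onn D (id_ntr u) = id_ntr (onf D u)) \<and>
     (\<forall>\<alpha> \<beta> u v w. sntr sm \<alpha> u v \<longrightarrow> sntr sm \<beta> v w \<longrightarrow> onn D (\<beta> \<bullet> \<alpha>) = onn D \<beta> \<bullet> onn D \<alpha>) \<and>
     (\<forall>\<alpha> \<beta> u u' v v'. sntr sm \<alpha> u u' \<longrightarrow> sntr sm \<beta> v v' \<longrightarrow> Src v = Tgt u \<longrightarrow>
        onn D (\<beta> \<star> \<alpha>) = onn D \<alpha> \<star> onn D \<beta>)"

text \<open>A chosen left adjoint \<open>u\<^sub>!\<close> and right adjoint \<open>u\<^sub>*\<close> of \<open>u\<^sup>*\<close>, with units and counits.\<close>

definition lan_data ::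
  "('k, 'o, 'm) pder \<Rightarrow> 'k sfunc \<Rightarrow>
   ('o, 'm, 'o, 'm) func \<times> ('o, 'm, 'o, 'm) ntr \<times> ('o, 'm, 'o, 'm) ntr" where
  "lan_data D u = (SOME (L, \<eta>, \<epsilon>). adjunction L (onf D u) \<eta> \<epsilon>)"

definition lan :: "('k, 'o, 'm) pder \<Rightarrow> 'k sfunc \<Rightarrow> ('o, 'm, 'o, 'm) func" where
  "lan D u = fst (lan_data D u)"

definition lan_unit :: "('k, 'o, 'm) pder \<Rightarrow> 'k sfunc \<Rightarrow> ('o, 'm, 'o, 'm) ntr" where
  "lan_unit D u = fst (snd (lan_data D u))"

definition lan_counit :: "('k, 'o, 'm) pder \<Rightarrow> 'k sfunc \<Rightarrow> ('o, 'm, 'o, 'm) ntr" where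
  "lan_counit D u = snd (snd (lan_data D u))"

definition ran_data ::
  "('k, 'o, 'm) pder \<Rightarrow> 'k sfunc \<Rightarrow>
   ('o, 'm, 'o, 'm) func \<times> ('o, 'm, 'o, 'm) ntr \<times> ('o, 'm, 'o, 'm) ntr" where
  "ran_data D u = (SOME (R, \<eta>, \<epsilon>). adjunction (onf D u) R \<eta> \<epsilon>)"

definition ran :: "('k, 'o, 'm) pder \<Rightarrow> 'k sfunc \<Rightarrow> ('o, 'm, 'o, 'm) func" where
  "ran D u = fst (ran_data D u)"

definition ran_unit :: "('k, 'o, 'm) pder \<Rightarrow> 'k sfunc \<Rightarrow> ('o, 'm, 'o, 'm) ntr" where
  "ran_unit D u = fst (snd (ran_data D u))"

definition ran_counit :: "('k, 'o, 'm) pder \<Rightarrow> 'k sfunc \<Rightarrow> ('o, 'm, 'o, 'm) ntr" where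
  "ran_counit D u = snd (snd (ran_data D u))"

text \<open>
  The canonical map \<open>q\<^sub>! p\<^sup>* X \<rightarrow> b\<^sup>* u\<^sub>! X\<close> attached to a square \<open>\<alpha> : u \<odot> p \<Rightarrow> b \<odot> q\<close>: the transpose
  of \<open>p\<^sup>* X \<rightarrow> p\<^sup>* u\<^sup>* u\<^sub>! X \<rightarrow> q\<^sup>* b\<^sup>* u\<^sub>! X\<close>.
\<close>

definition lan_mate ::
  "('k, 'o, 'm) pder \<Rightarrow> 'k sfunc \<Rightarrow> 'k sfunc \<Rightarrow> 'k sfunc \<Rightarrow> 'k sfunc \<Rightarrow> 'k sntr \<Rightarrow> 'o \<Rightarrow> 'm" where
  "lan_mate D p u q b \<alpha> X =
     cmp (lan_counit D q) (omap (onf D b) (omap (lan D u) X)) \<cdot>\<^bsub>onc D (Tgt q)\<^esub>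
     amap (lan D q)
       (cmp (onn D \<alpha>) (omap (lan D u) X) \<cdot>\<^bsub>onc D (Src q)\<^esub> amap (onf D p) (cmp (lan_unit D u) X))"

text \<open>
  Dually, the canonical map \<open>b\<^sup>* u\<^sub>* X \<rightarrow> q\<^sub>* p\<^sup>* X\<close> attached to a square \<open>\<alpha> : b \<odot> q \<Rightarrow> u \<odot> p\<close>.
\<close>

definition ran_mate ::
  "('k, 'o, 'm) pder \<Rightarrow> 'k sfunc \<Rightarrow> 'k sfunc \<Rightarrow> 'k sfunc \<Rightarrow> 'k sfunc \<Rightarrow> 'k sntr \<Rightarrow> 'o \<Rightarrow> 'm" where
  "ran_mate D p u q b \<alpha> X =
     amap (ran D q)
       (amap (onf D p) (cmp (ran_counit D u) X) \<cdot>\<^bsub>onc D (Src q)\<^esub> cmp (onn D \<alpha>) (omap (ran D u) X))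
     \<cdot>\<^bsub>onc D (Tgt q)\<^esub> cmp (ran_unit D q) (omap (onf D b) (omap (ran D u) X))"

definition Der1 :: "('k elem set \<Rightarrow> bool) \<Rightarrow> ('k, 'o, 'm) pder \<Rightarrow> bool" where
  "Der1 sm D \<longleftrightarrow>
     (\<forall>I A. sm I \<longrightarrow> (\<forall>i \<in> I. A i \<in> Cat sm) \<longrightarrow>
        equivalence
          (mk_func (onc D (coprod I A)) (prod_family I (\<lambda>i. onc D (A i)))
             (\<lambda>X. \<lambda>i\<in>I. omap (onf D (coprod_in I A i)) X)
             (\<lambda>f. \<lambda>i\<in>I. amap (onf D (coprod_in I A i)) f))
          (onc D (coprod I A)) (prod_family I (\<lambda>i. onc D (A i))))"

definition Der2 :: "('k elem set \<Rightarrow> bool) \<Rightarrow> ('k, 'o, 'm) pder \<Rightarrow> bool" where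
  "Der2 sm D \<longleftrightarrow>
     (\<forall>A \<in> Cat sm. \<forall>f \<in> Arr (onc D A).
        iso (onc D A) f \<longleftrightarrow> (\<forall>a \<in> Obj A. iso (onc D one) (amap (onf D (pt A a)) f)))"

definition Der3 :: "('k elem set \<Rightarrow> bool) \<Rightarrow> ('k, 'o, 'm) pder \<Rightarrow> bool" where
  "Der3 sm D \<longleftrightarrow>
     (\<forall>u A B. sfunc sm u A B \<longrightarrow>
        (\<exists>L \<eta> \<epsilon>. adjunction L (onf D u) \<eta> \<epsilon>) \<and> (\<exists>R \<eta> \<epsilon>. adjunction (onf D u) R \<eta> \<epsilon>))"

definition Der4 :: "('k elem set \<Rightarrow> bool) \<Rightarrow> ('k, 'o, 'm) pder \<Rightarrow> bool" where
  "Der4 sm D \<longleftrightarrow>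
     (\<forall>u A B. sfunc sm u A B \<longrightarrow> (\<forall>b \<in> Obj B. \<forall>X \<in> Obj (onc D A).
        iso (onc D one)
          (lan_mate D (slice_proj u b) u (to_one (slice u b)) (pt B b) (slice_ntr u b) X) \<and>
        iso (onc D one)
          (ran_mate D (coslice_proj b u) u (to_one (coslice b u)) (pt B b) (coslice_ntr b u) X)))"

definition derivator :: "('k elem set \<Rightarrow> bool) \<Rightarrow> ('k, 'o, 'm) pder \<Rightarrow> bool" where
  "derivator sm D \<longleftrightarrow> prederivator sm D \<and> Der1 sm D \<and> Der2 sm D \<and> Der3 sm D \<and> Der4 sm D"

text \<open>\<open>D\<^sup>A\<close>\<close>

definition shift :: "('k, 'o, 'm) pder \<Rightarrow> 'k scat \<Rightarrow> ('k, 'o, 'm) pder" where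
  "shift D A = \<lparr>onc = (\<lambda>K. onc D (A \<otimes> K)), onf = (\<lambda>v. onf D (id_func A \<otimes>\<^sub>f v)),
     onn = (\<lambda>\<alpha>. onn D (id_ntr (id_func A) \<otimes>\<^sub>n \<alpha>))\<rparr>"

text \<open>
  Morphisms of derivators are pseudo-natural transformations; the structure cell at
  \<open>v : K' \<rightarrow> K\<close> is an invertible transformation \<open>T\<^sub>K\<^sub>' v\<^sup>* \<Rightarrow> v\<^sup>* T\<^sub>K\<close>.
\<close>

record ('k, 'o, 'm) dmor =
  at :: "'k scat \<Rightarrow> ('o, 'm, 'o, 'm) func"
  cell :: "'k sfunc \<Rightarrow> ('o, 'm, 'o, 'm) ntr"

definition is_dmor ::
  "('k elem set \<Rightarrow> bool) \<Rightarrow> ('k, 'o, 'm) dmor \<Rightarrow> ('k, 'o, 'm) pder \<Rightarrow> ('k, 'o, 'm) pder \<Rightarrow> bool" where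
  "is_dmor sm T D E \<longleftrightarrow>
     (\<forall>K \<in> Cat sm. is_func (at T K) (onc D K) (onc E K)) \<and>
     (\<forall>v K' K. sfunc sm v K' K \<longrightarrow>
        is_iso_ntr (cell T v) (at T K' \<odot> onf D v) (onf E v \<odot> at T K)) \<and>
     (\<forall>K \<in> Cat sm. cell T (id_func K) = id_ntr (at T K)) \<and>
     (\<forall>v w K'' K' K. sfunc sm v K'' K' \<longrightarrow> sfunc sm w K' K \<longrightarrow>
        cell T (w \<odot> v) = (id_ntr (onf E v) \<star> cell T w) \<bullet> (cell T v \<star> id_ntr (onf D w))) \<and>
     (\<forall>\<alpha> v w. sntr sm \<alpha> v w \<longrightarrow>
        (onn E \<alpha> \<star> id_ntr (at T (Tgt v))) \<bullet> cell T v =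
        cell T w \<bullet> (id_ntr (at T (Src v)) \<star> onn D \<alpha>))"

definition comp_dmor :: "('k, 'o, 'm) dmor \<Rightarrow> ('k, 'o, 'm) dmor \<Rightarrow> ('k, 'o, 'm) dmor"
  (infixl "\<odot>\<^sub>d" 70) where
  "S \<odot>\<^sub>d T = \<lparr>at = (\<lambda>K. at S K \<odot> at T K),
     cell = (\<lambda>v. (cell S v \<star> id_ntr (at T (Tgt v))) \<bullet> (id_ntr (at S (Src v)) \<star> cell T v))\<rparr>"

text \<open>Modifications \<open>T \<Rightarrow> S\<close>, given by a family of transformations indexed by Cat.\<close>

definition is_modification ::
  "('k elem set \<Rightarrow> bool) \<Rightarrow> ('k scat \<Rightarrow> ('o, 'm, 'o, 'm) ntr) \<Rightarrow>
   ('k, 'o, 'm) pder \<Rightarrow> ('k, 'o, 'm) pder \<Rightarrow> ('k, 'o, 'm) dmor \<Rightarrow> ('k, 'o, 'm) dmor \<Rightarrow> bool" where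
  "is_modification sm \<theta> D E T S \<longleftrightarrow>
     (\<forall>K \<in> Cat sm. is_ntr (\<theta> K) (at T K) (at S K)) \<and>
     (\<forall>v K' K. sfunc sm v K' K \<longrightarrow>
        (id_ntr (onf E v) \<star> \<theta> K) \<bullet> cell T v = cell S v \<bullet> (\<theta> K' \<star> id_ntr (onf D v)))"

definition is_iso_modification ::
  "('k elem set \<Rightarrow> bool) \<Rightarrow> ('k scat \<Rightarrow> ('o, 'm, 'o, 'm) ntr) \<Rightarrow>
   ('k, 'o, 'm) pder \<Rightarrow> ('k, 'o, 'm) pder \<Rightarrow> ('k, 'o, 'm) dmor \<Rightarrow> ('k, 'o, 'm) dmor \<Rightarrow> bool" where
  "is_iso_modification sm \<theta> D E T S \<longleftrightarrow> is_modification sm \<theta> D E T S \<and>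
     (\<forall>K \<in> Cat sm. \<forall>X \<in> Obj (onc D K). iso (onc E K) (cmp (\<theta> K) X))"

text \<open>
  The morphisms \<open>u\<^sup>* : D\<^sup>B \<rightarrow> D\<^sup>A\<close> and \<open>u\<^sub>! : D\<^sup>A \<rightarrow> D\<^sup>B\<close> induced by \<open>u : A \<rightarrow> B\<close>.  The former is
  strict; the structure cells of the latter are the mates of the identities
  \<open>(u \<times> K) \<circ> (A \<times> v) = (B \<times> v) \<circ> (u \<times> K')\<close>.
\<close>

definition pull :: "('k, 'o, 'm) pder \<Rightarrow> 'k sfunc \<Rightarrow> ('k, 'o, 'm) dmor" where
  "pull D u = \<lparr>at = (\<lambda>K. onf D (u \<otimes>\<^sub>f id_func K)),
     cell = (\<lambda>v. id_ntr (onf D (u \<otimes>\<^sub>f id_func (Src v)) \<odot> onf (shift D (Tgt u)) v))\<rparr>"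

definition push :: "('k, 'o, 'm) pder \<Rightarrow> 'k sfunc \<Rightarrow> ('k, 'o, 'm) dmor" where
  "push D u = \<lparr>at = (\<lambda>K. lan D (u \<otimes>\<^sub>f id_func K)),
     cell = (\<lambda>v. let K' = Src v; K = Tgt v; p = id_func (Src u) \<otimes>\<^sub>f v; b = id_func (Tgt u) \<otimes>\<^sub>f v in
       mk_ntr (lan D (u \<otimes>\<^sub>f id_func K') \<odot> onf D p) (onf D b \<odot> lan D (u \<otimes>\<^sub>f id_func K))
         (lan_mate D p (u \<otimes>\<^sub>f id_func K) (u \<otimes>\<^sub>f id_func K') b
            (id_ntr ((u \<otimes>\<^sub>f id_func K) \<odot> p))))\<rparr>"

text \<open>\<open>colim\<^sub>A : D\<^sup>A \<rightarrow> D\<^sup>\<one>\<close> and, for \<open>w : J \<rightarrow> A\<close>, the canonical map \<open>colim\<^sub>J w\<^sup>* X \<rightarrow> colim\<^sub>A X\<close>.\<close>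

definition colim :: "('k, 'o, 'm) pder \<Rightarrow> 'k scat \<Rightarrow> ('k, 'o, 'm) dmor" where
  "colim D A = push D (to_one A)"

definition colim_comparison ::
  "('k, 'o, 'm) pder \<Rightarrow> 'k scat \<Rightarrow> 'k sfunc \<Rightarrow> 'o \<Rightarrow> 'm" where
  "colim_comparison D K w X =
     lan_mate D (w \<otimes>\<^sub>f id_func K) (to_one (Tgt w) \<otimes>\<^sub>f id_func K) (to_one (Src w) \<otimes>\<^sub>f id_func K)
       (id_func (one \<otimes> K)) (id_ntr (to_one (Src w) \<otimes>\<^sub>f id_func K)) X"

text \<open>
  The argument of type \<open>('o \<times> 'm) itself\<close> names the CAT in which the derivators quantified
  over take their values.
\<close>

definition homotopy_final ::
  "('o \<times> 'm) itself \<Rightarrow> ('k elem set \<Rightarrow> bool) \<Rightarrow> 'k sfunc \<Rightarrow> 'k scat \<Rightarrow> 'k scat \<Rightarrow> bool" where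
  "homotopy_final _ sm u A B \<longleftrightarrow> sfunc sm u A B \<and>
     (\<forall>D :: ('k, 'o, 'm) pder. derivator sm D \<longrightarrow>
        (\<forall>K \<in> Cat sm. \<forall>X \<in> Obj (onc (shift D B) K).
           iso (onc (shift D one) K) (colim_comparison D K u X)))"

definition left_decomposition ::
  "('o \<times> 'm) itself \<Rightarrow> ('k elem set \<Rightarrow> bool) \<Rightarrow> 'k scat \<Rightarrow> 'k scat \<Rightarrow> 'k diag \<Rightarrow> 'k sfunc \<Rightarrow> bool"
  where
  "left_decomposition CAT sm A C F u \<longleftrightarrow>
     C \<in> Cat sm \<and> is_func F C (Cat1 sm) \<and> homotopy_final CAT sm u (groth F) A"

text \<open>\<open>Z \<in> D\<^sup>C\<^sup>\<rhd>(K)\<close> lies in the essential image of \<open>(i\<^sub>C)\<^sub>!\<close>.\<close>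

definition colimiting_cocone ::
  "('k, 'o, 'm) pder \<Rightarrow> 'k scat \<Rightarrow> 'k scat \<Rightarrow> 'o \<Rightarrow> bool" where
  "colimiting_cocone D C K Z \<longleftrightarrow>
     (\<exists>Y \<in> Obj (onc (shift D C) K). \<exists>f. iso (onc (shift D (rcone C)) K) f \<and>
        f \<in> hom (onc (shift D (rcone C)) K) (omap (at (push D (rcone_in C)) K) Y) Z)"

text \<open>The map \<open>Z\<^sub>x \<rightarrow> Z\<^sub>y\<close> in \<open>D\<^sup>\<one>(K)\<close> induced on \<open>Z \<in> D\<^sup>B(K)\<close> by an arrow \<open>g : x \<rightarrow> y\<close> of \<open>B\<close>.\<close>

definition transition ::
  "('k, 'o, 'm) pder \<Rightarrow> 'k scat \<Rightarrow> 'k scat \<Rightarrow> 'k elem \<Rightarrow> 'o \<Rightarrow> 'm" where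
  "transition D B K g Z = cmp (onn D (pt_ntr B g \<otimes>\<^sub>n id_ntr (id_func K))) Z"

text \<open>
  For \<open>f : c \<rightarrow> c'\<close> in \<open>C\<close> and \<open>Y\<close> on \<open>\<integral> F\<close>, the canonical map
  \<open>colim\<^bsub>F c\<^esub> i\<^sub>c\<^sup>* Y \<rightarrow> colim\<^bsub>F c\<^esub> (F f)\<^sup>* i\<^sub>c\<^sub>'\<^sup>* Y \<rightarrow> colim\<^bsub>F c'\<^esub> i\<^sub>c\<^sub>'\<^sup>* Y\<close>.
\<close>

definition fib_colim_transition ::
  "('k, 'o, 'm) pder \<Rightarrow> 'k diag \<Rightarrow> 'k scat \<Rightarrow> 'k elem \<Rightarrow> 'o \<Rightarrow> 'm" where
  "fib_colim_transition D F K f Y = (let c = Dom (Src F) f; c' = Cod (Src F) f in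
     colim_comparison D K (amap F f) (omap (at (pull D (fib F c')) K) Y)
     \<cdot>\<^bsub>onc (shift D one) K\<^esub>
     amap (at (colim D (omap F c)) K) (cmp (onn D (fib_ntr F f \<otimes>\<^sub>n id_ntr (id_func K))) Y))"

end

theory Submission
  imports Defs
begin

text \<open>
  Let \<open>E\<close> be the Grothendieck construction of \<open>F\<close> and \<open>G : E \<rightarrow> C\<^sup>\<rhd>\<close> the projection to \<open>C\<close> followed
  by the inclusion; put \<open>d = G\<^sub>! u\<^sup>*\<close>.  Since \<open>G\<close> factors through the inclusion of \<open>C\<close>, the cocone
  \<open>d X\<close> is colimiting.  All canonical maps in question are mates of squares in Cat times a parameter
  category, so that every coherence equation reduces to an equality of pasted 2-cells.

  By Der2 and Der4, a mate is invertible as soon as, over each point, the induced functors to the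
  slices of Der4 are inclusions of reflective subcategories: restriction along such a functor does not
  change colimits.  This applies to the square defining the structure cells of \<open>G\<^sub>!\<close>, to the fibre
  inclusion \<open>F c \<rightarrow> (G/c)\<close>, whose reflection sends \<open>((c', y), f : c' \<rightarrow> c)\<close> to \<open>F f y\<close>, and
  to \<open>E \<cong> (G/\<infinity>)\<close>.  Hence the value of \<open>d X\<close> at \<open>c\<close> is the colimit over \<open>F c\<close>, and its value at \<open>\<infinity>\<close>
  is the colimit over \<open>E\<close>, which homotopy finality of \<open>u\<close> identifies with that over \<open>A\<close>.
\<close>

section \<open>Categories, functors and transformations\<close>

text \<open>Left Kan extensions are Hilbert choices made separately for each functor, so no strict
  equation relates those along different functors. Hence equations are tested on adjuncts: a mate is
  determined by its composite with a unit, and colimits enter through universal maps to constant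
  diagrams, a property that survives restriction of the index category. A parameter change v : K' ->
  K is built into the mate of every square: the identity square yields the structure cells of a
  push, v = id yields a component at K, and pasting the two kinds in either order gives the
  modification axiom. Parameters do not spoil exactness, since the slice of u x K over (b, k) is the
  product of (u/b) and K/k, and K/k has a terminal object. Because F is a strict functor and all
  data are normalised, the reflections are retractions on the nose. At the apex the natural map runs
  from the colimit over E to the value of d X, against the direction asserted; the required
  isomorphism is therefore defined by an equation with that map, which is cancelled whenever a
  property has to be proved.\<close>

lemma mk_cat_simps [simp]:
  "Obj (mk_cat Ob Ar d c i k) = Ob"
  "Arr (mk_cat Ob Ar d c i k) = Ar"
  "f \<in> Ar \<Longrightarrow> Dom (mk_cat Ob Ar d c i k) f = d f"
  "f \<in> Ar \<Longrightarrow> Cod (mk_cat Ob Ar d c i k) f = c f"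
  "x \<in> Ob \<Longrightarrow> Ident (mk_cat Ob Ar d c i k) x = i x"
  "g \<in> Ar \<Longrightarrow> f \<in> Ar \<Longrightarrow> d g = c f \<Longrightarrow> g \<cdot>\<^bsub>mk_cat Ob Ar d c i k\<^esub> f = k g f"
  by (simp_all add: mk_cat_def)

text \<open>The premises concern only the raw operations on the carriers, which auto can decide for
  concrete encodings. The normalisation clause of \<open>category\<close> holds because restricting
  the data of \<open>mk_cat\<close> a second time changes nothing.\<close>

lemma category_mk_cat:
  assumes "\<And>f. f \<in> Ar \<Longrightarrow> d f \<in> Ob \<and> c f \<in> Ob"
    and "\<And>x. x \<in> Ob \<Longrightarrow> i x \<in> Ar \<and> d (i x) = x \<and> c (i x) = x"
    and "\<And>f g. f \<in> Ar \<Longrightarrow> g \<in> Ar \<Longrightarrow> d g = c f \<Longrightarrow> k g f \<in> Ar \<and> d (k g f) = d f \<and> c (k g f) = c g"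
    and "\<And>f. f \<in> Ar \<Longrightarrow> k (i (c f)) f = f \<and> k f (i (d f)) = f"
    and "\<And>f g h. f \<in> Ar \<Longrightarrow> g \<in> Ar \<Longrightarrow> h \<in> Ar \<Longrightarrow> d g = c f \<Longrightarrow> d h = c g \<Longrightarrow>
      k h (k g f) = k (k h g) f"
  shows "category (mk_cat Ob Ar d c i k)"
proof -
  have "mk_cat Ob Ar (restrict d Ar) (restrict c Ar) (restrict i Ob)
     (\<lambda>g f. if g \<in> Ar \<and> f \<in> Ar \<and> d g = c f then k g f else undefined) = mk_cat Ob Ar d c i k"
    unfolding mk_cat_def by (auto intro!: ext)
  then have "mk_cat (Obj (mk_cat Ob Ar d c i k)) (Arr (mk_cat Ob Ar d c i k)) (Dom (mk_cat Ob Ar d c i k))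
      (Cod (mk_cat Ob Ar d c i k)) (Ident (mk_cat Ob Ar d c i k)) (Comp (mk_cat Ob Ar d c i k))
    = mk_cat Ob Ar d c i k"
    by (simp add: mk_cat_def)
  then show ?thesis
    unfolding category_def hom_def
    by (intro conjI ballI allI impI; (assumption | clarsimp simp add: assms))
qed

lemma hom_iff: "f \<in> hom A x y \<longleftrightarrow> f \<in> Arr A \<and> Dom A f = x \<and> Cod A f = y"
  by (simp add: hom_def)

text \<open>Phrased through \<open>Dom\<close> and \<open>Cod\<close> instead of hom-sets, so that
  simp can discharge the side conditions without guessing intermediate objects. The
  \<open>hom_\<close> variants that follow serve the opposite purpose: long composites are assembled
  from them by explicit instantiation.\<close>

lemma category_simps:
  assumes "category A"
  shows "f \<in> Arr A \<Longrightarrow> Dom A f \<in> Obj A"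
    and "f \<in> Arr A \<Longrightarrow> Cod A f \<in> Obj A"
    and "x \<in> Obj A \<Longrightarrow> Ident A x \<in> Arr A"
    and "x \<in> Obj A \<Longrightarrow> Dom A (Ident A x) = x"
    and "x \<in> Obj A \<Longrightarrow> Cod A (Ident A x) = x"
    and "f \<in> Arr A \<Longrightarrow> g \<in> Arr A \<Longrightarrow> Dom A g = Cod A f \<Longrightarrow> g \<cdot>\<^bsub>A\<^esub> f \<in> Arr A"
    and "f \<in> Arr A \<Longrightarrow> g \<in> Arr A \<Longrightarrow> Dom A g = Cod A f \<Longrightarrow> Dom A (g \<cdot>\<^bsub>A\<^esub> f) = Dom A f"
    and "f \<in> Arr A \<Longrightarrow> g \<in> Arr A \<Longrightarrow> Dom A g = Cod A f \<Longrightarrow> Cod A (g \<cdot>\<^bsub>A\<^esub> f) = Cod A g"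
    and "f \<in> Arr A \<Longrightarrow> Cod A f = y \<Longrightarrow> Ident A y \<cdot>\<^bsub>A\<^esub> f = f"
    and "f \<in> Arr A \<Longrightarrow> Dom A f = x \<Longrightarrow> f \<cdot>\<^bsub>A\<^esub> Ident A x = f"
    and "f \<in> Arr A \<Longrightarrow> g \<in> Arr A \<Longrightarrow> h \<in> Arr A \<Longrightarrow> Dom A g = Cod A f \<Longrightarrow> Dom A h = Cod A g \<Longrightarrow>
      h \<cdot>\<^bsub>A\<^esub> (g \<cdot>\<^bsub>A\<^esub> f) = h \<cdot>\<^bsub>A\<^esub> g \<cdot>\<^bsub>A\<^esub> f"
proof -
  have n: "mk_cat (Obj A) (Arr A) (Dom A) (Cod A) (Ident A) (Comp A) = A"
    using assms by (simp add: category_def)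
  show "f \<in> Arr A \<Longrightarrow> Dom A f \<in> Obj A" "f \<in> Arr A \<Longrightarrow> Cod A f \<in> Obj A"
    "x \<in> Obj A \<Longrightarrow> Ident A x \<in> Arr A" "x \<in> Obj A \<Longrightarrow> Dom A (Ident A x) = x"
    "x \<in> Obj A \<Longrightarrow> Cod A (Ident A x) = x"
    using assms unfolding category_def hom_def by auto
  have "f \<in> Arr A \<Longrightarrow> g \<in> Arr A \<Longrightarrow> Dom A g = Cod A f \<Longrightarrow> g \<cdot>\<^bsub>A\<^esub> f \<in> hom A (Dom A f) (Cod A g)"
    using assms unfolding category_def hom_def by auto
  then show "f \<in> Arr A \<Longrightarrow> g \<in> Arr A \<Longrightarrow> Dom A g = Cod A f \<Longrightarrow> g \<cdot>\<^bsub>A\<^esub> f \<in> Arr A"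
    "f \<in> Arr A \<Longrightarrow> g \<in> Arr A \<Longrightarrow> Dom A g = Cod A f \<Longrightarrow> Dom A (g \<cdot>\<^bsub>A\<^esub> f) = Dom A f"
    "f \<in> Arr A \<Longrightarrow> g \<in> Arr A \<Longrightarrow> Dom A g = Cod A f \<Longrightarrow> Cod A (g \<cdot>\<^bsub>A\<^esub> f) = Cod A g"
    by (simp_all add: hom_def)
  show "f \<in> Arr A \<Longrightarrow> Cod A f = y \<Longrightarrow> Ident A y \<cdot>\<^bsub>A\<^esub> f = f"
    "f \<in> Arr A \<Longrightarrow> Dom A f = x \<Longrightarrow> f \<cdot>\<^bsub>A\<^esub> Ident A x = f"
    "f \<in> Arr A \<Longrightarrow> g \<in> Arr A \<Longrightarrow> h \<in> Arr A \<Longrightarrow> Dom A g = Cod A f \<Longrightarrow> Dom A h = Cod A g \<Longrightarrow>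
      h \<cdot>\<^bsub>A\<^esub> (g \<cdot>\<^bsub>A\<^esub> f) = h \<cdot>\<^bsub>A\<^esub> g \<cdot>\<^bsub>A\<^esub> f"
    using assms unfolding category_def hom_def by auto
qed

lemma hom_comp: "category A \<Longrightarrow> f \<in> hom A x y \<Longrightarrow> g \<in> hom A y z \<Longrightarrow> g \<cdot>\<^bsub>A\<^esub> f \<in> hom A x z"
  by (simp add: hom_iff category_simps)

lemma hom_assoc: "category A \<Longrightarrow> f \<in> hom A w x \<Longrightarrow> g \<in> hom A x y \<Longrightarrow> h \<in> hom A y z \<Longrightarrow>
    h \<cdot>\<^bsub>A\<^esub> (g \<cdot>\<^bsub>A\<^esub> f) = h \<cdot>\<^bsub>A\<^esub> g \<cdot>\<^bsub>A\<^esub> f"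
  by (simp add: hom_iff category_simps)

lemma hom_ident: "category A \<Longrightarrow> x \<in> Obj A \<Longrightarrow> Ident A x \<in> hom A x x"
  by (simp add: hom_iff category_simps)

lemma hom_unit:
  "category A \<Longrightarrow> f \<in> hom A x y \<Longrightarrow> Ident A y \<cdot>\<^bsub>A\<^esub> f = f"
  "category A \<Longrightarrow> f \<in> hom A x y \<Longrightarrow> f \<cdot>\<^bsub>A\<^esub> Ident A x = f"
  by (simp_all add: hom_iff category_simps)

lemma hom_Obj: "category A \<Longrightarrow> f \<in> hom A x y \<Longrightarrow> x \<in> Obj A" "category A \<Longrightarrow> f \<in> hom A x y \<Longrightarrow> y \<in> Obj A"
  by (auto simp add: hom_iff category_simps)

lemma iso_iff: "f \<in> hom A x y \<Longrightarrow>
    iso A f \<longleftrightarrow> (\<exists>g \<in> hom A y x. g \<cdot>\<^bsub>A\<^esub> f = Ident A x \<and> f \<cdot>\<^bsub>A\<^esub> g = Ident A y)"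
  by (auto simp add: iso_def hom_iff)

lemma iso_comp:
  assumes A: "category A" and f: "f \<in> hom A x y" and g: "g \<in> hom A y z" and "iso A f" "iso A g"
  shows "iso A (g \<cdot>\<^bsub>A\<^esub> f)"
proof -
  obtain f' where f': "f' \<in> hom A y x" "f' \<cdot>\<^bsub>A\<^esub> f = Ident A x" "f \<cdot>\<^bsub>A\<^esub> f' = Ident A y"
    using iso_iff[OF f] assms by auto
  obtain g' where g': "g' \<in> hom A z y" "g' \<cdot>\<^bsub>A\<^esub> g = Ident A y" "g \<cdot>\<^bsub>A\<^esub> g' = Ident A z"
    using iso_iff[OF g] assms by auto
  have "(f' \<cdot>\<^bsub>A\<^esub> g') \<cdot>\<^bsub>A\<^esub> (g \<cdot>\<^bsub>A\<^esub> f) = f' \<cdot>\<^bsub>A\<^esub> ((g' \<cdot>\<^bsub>A\<^esub> g) \<cdot>\<^bsub>A\<^esub> f)"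
    using hom_assoc[OF A f g g'(1)] hom_assoc[OF A hom_comp[OF A f g] g'(1) f'(1)] by simp
  moreover have "(g \<cdot>\<^bsub>A\<^esub> f) \<cdot>\<^bsub>A\<^esub> (f' \<cdot>\<^bsub>A\<^esub> g') = g \<cdot>\<^bsub>A\<^esub> ((f \<cdot>\<^bsub>A\<^esub> f') \<cdot>\<^bsub>A\<^esub> g')"
    using hom_assoc[OF A g'(1) f'(1) f] hom_assoc[OF A hom_comp[OF A g'(1) f'(1)] f g] by simp
  ultimately show ?thesis
    using f' g' hom_unit[OF A f] hom_unit[OF A g'(1)] iso_iff[OF hom_comp[OF A f g]]
      hom_comp[OF A g'(1) f'(1)] by auto
qed

text \<open>Invertible arrows are epimorphisms. Maps out of the apex of the cocone are compared in
  this way, after precomposition with a known isomorphism.\<close>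

lemma iso_cancel_right:
  assumes A: "category A" and f: "f \<in> hom A x y" and i: "iso A f"
    and g: "g \<in> hom A y z" "g' \<in> hom A y z" and e: "g \<cdot>\<^bsub>A\<^esub> f = g' \<cdot>\<^bsub>A\<^esub> f"
  shows "g = g'"
proof -
  obtain f' where f': "f' \<in> hom A y x" "f' \<cdot>\<^bsub>A\<^esub> f = Ident A x" "f \<cdot>\<^bsub>A\<^esub> f' = Ident A y"
    using iso_iff[OF f] i by auto
  have "g \<cdot>\<^bsub>A\<^esub> f \<cdot>\<^bsub>A\<^esub> f' = g' \<cdot>\<^bsub>A\<^esub> f \<cdot>\<^bsub>A\<^esub> f'" using e by simp
  then show ?thesis
    using hom_assoc[OF A f'(1) f g(1)] hom_assoc[OF A f'(1) f g(2)] f'(3) hom_unit[OF A g(1)] hom_unit[OF A g(2)]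
    by simp
qed

text \<open>One half of two-out-of-three, since g is the composite of g f with the inverse of f.
  When squares are pasted, f is the mate of a test square, g f the mate of the pasted square and g
  the map under study.\<close>

lemma iso_cancel_left_factor:
  assumes A: "category A" and f: "f \<in> hom A x y" and g: "g \<in> hom A y z" and i: "iso A f" and j: "iso A (g \<cdot>\<^bsub>A\<^esub> f)"
  shows "iso A g"
proof -
  obtain f' where f': "f' \<in> hom A y x" "f' \<cdot>\<^bsub>A\<^esub> f = Ident A x" "f \<cdot>\<^bsub>A\<^esub> f' = Ident A y"
    using iso_iff[OF f] i by auto
  then have "iso A f'" using iso_iff[OF f'(1)] f by auto
  then have "iso A (g \<cdot>\<^bsub>A\<^esub> f \<cdot>\<^bsub>A\<^esub> f')" by (rule iso_comp[OF A f'(1) hom_comp[OF A f g] _ j])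
  then show ?thesis using hom_assoc[OF A f'(1) f g] f'(3) hom_unit(2)[OF A g] by simp
qed

section \<open>Functors and their strict composition\<close>

lemma mk_func_simps [simp]:
  "Src (mk_func A B fo fa) = A" "Tgt (mk_func A B fo fa) = B"
  "x \<in> Obj A \<Longrightarrow> omap (mk_func A B fo fa) x = fo x"
  "f \<in> Arr A \<Longrightarrow> amap (mk_func A B fo fa) f = fa f"
  by (simp_all add: mk_func_def)

lemma is_func_mk:
  assumes "category A" "category B"
    and "\<And>x. x \<in> Obj A \<Longrightarrow> fo x \<in> Obj B"
    and "\<And>f. f \<in> Arr A \<Longrightarrow> fa f \<in> Arr B \<and> Dom B (fa f) = fo (Dom A f) \<and> Cod B (fa f) = fo (Cod A f)"
    and "\<And>x. x \<in> Obj A \<Longrightarrow> fa (Ident A x) = Ident B (fo x)"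
    and "\<And>f g. f \<in> Arr A \<Longrightarrow> g \<in> Arr A \<Longrightarrow> Dom A g = Cod A f \<Longrightarrow> fa (g \<cdot>\<^bsub>A\<^esub> f) = fa g \<cdot>\<^bsub>B\<^esub> fa f"
  shows "is_func (mk_func A B fo fa) A B"
proof -
  have "mk_func A B (omap (mk_func A B fo fa)) (amap (mk_func A B fo fa)) = mk_func A B fo fa"
    by (simp add: mk_func_def)
  then show ?thesis
    unfolding is_func_def using assms by (auto simp add: hom_iff category_simps)
qed

lemma is_funcD:
  assumes "is_func F A B"
  shows "category A" "category B" "Src F = A" "Tgt F = B"
    and "x \<in> Obj A \<Longrightarrow> omap F x \<in> Obj B"
    and "f \<in> Arr A \<Longrightarrow> amap F f \<in> Arr B"
    and "f \<in> Arr A \<Longrightarrow> Dom B (amap F f) = omap F (Dom A f)"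
    and "f \<in> Arr A \<Longrightarrow> Cod B (amap F f) = omap F (Cod A f)"
    and "x \<in> Obj A \<Longrightarrow> amap F (Ident A x) = Ident B (omap F x)"
    and "f \<in> Arr A \<Longrightarrow> g \<in> Arr A \<Longrightarrow> Dom A g = Cod A f \<Longrightarrow> amap F (g \<cdot>\<^bsub>A\<^esub> f) = amap F g \<cdot>\<^bsub>B\<^esub> amap F f"
proof -
  have n: "mk_func A B (omap F) (amap F) = F" using assms by (simp add: is_func_def)
  then show "Src F = A" "Tgt F = B" by (metis mk_func_simps(1), metis mk_func_simps(2))
  have "f \<in> Arr A \<Longrightarrow> amap F f \<in> hom B (omap F (Dom A f)) (omap F (Cod A f))"
    using assms unfolding is_func_def by (metis (mono_tags, lifting) hom_iff)
  then show "f \<in> Arr A \<Longrightarrow> amap F f \<in> Arr B" "f \<in> Arr A \<Longrightarrow> Dom B (amap F f) = omap F (Dom A f)"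
    "f \<in> Arr A \<Longrightarrow> Cod B (amap F f) = omap F (Cod A f)"
    by (simp_all add: hom_iff)
  show "category A" "category B" "x \<in> Obj A \<Longrightarrow> omap F x \<in> Obj B"
    "x \<in> Obj A \<Longrightarrow> amap F (Ident A x) = Ident B (omap F x)"
    using assms by (auto simp add: is_func_def)
  show "f \<in> Arr A \<Longrightarrow> g \<in> Arr A \<Longrightarrow> Dom A g = Cod A f \<Longrightarrow> amap F (g \<cdot>\<^bsub>A\<^esub> f) = amap F g \<cdot>\<^bsub>B\<^esub> amap F f"
    using assms unfolding is_func_def hom_iff by blast
qed

lemma is_func_hom: "is_func F A B \<Longrightarrow> f \<in> hom A x y \<Longrightarrow> amap F f \<in> hom B (omap F x) (omap F y)"
  by (auto simp add: hom_iff is_funcD)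

lemma is_func_comp: "is_func F A B \<Longrightarrow> f \<in> hom A x y \<Longrightarrow> g \<in> hom A y z \<Longrightarrow>
    amap F (g \<cdot>\<^bsub>A\<^esub> f) = amap F g \<cdot>\<^bsub>B\<^esub> amap F f"
  by (auto simp add: hom_iff is_funcD)

text \<open>Off the carriers both maps are \<open>undefined\<close>, and source and target are
  fields of the record, so agreement on the carriers is equality in HOL. All strict identities
  between composites of functors rest on this.\<close>

lemma func_eqI:
  assumes F: "is_func F A B" and G: "is_func G A B"
    and o: "\<And>x. x \<in> Obj A \<Longrightarrow> omap F x = omap G x" and a: "\<And>f. f \<in> Arr A \<Longrightarrow> amap F f = amap G f"
  shows "F = G"
proof -
  have "mk_func A B (omap F) (amap F) = mk_func A B (omap G) (amap G)"
    using o a by (auto simp add: mk_func_def restrict_def)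
  then show ?thesis using F G by (simp add: is_func_def)
qed

lemma is_func_id: "category A \<Longrightarrow> is_func (id_func A) A A"
  unfolding id_func_def by (rule is_func_mk) (auto simp add: category_simps)

lemma id_func_simps [simp]:
  "Src (id_func A) = A" "Tgt (id_func A) = A"
  "x \<in> Obj A \<Longrightarrow> omap (id_func A) x = x" "f \<in> Arr A \<Longrightarrow> amap (id_func A) f = f"
  by (simp_all add: id_func_def)

lemma comp_func_simps [simp]:
  "Src (G \<odot> F) = Src F" "Tgt (G \<odot> F) = Tgt G"
  "x \<in> Obj (Src F) \<Longrightarrow> omap (G \<odot> F) x = omap G (omap F x)"
  "f \<in> Arr (Src F) \<Longrightarrow> amap (G \<odot> F) f = amap G (amap F f)"
  by (simp_all add: comp_func_def)

lemma is_func_comp_func: "is_func F A B \<Longrightarrow> is_func G B C \<Longrightarrow> is_func (G \<odot> F) A C"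
  unfolding comp_func_def by (simp add: is_funcD(3,4), rule is_func_mk) (auto simp add: is_funcD)

lemma comp_func_assoc: 
  assumes "is_func F A B" "is_func G B C" "is_func H C E"
  shows "H \<odot> (G \<odot> F) = H \<odot> G \<odot> F"
  by (rule func_eqI[OF is_func_comp_func[OF is_func_comp_func[OF assms(1,2)] assms(3)]
        is_func_comp_func[OF assms(1) is_func_comp_func[OF assms(2,3)]]])
    (simp_all add: is_funcD[OF assms(1)] is_funcD(3)[OF assms(2)])

lemma comp_func_id:
  assumes F: "is_func F A B"
  shows "F \<odot> id_func A = F" "id_func B \<odot> F = F"
  by (rule func_eqI[of _ A B]; simp add: is_funcD[OF F] F is_func_comp_func[OF F is_func_id]
      is_func_comp_func[OF is_func_id F])+

section \<open>Natural transformations with vertical and horizontal composition\<close>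

lemma mk_ntr_simps [simp]:
  "NSrc (mk_ntr F G t) = F" "NTgt (mk_ntr F G t) = G"
  "x \<in> Obj (Src F) \<Longrightarrow> cmp (mk_ntr F G t) x = t x"
  by (simp_all add: mk_ntr_def)

lemma is_ntr_mk:
  assumes "is_func F A B" "is_func G A B"
    and "\<And>x. x \<in> Obj A \<Longrightarrow> t x \<in> hom B (omap F x) (omap G x)"
    and "\<And>f. f \<in> Arr A \<Longrightarrow> t (Cod A f) \<cdot>\<^bsub>B\<^esub> amap F f = amap G f \<cdot>\<^bsub>B\<^esub> t (Dom A f)"
  shows "is_ntr (mk_ntr F G t) F G"
proof -
  note F = is_funcD[OF assms(1)] and G = is_funcD[OF assms(2)]
  have "mk_ntr F G (cmp (mk_ntr F G t)) = mk_ntr F G t" by (simp add: mk_ntr_def)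
  moreover have "f \<in> hom A x y \<Longrightarrow> t y \<cdot>\<^bsub>B\<^esub> amap F f = amap G f \<cdot>\<^bsub>B\<^esub> t x" for x y f
    using assms(4)[of f] by (auto simp add: hom_iff)
  ultimately show ?thesis
    unfolding is_ntr_def using assms(1-3) F(1-4) G(1-4) hom_Obj[OF F(1)] by (auto; metis mk_ntr_simps(3))
qed

lemma is_ntrD:
  assumes "is_ntr \<tau> F G" and F: "is_func F A B"
  shows "is_func G A B" "NSrc \<tau> = F" "NTgt \<tau> = G"
    and "x \<in> Obj A \<Longrightarrow> cmp \<tau> x \<in> hom B (omap F x) (omap G x)"
    and "x \<in> Obj A \<Longrightarrow> cmp \<tau> x \<in> Arr B"
    and "x \<in> Obj A \<Longrightarrow> Dom B (cmp \<tau> x) = omap F x"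
    and "x \<in> Obj A \<Longrightarrow> Cod B (cmp \<tau> x) = omap G x"
    and "f \<in> Arr A \<Longrightarrow> cmp \<tau> (Cod A f) \<cdot>\<^bsub>B\<^esub> amap F f = amap G f \<cdot>\<^bsub>B\<^esub> cmp \<tau> (Dom A f)"
proof -
  note n = assms(1)[unfolded is_ntr_def is_funcD(3,4)[OF F]]
  show "is_func G A B" using n by blast
  have m: "mk_ntr F G (cmp \<tau>) = \<tau>" using n by blast
  show "NSrc \<tau> = F" "NTgt \<tau> = G"
    using m mk_ntr_simps(1,2) by metis+
  show h: "x \<in> Obj A \<Longrightarrow> cmp \<tau> x \<in> hom B (omap F x) (omap G x)" for x using n by blast
  show "x \<in> Obj A \<Longrightarrow> cmp \<tau> x \<in> Arr B" "x \<in> Obj A \<Longrightarrow> Dom B (cmp \<tau> x) = omap F x"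
    "x \<in> Obj A \<Longrightarrow> Cod B (cmp \<tau> x) = omap G x" using h by (auto simp add: hom_iff)
  show "f \<in> Arr A \<Longrightarrow> cmp \<tau> (Cod A f) \<cdot>\<^bsub>B\<^esub> amap F f = amap G f \<cdot>\<^bsub>B\<^esub> cmp \<tau> (Dom A f)"
    using n by (auto simp add: hom_iff)
qed

lemma ntr_eqI:
  assumes "is_ntr \<sigma> F G" "is_ntr \<tau> F G" and "\<And>x. x \<in> Obj (Src F) \<Longrightarrow> cmp \<sigma> x = cmp \<tau> x"
  shows "\<sigma> = \<tau>"
proof -
  have "mk_ntr F G (cmp \<sigma>) = mk_ntr F G (cmp \<tau>)"
    using assms(3) by (auto simp add: mk_ntr_def restrict_def)
  then show ?thesis using assms(1,2) by (simp add: is_ntr_def)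
qed

lemma id_ntr_simps [simp]:
  "NSrc (id_ntr F) = F" "NTgt (id_ntr F) = F"
  "x \<in> Obj (Src F) \<Longrightarrow> cmp (id_ntr F) x = Ident (Tgt F) (omap F x)"
  by (simp_all add: id_ntr_def)

lemma is_ntr_id: assumes F: "is_func F A B" shows "is_ntr (id_ntr F) F F"
  unfolding id_ntr_def is_funcD(3,4)[OF F]
  by (rule is_ntr_mk[OF F F]) (use is_funcD[OF F] in \<open>auto simp add: category_simps hom_iff\<close>)

lemma vcomp_simps [simp]:
  "NSrc (\<sigma> \<bullet> \<tau>) = NSrc \<tau>" "NTgt (\<sigma> \<bullet> \<tau>) = NTgt \<sigma>"
  "x \<in> Obj (Src (NSrc \<tau>)) \<Longrightarrow> cmp (\<sigma> \<bullet> \<tau>) x = cmp \<sigma> x \<cdot>\<^bsub>Tgt (NSrc \<tau>)\<^esub> cmp \<tau> x"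
  by (simp_all add: vcomp_def)

lemma is_ntr_vcomp:
  assumes F: "is_func F A B" and t: "is_ntr \<tau> F G" and s: "is_ntr \<sigma> G H"
  shows "is_ntr (\<sigma> \<bullet> \<tau>) F H"
proof -
  note tD = is_ntrD[OF t F] and sD = is_ntrD[OF s is_ntrD(1)[OF t F]]
  note FD = is_funcD[OF F] and GD = is_funcD[OF tD(1)] and HD = is_funcD[OF sD(1)]
  note B = category_simps[OF FD(2)] and A = category_simps[OF FD(1)]
  show ?thesis
    unfolding vcomp_def tD sD FD
  proof (rule is_ntr_mk[OF F sD(1)])
    fix f assume f: "f \<in> Arr A"
    have "cmp \<sigma> (Cod A f) \<cdot>\<^bsub>B\<^esub> cmp \<tau> (Cod A f) \<cdot>\<^bsub>B\<^esub> amap F f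
      = cmp \<sigma> (Cod A f) \<cdot>\<^bsub>B\<^esub> (cmp \<tau> (Cod A f) \<cdot>\<^bsub>B\<^esub> amap F f)"
      using f by (simp add: FD GD tD(5-7) sD(5-7) A B del: tD(8))
    also have "\<dots> = (cmp \<sigma> (Cod A f) \<cdot>\<^bsub>B\<^esub> amap G f) \<cdot>\<^bsub>B\<^esub> cmp \<tau> (Dom A f)"
      using f by (simp add: FD GD tD(5-8) sD(5-7) A B)
    also have "\<dots> = amap H f \<cdot>\<^bsub>B\<^esub> (cmp \<sigma> (Dom A f) \<cdot>\<^bsub>B\<^esub> cmp \<tau> (Dom A f))"
      using f by (simp add: FD GD HD tD(5-7) sD(5-8) A B)
    finally show "cmp \<sigma> (Cod A f) \<cdot>\<^bsub>B\<^esub> cmp \<tau> (Cod A f) \<cdot>\<^bsub>B\<^esub> amap F f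
      = amap H f \<cdot>\<^bsub>B\<^esub> (cmp \<sigma> (Dom A f) \<cdot>\<^bsub>B\<^esub> cmp \<tau> (Dom A f))" .
  qed (simp add: hom_iff FD GD HD tD sD A B)
qed

lemma hcomp_simps [simp]:
  "NSrc (\<beta> \<star> \<alpha>) = NSrc \<beta> \<odot> NSrc \<alpha>" "NTgt (\<beta> \<star> \<alpha>) = NTgt \<beta> \<odot> NTgt \<alpha>"
  "x \<in> Obj (Src (NSrc \<alpha>)) \<Longrightarrow>
    cmp (\<beta> \<star> \<alpha>) x = cmp \<beta> (omap (NTgt \<alpha>) x) \<cdot>\<^bsub>Tgt (NSrc \<beta>)\<^esub> amap (NSrc \<beta>) (cmp \<alpha> x)"
  by (simp_all add: hcomp_def)

lemma is_ntr_hcomp: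
  assumes F: "is_func F A B" and H: "is_func H B C" and a: "is_ntr \<alpha> F G" and b: "is_ntr \<beta> H K"
  shows "is_ntr (\<beta> \<star> \<alpha>) (H \<odot> F) (K \<odot> G)"
proof -
  note aD = is_ntrD[OF a F] and bD = is_ntrD[OF b H]
  note FD = is_funcD[OF F] and GD = is_funcD[OF aD(1)] and HD = is_funcD[OF H] and KD = is_funcD[OF bD(1)]
  note A = category_simps[OF FD(1)] and B = category_simps[OF FD(2)] and C = category_simps[OF HD(2)]
  \<comment> \<open>Naturality of \<beta> with the endpoints as separate variables, so that it
    applies at \<open>amap G f\<close>, whose endpoints appear already rewritten to values of
    G.\<close>
  have b8: "g \<in> Arr B \<Longrightarrow> Dom B g = x \<Longrightarrow> Cod B g = y \<Longrightarrow> cmp \<beta> y \<cdot>\<^bsub>C\<^esub> amap H g = amap K g \<cdot>\<^bsub>C\<^esub> cmp \<beta> x" for g x y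
    using bD(8) by blast
  show ?thesis
    unfolding hcomp_def aD(2,3) bD(2,3) HD(3,4)
  proof (rule is_ntr_mk[OF is_func_comp_func[OF F H] is_func_comp_func[OF aD(1) bD(1)]])
    fix f assume f: "f \<in> Arr A"
    note s = f FD(5-8) GD(5-8) HD(5-8) KD(5-8) aD(5-7) bD(5-7) A B C
    have "cmp \<beta> (omap G (Cod A f)) \<cdot>\<^bsub>C\<^esub> amap H (cmp \<alpha> (Cod A f)) \<cdot>\<^bsub>C\<^esub> amap H (amap F f)
       = cmp \<beta> (omap G (Cod A f)) \<cdot>\<^bsub>C\<^esub> (amap H (cmp \<alpha> (Cod A f)) \<cdot>\<^bsub>C\<^esub> amap H (amap F f))"
      by (simp add: s)
    also have "\<dots> = cmp \<beta> (omap G (Cod A f)) \<cdot>\<^bsub>C\<^esub> amap H (cmp \<alpha> (Cod A f) \<cdot>\<^bsub>B\<^esub> amap F f)"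
      by (subst HD(10)) (simp_all add: s)
    also have "\<dots> = cmp \<beta> (omap G (Cod A f)) \<cdot>\<^bsub>C\<^esub> amap H (amap G f \<cdot>\<^bsub>B\<^esub> cmp \<alpha> (Dom A f))"
      using f by (simp add: aD(8))
    also have "\<dots> = cmp \<beta> (omap G (Cod A f)) \<cdot>\<^bsub>C\<^esub> amap H (amap G f) \<cdot>\<^bsub>C\<^esub> amap H (cmp \<alpha> (Dom A f))"
      by (subst HD(10)) (simp_all add: s)
    also have "\<dots> = amap K (amap G f) \<cdot>\<^bsub>C\<^esub> cmp \<beta> (omap G (Dom A f)) \<cdot>\<^bsub>C\<^esub> amap H (cmp \<alpha> (Dom A f))"
      by (subst b8[of "amap G f"]) (simp_all add: s)
    finally show "cmp \<beta> (omap G (Cod A f)) \<cdot>\<^bsub>C\<^esub> amap H (cmp \<alpha> (Cod A f)) \<cdot>\<^bsub>C\<^esub> amap (H \<odot> F) f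
       = amap (K \<odot> G) f \<cdot>\<^bsub>C\<^esub> (cmp \<beta> (omap G (Dom A f)) \<cdot>\<^bsub>C\<^esub> amap H (cmp \<alpha> (Dom A f)))"
      by (simp add: s FD(3) GD(3))
  qed (simp add: hom_iff FD GD HD KD aD bD A B C)
qed

lemma id_ntr_hcomp:
  assumes u: "is_func u A B" and v: "is_func v B C"
  shows "id_ntr v \<star> id_ntr u = id_ntr (v \<odot> u)"
  by (rule ntr_eqI[OF is_ntr_hcomp[OF u v is_ntr_id[OF u] is_ntr_id[OF v]] is_ntr_id[OF is_func_comp_func[OF u v]]])
    (simp add: is_funcD[OF u] is_funcD[OF v] category_simps[OF is_funcD(2)[OF v]])

lemma vcomp_id:
  assumes F: "is_func F A B" and t: "is_ntr \<tau> F G"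
  shows "\<tau> \<bullet> id_ntr F = \<tau>" "id_ntr G \<bullet> \<tau> = \<tau>"
proof -
  note tD = is_ntrD[OF t F]
  show "\<tau> \<bullet> id_ntr F = \<tau>"
    by (rule ntr_eqI[OF is_ntr_vcomp[OF F is_ntr_id[OF F] t] t])
      (simp add: is_funcD[OF F] tD category_simps[OF is_funcD(2)[OF F]])
  show "id_ntr G \<bullet> \<tau> = \<tau>"
    by (rule ntr_eqI[OF is_ntr_vcomp[OF F t is_ntr_id[OF tD(1)]] t])
      (simp add: is_funcD[OF F] is_funcD(3,4)[OF tD(1)] tD(2-7) category_simps[OF is_funcD(2)[OF F]])
qed

lemma hcomp_id_func:
  assumes F: "is_func F A B" and t: "is_ntr \<tau> F G"
  shows "\<tau> \<star> id_ntr (id_func A) = \<tau>" "id_ntr (id_func B) \<star> \<tau> = \<tau>"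
proof -
  note tD = is_ntrD[OF t F]
  note i = is_func_id[OF is_funcD(1)[OF F]] and j = is_func_id[OF is_funcD(2)[OF F]]
  note G = tD(1)
  have 1: "is_ntr (\<tau> \<star> id_ntr (id_func A)) F G"
    using is_ntr_hcomp[OF i F is_ntr_id[OF i] t] by (simp add: comp_func_id[OF F] comp_func_id[OF G])
  show "\<tau> \<star> id_ntr (id_func A) = \<tau>"
    by (rule ntr_eqI[OF 1 t]) (simp add: is_funcD[OF F] tD category_simps[OF is_funcD(1)[OF F]] category_simps[OF is_funcD(2)[OF F]])
  have 2: "is_ntr (id_ntr (id_func B) \<star> \<tau>) F G"
    using is_ntr_hcomp[OF F j t is_ntr_id[OF j]] by (simp add: comp_func_id[OF F] comp_func_id[OF G])
  show "id_ntr (id_func B) \<star> \<tau> = \<tau>"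
    by (rule ntr_eqI[OF 2 t]) (simp add: is_funcD[OF F] is_funcD[OF G] tD(2-7) category_simps[OF is_funcD(2)[OF F]])
qed

section \<open>Small categories\<close>

lemma smallnessD:
  assumes "smallness sm"
  shows "sm {}" "sm S \<Longrightarrow> sm (insert x S)" "sm S \<Longrightarrow> T \<subseteq> S \<Longrightarrow> sm T" "sm S \<Longrightarrow> sm (f ` S)"
    and "sm S \<Longrightarrow> (\<And>i. i \<in> S \<Longrightarrow> sm (X i)) \<Longrightarrow> sm (\<Union>i\<in>S. X i)"
proof -
  note a = assms[unfolded smallness_def]
  show "sm {}" using a by (rule conjunct1)
  show "sm S \<Longrightarrow> sm (insert x S)" using conjunct1[OF conjunct2[OF a]] by simp
  show "sm S \<Longrightarrow> T \<subseteq> S \<Longrightarrow> sm T" using conjunct1[OF conjunct2[OF conjunct2[OF a]]] by simp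
  show "sm S \<Longrightarrow> sm (f ` S)" using conjunct1[OF conjunct2[OF conjunct2[OF conjunct2[OF a]]]] by simp
  show "sm S \<Longrightarrow> (\<And>i. i \<in> S \<Longrightarrow> sm (X i)) \<Longrightarrow> sm (\<Union>i\<in>S. X i)"
    using conjunct2[OF conjunct2[OF conjunct2[OF conjunct2[OF a]]]] by simp
qed

lemma small_Un: assumes "smallness sm" "sm S" "sm T" shows "sm (S \<union> T)"
proof -
  \<comment> \<open>The axioms of \<open>smallness\<close> provide unions of small families only. A
    binary union is one of these, indexed by the two distinct elements \<open>Pt\<close> and
    \<open>Old Pt\<close>.\<close>
  have two: "sm {Pt, Old Pt}" using smallnessD(1,2)[OF assms(1)] by simp
  then show ?thesis
    using smallnessD(5)[OF assms(1) two, of "\<lambda>i. if i = Pt then S else T"] assms by (simp add: Un_commute)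
qed

lemma small_pairs:
  assumes "smallness sm" "sm S" "\<And>a. a \<in> S \<Longrightarrow> sm (T a)"
  shows "sm {Pair a b | a b. a \<in> S \<and> b \<in> T a}"
proof -
  have "sm (\<Union>a\<in>S. Pair a ` T a)"
    by (rule smallnessD(5)[OF assms(1,2)]) (simp add: assms smallnessD(4)[OF assms(1)])
  moreover have "(\<Union>a\<in>S. Pair a ` T a) = {Pair a b | a b. a \<in> S \<and> b \<in> T a}" by auto
  ultimately show ?thesis by simp
qed

section \<open>Products of categories, functors and transformations\<close>

lemma category_prod_cat: "category A \<Longrightarrow> category B \<Longrightarrow> category (A \<otimes> B)"
  unfolding prod_cat_def by (rule category_mk_cat) (auto simp add: category_simps)

lemma prod_cat_simps [simp]:
  "Pair a b \<in> Obj (A \<otimes> B) \<longleftrightarrow> a \<in> Obj A \<and> b \<in> Obj B"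
  "Pair f g \<in> Arr (A \<otimes> B) \<longleftrightarrow> f \<in> Arr A \<and> g \<in> Arr B"
  "f \<in> Arr A \<Longrightarrow> g \<in> Arr B \<Longrightarrow> Dom (A \<otimes> B) (Pair f g) = Pair (Dom A f) (Dom B g)"
  "f \<in> Arr A \<Longrightarrow> g \<in> Arr B \<Longrightarrow> Cod (A \<otimes> B) (Pair f g) = Pair (Cod A f) (Cod B g)"
  "a \<in> Obj A \<Longrightarrow> b \<in> Obj B \<Longrightarrow> Ident (A \<otimes> B) (Pair a b) = Pair (Ident A a) (Ident B b)"
  "f \<in> Arr A \<Longrightarrow> g \<in> Arr B \<Longrightarrow> f' \<in> Arr A \<Longrightarrow> g' \<in> Arr B \<Longrightarrow> Dom A f' = Cod A f \<Longrightarrow>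
    Dom B g' = Cod B g \<Longrightarrow> Pair f' g' \<cdot>\<^bsub>A \<otimes> B\<^esub> Pair f g = Pair (f' \<cdot>\<^bsub>A\<^esub> f) (g' \<cdot>\<^bsub>B\<^esub> g)"
  by (simp_all add: prod_cat_def)

lemma Obj_prod_catE: "x \<in> Obj (A \<otimes> B) \<Longrightarrow> (\<And>a b. x = Pair a b \<Longrightarrow> a \<in> Obj A \<Longrightarrow> b \<in> Obj B \<Longrightarrow> R) \<Longrightarrow> R"
  by (auto simp add: prod_cat_def)

lemma Arr_prod_catE: "x \<in> Arr (A \<otimes> B) \<Longrightarrow> (\<And>a b. x = Pair a b \<Longrightarrow> a \<in> Arr A \<Longrightarrow> b \<in> Arr B \<Longrightarrow> R) \<Longrightarrow> R"
  by (auto simp add: prod_cat_def)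

lemma prod_cat_Cat: assumes "smallness sm" "A \<in> Cat sm" "B \<in> Cat sm" shows "A \<otimes> B \<in> Cat sm"
  using assms(2,3) small_pairs[OF assms(1), of "Obj A" "\<lambda>_. Obj B"] small_pairs[OF assms(1), of "Arr A" "\<lambda>_. Arr B"]
  by (simp add: Cat_def category_prod_cat) (simp add: prod_cat_def)

lemma prod_func_simps [simp]:
  "Src (u \<otimes>\<^sub>f v) = Src u \<otimes> Src v" "Tgt (u \<otimes>\<^sub>f v) = Tgt u \<otimes> Tgt v"
  "a \<in> Obj (Src u) \<Longrightarrow> b \<in> Obj (Src v) \<Longrightarrow> omap (u \<otimes>\<^sub>f v) (Pair a b) = Pair (omap u a) (omap v b)"
  "f \<in> Arr (Src u) \<Longrightarrow> g \<in> Arr (Src v) \<Longrightarrow> amap (u \<otimes>\<^sub>f v) (Pair f g) = Pair (amap u f) (amap v g)"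
  by (simp_all add: prod_func_def)

lemma is_func_prod:
  assumes u: "is_func u A B" and v: "is_func v A' B'"
  shows "is_func (u \<otimes>\<^sub>f v) (A \<otimes> A') (B \<otimes> B')"
  unfolding prod_func_def is_funcD(3,4)[OF u] is_funcD(3,4)[OF v]
  by (rule is_func_mk)
    (auto elim!: Obj_prod_catE Arr_prod_catE
      simp add: category_prod_cat is_funcD[OF u] is_funcD[OF v] category_simps[OF is_funcD(1)[OF u]]
      category_simps[OF is_funcD(1)[OF v]])

lemma prod_func_comp:
  assumes u: "is_func u A B" and v: "is_func v A' B'" and w: "is_func w B C" and z: "is_func z B' C'"
  shows "(w \<otimes>\<^sub>f z) \<odot> (u \<otimes>\<^sub>f v) = (w \<odot> u) \<otimes>\<^sub>f (z \<odot> v)"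
  by (rule func_eqI[OF is_func_comp_func[OF is_func_prod[OF u v] is_func_prod[OF w z]]
        is_func_prod[OF is_func_comp_func[OF u w] is_func_comp_func[OF v z]]])
    (auto elim!: Obj_prod_catE Arr_prod_catE
      simp add: is_funcD[OF u] is_funcD[OF v] is_funcD[OF w] is_funcD[OF z])

lemma prod_func_id:
  assumes "category A" "category B"
  shows "id_func A \<otimes>\<^sub>f id_func B = id_func (A \<otimes> B)"
  by (rule func_eqI[OF is_func_prod[OF is_func_id[OF assms(1)] is_func_id[OF assms(2)]] is_func_id[OF category_prod_cat[OF assms]]])
    (auto elim!: Obj_prod_catE Arr_prod_catE)

lemma prod_ntr_simps [simp]:
  "NSrc (\<alpha> \<otimes>\<^sub>n \<beta>) = NSrc \<alpha> \<otimes>\<^sub>f NSrc \<beta>" "NTgt (\<alpha> \<otimes>\<^sub>n \<beta>) = NTgt \<alpha> \<otimes>\<^sub>f NTgt \<beta>"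
  "a \<in> Obj (Src (NSrc \<alpha>)) \<Longrightarrow> b \<in> Obj (Src (NSrc \<beta>)) \<Longrightarrow>
    cmp (\<alpha> \<otimes>\<^sub>n \<beta>) (Pair a b) = Pair (cmp \<alpha> a) (cmp \<beta> b)"
  by (simp_all add: prod_ntr_def)

lemma is_ntr_prod:
  assumes u: "is_func u A B" and v: "is_func v A' B'" and a: "is_ntr \<alpha> u u'" and b: "is_ntr \<beta> v v'"
  shows "is_ntr (\<alpha> \<otimes>\<^sub>n \<beta>) (u \<otimes>\<^sub>f v) (u' \<otimes>\<^sub>f v')"
proof -
  note aD = is_ntrD[OF a u] and bD = is_ntrD[OF b v]
  show ?thesis
    unfolding prod_ntr_def aD(2,3) bD(2,3)
    by (rule is_ntr_mk[OF is_func_prod[OF u v] is_func_prod[OF aD(1) bD(1)]])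
      (auto elim!: Obj_prod_catE Arr_prod_catE
        simp add: hom_iff is_funcD[OF u] is_funcD[OF v] is_funcD[OF aD(1)] is_funcD[OF bD(1)] aD(5-8) bD(5-8)
        category_simps[OF is_funcD(1)[OF u]] category_simps[OF is_funcD(1)[OF v]])
qed

lemma prod_ntr_id:
  assumes u: "is_func u A B" and v: "is_func v A' B'"
  shows "id_ntr u \<otimes>\<^sub>n id_ntr v = id_ntr (u \<otimes>\<^sub>f v)"
  by (rule ntr_eqI[OF is_ntr_prod[OF u v is_ntr_id[OF u] is_ntr_id[OF v]] is_ntr_id[OF is_func_prod[OF u v]]])
    (auto elim!: Obj_prod_catE simp add: is_funcD[OF u] is_funcD[OF v])

lemma prod_ntr_vcomp:
  assumes u: "is_func u A B" and v: "is_func v A' B'" and a: "is_ntr \<alpha> u u'" and b: "is_ntr \<beta> v v'"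
    and c: "is_ntr \<gamma> u' u''" and d: "is_ntr \<delta> v' v''"
  shows "(\<gamma> \<otimes>\<^sub>n \<delta>) \<bullet> (\<alpha> \<otimes>\<^sub>n \<beta>) = (\<gamma> \<bullet> \<alpha>) \<otimes>\<^sub>n (\<delta> \<bullet> \<beta>)"
proof -
  note aD = is_ntrD[OF a u] and bD = is_ntrD[OF b v]
  note cD = is_ntrD[OF c aD(1)] and dD = is_ntrD[OF d bD(1)]
  show ?thesis
    by (rule ntr_eqI[OF is_ntr_vcomp[OF is_func_prod[OF u v] is_ntr_prod[OF u v a b] is_ntr_prod[OF aD(1) bD(1) c d]]
        is_ntr_prod[OF u v is_ntr_vcomp[OF u a c] is_ntr_vcomp[OF v b d]]])
      (auto elim!: Obj_prod_catE simp add: is_funcD[OF u] is_funcD[OF v] is_funcD(3,4)[OF aD(1)] is_funcD(3,4)[OF bD(1)]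
        aD(2,3,5-7) bD(2,3,5-7) cD(2,3,5-7) dD(2,3,5-7))
qed

text \<open>Together with \<open>prod_ntr_vcomp\<close> this splits a pasting of squares with
  parameters into a pasting of the squares themselves and a composite of transformations in the
  parameter direction.\<close>

lemma prod_ntr_hcomp:
  assumes u: "is_func u A B" and v: "is_func v A' B'" and a: "is_ntr \<alpha> u u'" and b: "is_ntr \<beta> v v'"
    and w: "is_func w B C" and z: "is_func z B' C'" and c: "is_ntr \<gamma> w w'" and d: "is_ntr \<delta> z z'"
  shows "(\<gamma> \<otimes>\<^sub>n \<delta>) \<star> (\<alpha> \<otimes>\<^sub>n \<beta>) = (\<gamma> \<star> \<alpha>) \<otimes>\<^sub>n (\<delta> \<star> \<beta>)"
proof -
  note aD = is_ntrD[OF a u] and bD = is_ntrD[OF b v]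
  note cD = is_ntrD[OF c w] and dD = is_ntrD[OF d z]
  note fs = is_funcD[OF u] is_funcD[OF v] is_funcD[OF w] is_funcD[OF z] is_funcD[OF aD(1)] is_funcD[OF bD(1)]
  have e1: "(w \<otimes>\<^sub>f z) \<odot> (u \<otimes>\<^sub>f v) = (w \<odot> u) \<otimes>\<^sub>f (z \<odot> v)" by (rule prod_func_comp[OF u v w z])
  have e2: "(w' \<otimes>\<^sub>f z') \<odot> (u' \<otimes>\<^sub>f v') = (w' \<odot> u') \<otimes>\<^sub>f (z' \<odot> v')"
    by (rule prod_func_comp[OF aD(1) bD(1) cD(1) dD(1)])
  have t: "is_ntr ((\<gamma> \<otimes>\<^sub>n \<delta>) \<star> (\<alpha> \<otimes>\<^sub>n \<beta>)) ((w \<odot> u) \<otimes>\<^sub>f (z \<odot> v)) ((w' \<odot> u') \<otimes>\<^sub>f (z' \<odot> v'))"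
    using is_ntr_hcomp[OF is_func_prod[OF u v] is_func_prod[OF w z] is_ntr_prod[OF u v a b] is_ntr_prod[OF w z c d]]
    unfolding e1 e2 .
  show ?thesis
    by (rule ntr_eqI[OF t
        is_ntr_prod[OF is_func_comp_func[OF u w] is_func_comp_func[OF v z] is_ntr_hcomp[OF u w a c] is_ntr_hcomp[OF v z b d]]])
      (auto elim!: Obj_prod_catE simp add: fs aD(2,3,5-7) bD(2,3,5-7) cD(2,3,5-7) dD(2,3,5-7))
qed

section \<open>Functors and transformations between small categories, points and the terminal
  category\<close>

lemma sfuncD:
  assumes "sfunc sm u A B"
  shows "A \<in> Cat sm" "B \<in> Cat sm" "is_func u A B" "Src u = A" "Tgt u = B"
  using assms is_funcD(3,4) by (auto simp add: sfunc_def)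

lemma Cat_category: "A \<in> Cat sm \<Longrightarrow> category A"
  by (simp add: Cat_def)

lemma sfunc_id: "A \<in> Cat sm \<Longrightarrow> sfunc sm (id_func A) A A"
  by (simp add: sfunc_def Cat_category is_func_id)

lemma sfunc_comp: "sfunc sm u A B \<Longrightarrow> sfunc sm v B C \<Longrightarrow> sfunc sm (v \<odot> u) A C"
  by (auto simp add: sfunc_def intro: is_func_comp_func)

lemma sfunc_prod: "smallness sm \<Longrightarrow> sfunc sm u A B \<Longrightarrow> sfunc sm v A' B' \<Longrightarrow> sfunc sm (u \<otimes>\<^sub>f v) (A \<otimes> A') (B \<otimes> B')"
  by (simp add: sfunc_def is_func_prod prod_cat_Cat)

lemma sntrI: "sfunc sm u A B \<Longrightarrow> is_ntr \<alpha> u v \<Longrightarrow> sntr sm \<alpha> u v"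
  by (simp add: sntr_def sfuncD(4,5))

lemma sntrD:
  assumes "sntr sm \<alpha> u v" and "sfunc sm u A B"
  shows "is_ntr \<alpha> u v" "sfunc sm v A B"
  using assms is_ntrD(1)[of \<alpha> u v A B] by (auto simp add: sntr_def sfunc_def)

lemma sntr_id: "sfunc sm u A B \<Longrightarrow> sntr sm (id_ntr u) u u"
  by (rule sntrI) (auto intro: is_ntr_id dest: sfuncD(3))

lemma sntr_vcomp: "sfunc sm u A B \<Longrightarrow> sntr sm \<alpha> u v \<Longrightarrow> sntr sm \<beta> v w \<Longrightarrow> sntr sm (\<beta> \<bullet> \<alpha>) u w"
  by (rule sntrI, assumption) (metis is_ntr_vcomp sfuncD(3) sntr_def)

lemma sntr_hcomp: "sfunc sm u A B \<Longrightarrow> sfunc sm v B C \<Longrightarrow> sntr sm \<alpha> u u' \<Longrightarrow> sntr sm \<beta> v v' \<Longrightarrow>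
    sntr sm (\<beta> \<star> \<alpha>) (v \<odot> u) (v' \<odot> u')"
  by (rule sntrI[OF sfunc_comp], assumption+) (metis is_ntr_hcomp sfuncD(3) sntr_def)

lemma sntr_prod: "smallness sm \<Longrightarrow> sfunc sm u A B \<Longrightarrow> sfunc sm v A' B' \<Longrightarrow> sntr sm \<alpha> u u' \<Longrightarrow> sntr sm \<beta> v v' \<Longrightarrow>
    sntr sm (\<alpha> \<otimes>\<^sub>n \<beta>) (u \<otimes>\<^sub>f v) (u' \<otimes>\<^sub>f v')"
  by (rule sntrI[OF sfunc_prod], assumption+) (metis is_ntr_prod sfuncD(3) sntr_def)

lemma one_simps [simp]:
  "x \<in> Obj one \<longleftrightarrow> x = Pt" "f \<in> Arr one \<longleftrightarrow> f = Pt"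
  "Dom one Pt = Pt" "Cod one Pt = Pt" "Ident one Pt = Pt" "Pt \<cdot>\<^bsub>one\<^esub> Pt = Pt"
  by (simp_all add: one_def)

lemma one_Cat: "smallness sm \<Longrightarrow> one \<in> Cat sm"
proof -
  have "category one" unfolding one_def by (rule category_mk_cat) auto
  then show "smallness sm \<Longrightarrow> one \<in> Cat sm" using smallnessD(1,2) by (simp add: Cat_def) (simp add: one_def smallnessD)
qed

lemma sfunc_to_one: assumes "smallness sm" "A \<in> Cat sm" shows "sfunc sm (to_one A) A one"
  unfolding sfunc_def to_one_def using assms Cat_category[OF one_Cat[OF assms(1)]] Cat_category[OF assms(2)]
  by (auto intro!: is_func_mk simp add: one_Cat)

lemma to_one_simps [simp]:
  "Src (to_one A) = A" "Tgt (to_one A) = one"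
  "x \<in> Obj A \<Longrightarrow> omap (to_one A) x = Pt" "f \<in> Arr A \<Longrightarrow> amap (to_one A) f = Pt"
  by (simp_all add: to_one_def)

lemma func_to_one: assumes "smallness sm" and u: "sfunc sm u A one" shows "u = to_one A"
  by (rule func_eqI[OF sfuncD(3)[OF u] sfuncD(3)[OF sfunc_to_one[OF assms(1) sfuncD(1)[OF u]]]])
    (use is_funcD(5,6)[OF sfuncD(3)[OF u]] in auto)

text \<open>The two-dimensional part of terminality: every component lies in the only hom-set of
  \<open>one\<close>. It implies that a transformation between endofunctors of an index category
  acts trivially on constant diagrams.\<close>

lemma ntr_to_one:
  assumes "smallness sm" and u: "sfunc sm u A one" and a: "sntr sm \<alpha> u v" shows "\<alpha> = id_ntr u"
proof -
  note uD = sfuncD[OF u] and vD = sfuncD[OF sntrD(2)[OF a u]]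
  have e: "v = u" using func_to_one[OF assms(1)] u sntrD(2)[OF a u] by blast
  show ?thesis
    by (rule ntr_eqI[OF sntrD(1)[OF a u]])
     (use e is_ntr_id[OF uD(3)] is_ntrD(5)[OF sntrD(1)[OF a u] uD(3)] is_funcD(5)[OF uD(3)] uD(4,5) in auto)
qed

lemma pt_simps [simp]:
  "Src (pt A a) = one" "Tgt (pt A a) = A" "omap (pt A a) Pt = a" "amap (pt A a) Pt = Ident A a"
  by (simp_all add: pt_def)

lemma sfunc_pt: assumes "smallness sm" "A \<in> Cat sm" "a \<in> Obj A" shows "sfunc sm (pt A a) one A"
proof -
  note A = category_simps[OF Cat_category[OF assms(2)]]
  have "is_func (pt A a) one A" unfolding pt_def
    by (rule is_func_mk) (use assms Cat_category[OF one_Cat[OF assms(1)]] Cat_category[OF assms(2)] in \<open>auto simp add: A\<close>)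
  then show ?thesis using assms one_Cat by (simp add: sfunc_def)
qed

lemma pt_ntr_simps [simp]:
  "NSrc (pt_ntr A f) = pt A (Dom A f)" "NTgt (pt_ntr A f) = pt A (Cod A f)" "cmp (pt_ntr A f) Pt = f"
  by (simp_all add: pt_ntr_def)

lemma sntr_pt: assumes "smallness sm" "A \<in> Cat sm" "f \<in> Arr A"
  shows "sntr sm (pt_ntr A f) (pt A (Dom A f)) (pt A (Cod A f))"
proof -
  note A = category_simps[OF Cat_category[OF assms(2)]]
  show ?thesis
    by (rule sntrI[OF sfunc_pt[OF assms(1,2)]], simp add: A assms, unfold pt_ntr_def,
     rule is_ntr_mk[OF sfuncD(3)[OF sfunc_pt[OF assms(1,2)]] sfuncD(3)[OF sfunc_pt[OF assms(1,2)]]])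
    (auto simp add: A assms hom_iff)
qed

section \<open>Slice categories\<close>

lemma category_slice: assumes u: "is_func u A B" shows "category (slice u b)"
proof -
  note AB = is_funcD[OF u] category_simps[OF is_funcD(1)[OF u]] category_simps[OF is_funcD(2)[OF u]]
  show ?thesis
    unfolding slice_def Let_def by (rule category_mk_cat) (auto simp add: hom_iff AB)
qed

text \<open>An arrow stores only its target leg, and the source leg is computed from it.
  Composability therefore consists of two equations, one in A and one saying that the leg of the
  first arrow is the computed source leg of the second.\<close>

lemma slice_simps [simp]:
  assumes u: "is_func u A B"
  shows "Pair a f \<in> Obj (slice u b) \<longleftrightarrow> a \<in> Obj A \<and> f \<in> Arr B \<and> Dom B f = omap u a \<and> Cod B f = b"
    and "Pair h f \<in> Arr (slice u b) \<longleftrightarrow> h \<in> Arr A \<and> f \<in> Arr B \<and> Dom B f = omap u (Cod A h) \<and> Cod B f = b"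
    and "Pair h f \<in> Arr (slice u b) \<Longrightarrow> Dom (slice u b) (Pair h f) = Pair (Dom A h) (f \<cdot>\<^bsub>B\<^esub> amap u h)"
    and "Pair h f \<in> Arr (slice u b) \<Longrightarrow> Cod (slice u b) (Pair h f) = Pair (Cod A h) f"
    and "Pair a f \<in> Obj (slice u b) \<Longrightarrow> Ident (slice u b) (Pair a f) = Pair (Ident A a) f"
    and "Pair h f \<in> Arr (slice u b) \<Longrightarrow> Pair h' f' \<in> Arr (slice u b) \<Longrightarrow> Dom A h' = Cod A h \<Longrightarrow> f = f' \<cdot>\<^bsub>B\<^esub> amap u h' \<Longrightarrow>
      Pair h' f' \<cdot>\<^bsub>slice u b\<^esub> Pair h f = Pair (h' \<cdot>\<^bsub>A\<^esub> h) f'"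
  using is_funcD(3,4)[OF u] by (auto simp add: slice_def Let_def hom_iff)

lemma Obj_sliceE: assumes "x \<in> Obj (slice u b)" and u: "is_func u A B"
  obtains a f where "x = Pair a f" "a \<in> Obj A" "f \<in> Arr B" "Dom B f = omap u a" "Cod B f = b"
  using assms(1) is_funcD(3,4)[OF u] by (auto simp add: slice_def Let_def hom_iff)

lemma Arr_sliceE: assumes "x \<in> Arr (slice u b)" and u: "is_func u A B"
  obtains h f where "x = Pair h f" "h \<in> Arr A" "f \<in> Arr B" "Dom B f = omap u (Cod A h)" "Cod B f = b"
  using assms(1) is_funcD(3,4)[OF u] by (auto simp add: slice_def Let_def hom_iff)

lemma slice_Cat: assumes "smallness sm" and u: "sfunc sm u A B" shows "slice u b \<in> Cat sm"
proof -
  note uD = sfuncD[OF u]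
  have A: "sm (Obj A)" "sm (Arr A)" "sm (Arr B)" using uD(1,2) by (auto simp add: Cat_def)
  have "sm {Pair a f | a f. a \<in> Obj A \<and> f \<in> Arr B}" "sm {Pair a f | a f. a \<in> Arr A \<and> f \<in> Arr B}"
    using small_pairs[OF assms(1) A(1), of "\<lambda>_. Arr B"] small_pairs[OF assms(1) A(2), of "\<lambda>_. Arr B"] A by simp_all
  moreover have "Obj (slice u b) \<subseteq> {Pair a f | a f. a \<in> Obj A \<and> f \<in> Arr B}"
    "Arr (slice u b) \<subseteq> {Pair a f | a f. a \<in> Arr A \<and> f \<in> Arr B}"
    using uD(3) by (auto elim!: Obj_sliceE Arr_sliceE)
  ultimately show ?thesis using smallnessD(3)[OF assms(1)] category_slice[OF uD(3)] by (simp add: Cat_def)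
qed

lemma slice_proj_simps [simp]:
  "Src (slice_proj u b) = slice u b" "Tgt (slice_proj u b) = Src u"
  "x \<in> Obj (slice u b) \<Longrightarrow> omap (slice_proj u b) x = pfst x"
  "f \<in> Arr (slice u b) \<Longrightarrow> amap (slice_proj u b) f = pfst f"
  by (simp_all add: slice_proj_def)

lemma sfunc_slice_proj: assumes "smallness sm" and u: "sfunc sm u A B" shows "sfunc sm (slice_proj u b) (slice u b) A"
proof -
  note uD = sfuncD[OF u]
  note AB = is_funcD[OF uD(3)] category_simps[OF is_funcD(1)[OF uD(3)]] category_simps[OF is_funcD(2)[OF uD(3)]]
  have "is_func (slice_proj u b) (slice u b) A"
    unfolding slice_proj_def uD(4)
    by (rule is_func_mk) (auto simp add: category_slice[OF uD(3)] AB slice_simps[OF uD(3)]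
        elim!: Obj_sliceE[OF _ uD(3)] Arr_sliceE[OF _ uD(3)])
  then show ?thesis using slice_Cat[OF assms] uD by (simp add: sfunc_def)
qed

lemma slice_ntr_simps [simp]:
  "NSrc (slice_ntr u b) = u \<odot> slice_proj u b" "NTgt (slice_ntr u b) = pt (Tgt u) b \<odot> to_one (slice u b)"
  "x \<in> Obj (slice u b) \<Longrightarrow> cmp (slice_ntr u b) x = psnd x"
  by (simp_all add: slice_ntr_def)

lemma sntr_slice: assumes "smallness sm" and u: "sfunc sm u A B" and b: "b \<in> Obj B"
  shows "sntr sm (slice_ntr u b) (u \<odot> slice_proj u b) (pt B b \<odot> to_one (slice u b))"
proof -
  note uD = sfuncD[OF u]
  note AB = is_funcD[OF uD(3)] category_simps[OF is_funcD(1)[OF uD(3)]] category_simps[OF is_funcD(2)[OF uD(3)]]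
  have 1: "sfunc sm (u \<odot> slice_proj u b) (slice u b) B" by (rule sfunc_comp[OF sfunc_slice_proj[OF assms(1,2)] u])
  have 2: "sfunc sm (pt B b \<odot> to_one (slice u b)) (slice u b) B"
    by (rule sfunc_comp[OF sfunc_to_one[OF assms(1) slice_Cat[OF assms(1,2)]] sfunc_pt[OF assms(1) uD(2) b]])
  show ?thesis
    by (rule sntrI[OF 1], unfold slice_ntr_def uD(5), rule is_ntr_mk[OF sfuncD(3)[OF 1] sfuncD(3)[OF 2]])
     (auto simp add: category_slice[OF uD(3)] AB slice_simps[OF uD(3)] hom_iff
        elim!: Obj_sliceE[OF _ uD(3)] Arr_sliceE[OF _ uD(3)])
qed

section \<open>The calculus of mates\<close>

lemma prederivatorD:
  assumes "prederivator sm D"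
  shows   "\<forall>A \<in> Cat sm. category (onc D A)"
  "\<forall>u A B. sfunc sm u A B \<longrightarrow> is_func (onf D u) (onc D B) (onc D A)"
  "\<forall>\<alpha> u v. sntr sm \<alpha> u v \<longrightarrow> is_ntr (onn D \<alpha>) (onf D u) (onf D v)"
  "\<forall>A \<in> Cat sm. onf D (id_func A) = id_func (onc D A)"
  "\<forall>u v A B C. sfunc sm u A B \<longrightarrow> sfunc sm v B C \<longrightarrow> onf D (v \<odot> u) = onf D u \<odot> onf D v"
  "\<forall>u A B. sfunc sm u A B \<longrightarrow> onn D (id_ntr u) = id_ntr (onf D u)"
  "\<forall>\<alpha> \<beta> u v w. sntr sm \<alpha> u v \<longrightarrow> sntr sm \<beta> v w \<longrightarrow> onn D (\<beta> \<bullet> \<alpha>) = onn D \<beta> \<bullet> onn D \<alpha>"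
  "\<forall>\<alpha> \<beta> u u' v v'. sntr sm \<alpha> u u' \<longrightarrow> sntr sm \<beta> v v' \<longrightarrow> Src v = Tgt u \<longrightarrow>
    onn D (\<beta> \<star> \<alpha>) = onn D \<alpha> \<star> onn D \<beta>"
  by (insert assms[unfolded prederivator_def], elim conjE, assumption)+

locale derivator_context =
  fixes sm :: "'k elem set \<Rightarrow> bool" and D :: "('k, 'o, 'm) pder"
  assumes small: "smallness sm" and der: "derivator sm D"
begin

abbreviation res :: "'k sfunc \<Rightarrow> 'o \<Rightarrow> 'o" where "res u X \<equiv> omap (onf D u) X"
abbreviation resa :: "'k sfunc \<Rightarrow> 'm \<Rightarrow> 'm" where "resa u f \<equiv> amap (onf D u) f"
abbreviation two :: "'k sntr \<Rightarrow> 'o \<Rightarrow> 'm" where "two \<alpha> X \<equiv> cmp (onn D \<alpha>) X"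
abbreviation lo :: "'k sfunc \<Rightarrow> 'o \<Rightarrow> 'o" where "lo u X \<equiv> omap (lan D u) X"
abbreviation la :: "'k sfunc \<Rightarrow> 'm \<Rightarrow> 'm" where "la u f \<equiv> amap (lan D u) f"
abbreviation eta :: "'k sfunc \<Rightarrow> 'o \<Rightarrow> 'm" where "eta u X \<equiv> cmp (lan_unit D u) X"
abbreviation eps :: "'k sfunc \<Rightarrow> 'o \<Rightarrow> 'm" where "eps u X \<equiv> cmp (lan_counit D u) X"

lemma prederivator: "prederivator sm D"
  using der by (simp add: derivator_def)

lemmas prederivator_raw = prederivatorD[OF prederivator]

lemma D_cat: "A \<in> Cat sm \<Longrightarrow> category (onc D A)"
  using prederivator_raw(1) by blast

lemma D_func: "sfunc sm u A B \<Longrightarrow> is_func (onf D u) (onc D B) (onc D A)"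
  using prederivator_raw(2) by blast

lemma D_ntr: "sntr sm \<alpha> u v \<Longrightarrow> is_ntr (onn D \<alpha>) (onf D u) (onf D v)"
  using prederivator_raw(3) by blast

lemma res_obj: "sfunc sm u A B \<Longrightarrow> X \<in> Obj (onc D B) \<Longrightarrow> res u X \<in> Obj (onc D A)"
  by (rule is_funcD(5)[OF D_func])

lemma resa_hom: "sfunc sm u A B \<Longrightarrow> f \<in> hom (onc D B) X Y \<Longrightarrow> resa u f \<in> hom (onc D A) (res u X) (res u Y)"
  by (rule is_func_hom[OF D_func])

lemma resa_comp: "sfunc sm u A B \<Longrightarrow> f \<in> hom (onc D B) X Y \<Longrightarrow> g \<in> hom (onc D B) Y Z \<Longrightarrow>
    resa u (g \<cdot>\<^bsub>onc D B\<^esub> f) = resa u g \<cdot>\<^bsub>onc D A\<^esub> resa u f"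
  by (rule is_func_comp[OF D_func])

lemma resa_ident: "sfunc sm u A B \<Longrightarrow> X \<in> Obj (onc D B) \<Longrightarrow> resa u (Ident (onc D B) X) = Ident (onc D A) (res u X)"
  by (rule is_funcD(9)[OF D_func])

lemma onf_id: "A \<in> Cat sm \<Longrightarrow> onf D (id_func A) = id_func (onc D A)"
  using prederivator_raw(4) by blast

lemma onf_comp: "sfunc sm u A B \<Longrightarrow> sfunc sm v B C \<Longrightarrow> onf D (v \<odot> u) = onf D u \<odot> onf D v"
  using prederivator_raw(5) by blast

lemma res_comp: "sfunc sm u A B \<Longrightarrow> sfunc sm v B C \<Longrightarrow> X \<in> Obj (onc D C) \<Longrightarrow> res (v \<odot> u) X = res u (res v X)"
  using is_funcD(3)[OF D_func[of v B C]] by (simp add: onf_comp)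

lemma resa_comp_func: "sfunc sm u A B \<Longrightarrow> sfunc sm v B C \<Longrightarrow> f \<in> hom (onc D C) X Y \<Longrightarrow>
    resa (v \<odot> u) f = resa u (resa v f)"
  using is_funcD(3)[OF D_func[of v B C]] by (simp add: onf_comp hom_iff)

lemma two_hom: "sfunc sm u A B \<Longrightarrow> sntr sm \<alpha> u v \<Longrightarrow> X \<in> Obj (onc D B) \<Longrightarrow>
    two \<alpha> X \<in> hom (onc D A) (res u X) (res v X)"
  by (rule is_ntrD(4)[OF D_ntr D_func])

lemma two_nat: "sfunc sm u A B \<Longrightarrow> sntr sm \<alpha> u v \<Longrightarrow> f \<in> hom (onc D B) X Y \<Longrightarrow>
    two \<alpha> Y \<cdot>\<^bsub>onc D A\<^esub> resa u f = resa v f \<cdot>\<^bsub>onc D A\<^esub> two \<alpha> X"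
  using is_ntrD(8)[OF D_ntr D_func] by (auto simp add: hom_iff)

lemma onn_id: "sfunc sm u A B \<Longrightarrow> onn D (id_ntr u) = id_ntr (onf D u)"
  using prederivator_raw(6) by blast

lemma two_id: "sfunc sm u A B \<Longrightarrow> X \<in> Obj (onc D B) \<Longrightarrow> two (id_ntr u) X = Ident (onc D A) (res u X)"
  using is_funcD(3,4)[OF D_func[of u A B]] by (simp add: onn_id)

lemma two_vcomp:
  assumes "sfunc sm u A B" "sntr sm \<alpha> u v" "sntr sm \<beta> v w" "X \<in> Obj (onc D B)"
  shows "two (\<beta> \<bullet> \<alpha>) X = two \<beta> X \<cdot>\<^bsub>onc D A\<^esub> two \<alpha> X"
proof -
  have "onn D (\<beta> \<bullet> \<alpha>) = onn D \<beta> \<bullet> onn D \<alpha>"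
    using prederivator_raw(7) assms(2,3) by blast
  then show ?thesis
    using assms(4) is_ntrD(2)[OF D_ntr[OF assms(2)] D_func[OF assms(1)]] is_funcD(3,4)[OF D_func[OF assms(1)]] by simp
qed

lemma onn_hcomp: "sfunc sm u A B \<Longrightarrow> sfunc sm v B C \<Longrightarrow> sntr sm \<alpha> u u' \<Longrightarrow> sntr sm \<beta> v v' \<Longrightarrow>
    onn D (\<beta> \<star> \<alpha>) = onn D \<alpha> \<star> onn D \<beta>"
  by (rule prederivator_raw(8)[rule_format]) (assumption, assumption, simp add: sfuncD(4,5))

text \<open>A prederivator reverses 1-cells and so exchanges the two kinds of whiskering:
  precomposing with w applies w^* to a component, whereas postcomposing with v, treated next,
  evaluates the transformation at v^* X.\<close>

lemma two_whisker_right: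
  assumes w: "sfunc sm w A B" and v: "sfunc sm v B C" and b: "sntr sm \<beta> v v'" and X: "X \<in> Obj (onc D C)"
  shows "two (\<beta> \<star> id_ntr w) X = resa w (two \<beta> X)"
proof -
  note n = is_ntrD[OF D_ntr[OF b] D_func[OF v]] and wD = is_funcD[OF D_func[OF w]] and vD = is_funcD[OF D_func[OF v]]
  note v' = is_funcD[OF n(1)]
  show ?thesis
    using X by (simp add: onn_hcomp[OF w v sntr_id[OF w] b] onn_id[OF w] n(2-7) vD wD v' category_simps[OF wD(2)])
qed

lemma two_whisker_left:
  assumes u: "sfunc sm u A B" and v: "sfunc sm v B C" and a: "sntr sm \<alpha> u u'" and X: "X \<in> Obj (onc D C)"
  shows "two (id_ntr v \<star> \<alpha>) X = two \<alpha> (res v X)"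
proof -
  note n = is_ntrD[OF D_ntr[OF a] D_func[OF u]] and uD = is_funcD[OF D_func[OF u]] and vD = is_funcD[OF D_func[OF v]]
  note u' = is_funcD[OF n(1)]
  show ?thesis
    using X by (simp add: onn_hcomp[OF u v a sntr_id[OF v]] onn_id[OF v] n(2-7) vD uD u' category_simps[OF uD(2)])
qed

section \<open>Chosen left Kan extensions and adjuncts\<close>

lemma lan_adjunction:
  assumes "sfunc sm u A B"
  shows "adjunction (lan D u) (onf D u) (lan_unit D u) (lan_counit D u)"
proof -
  obtain L \<eta> \<epsilon> where a: "adjunction L (onf D u) \<eta> \<epsilon>"
    using der assms unfolding derivator_def Der3_def by blast
  have "case lan_data D u of (L, \<eta>, \<epsilon>) \<Rightarrow> adjunction L (onf D u) \<eta> \<epsilon>"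
    unfolding lan_data_def by (rule someI[of _ "(L, \<eta>, \<epsilon>)"]) (simp add: a)
  then show ?thesis by (simp add: lan_def lan_unit_def lan_counit_def case_prod_beta)
qed

lemma lan_func: assumes u: "sfunc sm u A B" shows "is_func (lan D u) (onc D A) (onc D B)"
proof -
  note uD = is_funcD(3,4)[OF D_func[OF u]]
  \<comment> \<open>The predicate \<open>adjunction\<close> leaves the source of the left adjoint
    open. It is pinned down by the right adjoint, whose target is that source and is already known
    to be \<open>onc D A\<close>.\<close>
  have "is_func (lan D u) (Src (lan D u)) (onc D B)" "is_func (onf D u) (onc D B) (Src (lan D u))"
    using lan_adjunction[OF u] uD unfolding adjunction_def by auto
  then show ?thesis using is_funcD(4)[of "onf D u" "onc D B" "Src (lan D u)"] uD by simp
qed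

lemma lan_facts: assumes u: "sfunc sm u A B"
  shows "is_ntr (lan_unit D u) (id_func (onc D A)) (onf D u \<odot> lan D u)"
    and "is_ntr (lan_counit D u) (lan D u \<odot> onf D u) (id_func (onc D B))"
    and "X \<in> Obj (onc D A) \<Longrightarrow> eps u (lo u X) \<cdot>\<^bsub>onc D B\<^esub> la u (eta u X) = Ident (onc D B) (lo u X)"
    and "Y \<in> Obj (onc D B) \<Longrightarrow> resa u (eps u Y) \<cdot>\<^bsub>onc D A\<^esub> eta u (res u Y) = Ident (onc D A) (res u Y)"
  using lan_adjunction[OF u] is_funcD(3,4)[OF D_func[OF u]] is_funcD(3,4)[OF lan_func[OF u]]
  unfolding adjunction_def by auto

lemma lo_obj: "sfunc sm u A B \<Longrightarrow> X \<in> Obj (onc D A) \<Longrightarrow> lo u X \<in> Obj (onc D B)"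
  by (rule is_funcD(5)[OF lan_func])

lemma la_hom: "sfunc sm u A B \<Longrightarrow> f \<in> hom (onc D A) X Y \<Longrightarrow> la u f \<in> hom (onc D B) (lo u X) (lo u Y)"
  by (rule is_func_hom[OF lan_func])

lemma la_comp: "sfunc sm u A B \<Longrightarrow> f \<in> hom (onc D A) X Y \<Longrightarrow> g \<in> hom (onc D A) Y Z \<Longrightarrow>
    la u (g \<cdot>\<^bsub>onc D A\<^esub> f) = la u g \<cdot>\<^bsub>onc D B\<^esub> la u f"
  by (rule is_func_comp[OF lan_func])

lemma eta_hom: assumes u: "sfunc sm u A B" and X: "X \<in> Obj (onc D A)"
  shows "eta u X \<in> hom (onc D A) X (res u (lo u X))"
  using is_ntrD(4)[OF lan_facts(1)[OF u] is_func_id[OF D_cat[OF sfuncD(1)[OF u]]] X] X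
    is_funcD(3)[OF lan_func[OF u]] by simp

lemma eta_nat: assumes u: "sfunc sm u A B" and f: "f \<in> hom (onc D A) X Y"
  shows "eta u Y \<cdot>\<^bsub>onc D A\<^esub> f = resa u (la u f) \<cdot>\<^bsub>onc D A\<^esub> eta u X"
  using is_ntrD(8)[OF lan_facts(1)[OF u] is_func_id[OF D_cat[OF sfuncD(1)[OF u]]], of f] f
    is_funcD(3)[OF lan_func[OF u]] by (auto simp add: hom_iff)

lemma eps_hom: assumes u: "sfunc sm u A B" and X: "X \<in> Obj (onc D B)"
  shows "eps u X \<in> hom (onc D B) (lo u (res u X)) X"
  using is_ntrD(4)[OF lan_facts(2)[OF u] is_func_comp_func[OF D_func[OF u] lan_func[OF u]] X] X
    is_funcD(3)[OF D_func[OF u]] by simp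

lemma eps_nat: assumes u: "sfunc sm u A B" and f: "f \<in> hom (onc D B) X Y"
  shows "eps u Y \<cdot>\<^bsub>onc D B\<^esub> la u (resa u f) = f \<cdot>\<^bsub>onc D B\<^esub> eps u X"
  using is_ntrD(8)[OF lan_facts(2)[OF u] is_func_comp_func[OF D_func[OF u] lan_func[OF u]], of f] f
    is_funcD(3)[OF D_func[OF u]] by (auto simp add: hom_iff)

text \<open>The adjunct of f under u_! and u^*, written with the counit. Naturality of the unit
  moves f to the right, and a triangle identity then cancels counit and unit.\<close>

lemma transpose:
  assumes u: "sfunc sm u A B" and Z: "Z \<in> Obj (onc D B)" and f: "f \<in> hom (onc D A) X (res u Z)"
  shows "eps u Z \<cdot>\<^bsub>onc D B\<^esub> la u f \<in> hom (onc D B) (lo u X) Z"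
    and "resa u (eps u Z \<cdot>\<^bsub>onc D B\<^esub> la u f) \<cdot>\<^bsub>onc D A\<^esub> eta u X = f"
proof -
  note A = D_cat[OF sfuncD(1)[OF u]] and B = D_cat[OF sfuncD(2)[OF u]]
  note X = hom_Obj(1)[OF A f]
  note e = eps_hom[OF u Z] and lf = la_hom[OF u f] and h = eta_hom[OF u X]
  show "eps u Z \<cdot>\<^bsub>onc D B\<^esub> la u f \<in> hom (onc D B) (lo u X) Z" by (rule hom_comp[OF B lf e])
  have "resa u (eps u Z \<cdot>\<^bsub>onc D B\<^esub> la u f) \<cdot>\<^bsub>onc D A\<^esub> eta u X
    = resa u (eps u Z) \<cdot>\<^bsub>onc D A\<^esub> (resa u (la u f) \<cdot>\<^bsub>onc D A\<^esub> eta u X)"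
    unfolding resa_comp[OF u lf e] by (rule hom_assoc[OF A h resa_hom[OF u lf] resa_hom[OF u e], symmetric])
  also have "\<dots> = resa u (eps u Z) \<cdot>\<^bsub>onc D A\<^esub> eta u (res u Z) \<cdot>\<^bsub>onc D A\<^esub> f"
    unfolding eta_nat[OF u f, symmetric]
    by (rule hom_assoc[OF A f eta_hom[OF u res_obj[OF u Z]] resa_hom[OF u e]])
  also have "\<dots> = f" by (simp add: lan_facts(4)[OF u Z] hom_unit(1)[OF A f])
  finally show "resa u (eps u Z \<cdot>\<^bsub>onc D B\<^esub> la u f) \<cdot>\<^bsub>onc D A\<^esub> eta u X = f" .
qed

lemma transpose_inverse:
  assumes u: "sfunc sm u A B" and X: "X \<in> Obj (onc D A)" and g: "g \<in> hom (onc D B) (lo u X) Z"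
  shows "eps u Z \<cdot>\<^bsub>onc D B\<^esub> la u (resa u g \<cdot>\<^bsub>onc D A\<^esub> eta u X) = g"
proof -
  note B = D_cat[OF sfuncD(2)[OF u]]
  note e = eps_hom[OF u hom_Obj(2)[OF B g]] and h = eta_hom[OF u X]
  have "eps u Z \<cdot>\<^bsub>onc D B\<^esub> la u (resa u g \<cdot>\<^bsub>onc D A\<^esub> eta u X)
    = eps u Z \<cdot>\<^bsub>onc D B\<^esub> la u (resa u g) \<cdot>\<^bsub>onc D B\<^esub> la u (eta u X)"
    unfolding la_comp[OF u h resa_hom[OF u g]]
    by (rule hom_assoc[OF B la_hom[OF u h] la_hom[OF u resa_hom[OF u g]] e])
  also have "\<dots> = g \<cdot>\<^bsub>onc D B\<^esub> (eps u (lo u X) \<cdot>\<^bsub>onc D B\<^esub> la u (eta u X))"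
    unfolding eps_nat[OF u g]
    by (rule hom_assoc[OF B la_hom[OF u h] eps_hom[OF u lo_obj[OF u X]] g, symmetric])
  also have "\<dots> = g" by (simp add: lan_facts(3)[OF u X] hom_unit(2)[OF B g])
  finally show ?thesis .
qed

text \<open>Maps out of u_! X correspond bijectively to their adjuncts. All equations between maps
  out of chosen left Kan extensions are reduced in this way to equations between units, restrictions
  and 2-cells.\<close>

lemma lan_eqI:
  assumes u: "sfunc sm u A B" and X: "X \<in> Obj (onc D A)"
    and g: "g \<in> hom (onc D B) (lo u X) Z" "g' \<in> hom (onc D B) (lo u X) Z"
    and e: "resa u g \<cdot>\<^bsub>onc D A\<^esub> eta u X = resa u g' \<cdot>\<^bsub>onc D A\<^esub> eta u X"
  shows "g = g'"
  by (rule trans[OF transpose_inverse[OF u X g(1), unfolded e, symmetric] transpose_inverse[OF u X g(2)]])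

section \<open>Squares in Cat and their mates\<close>

definition square :: "'k scat \<Rightarrow> 'k scat \<Rightarrow> 'k scat \<Rightarrow> 'k scat \<Rightarrow> 'k sfunc \<Rightarrow> 'k sfunc \<Rightarrow> 'k sfunc \<Rightarrow> 'k sfunc \<Rightarrow> 'k sntr \<Rightarrow> bool" where
  "square A' A B' B p u q b \<alpha> \<longleftrightarrow> sfunc sm p A' A \<and> sfunc sm u A B \<and> sfunc sm q A' B' \<and> sfunc sm b B' B \<and>
     sntr sm \<alpha> (u \<odot> p) (b \<odot> q)"

lemma squareD:
  assumes "square A' A B' B p u q b \<alpha>"
  shows "sfunc sm p A' A" "sfunc sm u A B" "sfunc sm q A' B'" "sfunc sm b B' B" "sntr sm \<alpha> (u \<odot> p) (b \<odot> q)"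
    "sfunc sm (u \<odot> p) A' B" "sfunc sm (b \<odot> q) A' B"
  using assms unfolding square_def by (auto intro: sfunc_comp)

lemma square_two_hom:
  assumes s: "square A' A B' B p u q b \<alpha>" and Y: "Y \<in> Obj (onc D B)"
  shows "two \<alpha> Y \<in> hom (onc D A') (res p (res u Y)) (res q (res b Y))"
  using two_hom[OF squareD(6,5)[OF s] Y] res_comp[OF squareD(1,2)[OF s] Y] res_comp[OF squareD(3,4)[OF s] Y] by simp

lemma square_two_nat:
  assumes s: "square A' A B' B p u q b \<alpha>" and f: "f \<in> hom (onc D B) X Y"
  shows "two \<alpha> Y \<cdot>\<^bsub>onc D A'\<^esub> resa p (resa u f) = resa q (resa b f) \<cdot>\<^bsub>onc D A'\<^esub> two \<alpha> X"
  using two_nat[OF squareD(6,5)[OF s] f] resa_comp_func[OF squareD(1,2)[OF s] f] resa_comp_func[OF squareD(3,4)[OF s] f] by simp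

text \<open>The adjunct of the mate under q_! and q^*. Neither q_! nor its unit occurs in it, which
  is what makes mates of different squares comparable.\<close>

definition cotranspose :: "'k scat \<Rightarrow> 'k sfunc \<Rightarrow> 'k sfunc \<Rightarrow> 'k sntr \<Rightarrow> 'o \<Rightarrow> 'm" where
  "cotranspose A' p u \<alpha> X = two \<alpha> (lo u X) \<cdot>\<^bsub>onc D A'\<^esub> resa p (eta u X)"

lemma cotranspose_hom:
  assumes s: "square A' A B' B p u q b \<alpha>" and X: "X \<in> Obj (onc D A)"
  shows "cotranspose A' p u \<alpha> X \<in> hom (onc D A') (res p X) (res q (res b (lo u X)))"
  unfolding cotranspose_def
  by (rule hom_comp[OF D_cat[OF sfuncD(1)[OF squareD(1)[OF s]]] resa_hom[OF squareD(1)[OF s] eta_hom[OF squareD(2)[OF s] X]]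
        square_two_hom[OF s lo_obj[OF squareD(2)[OF s] X]]])

lemma lan_mate_eq:
  assumes s: "square A' A B' B p u q b \<alpha>"
  shows "lan_mate D p u q b \<alpha> X = eps q (res b (lo u X)) \<cdot>\<^bsub>onc D B'\<^esub> la q (cotranspose A' p u \<alpha> X)"
  unfolding lan_mate_def cotranspose_def using sfuncD(4,5)[OF squareD(3)[OF s]] by simp

lemma mate:
  assumes s: "square A' A B' B p u q b \<alpha>" and X: "X \<in> Obj (onc D A)"
  shows mate_hom: "lan_mate D p u q b \<alpha> X \<in> hom (onc D B') (lo q (res p X)) (res b (lo u X))"
    and mate_transpose: "resa q (lan_mate D p u q b \<alpha> X) \<cdot>\<^bsub>onc D A'\<^esub> eta q (res p X) = cotranspose A' p u \<alpha> X"
  unfolding lan_mate_eq[OF s]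
  using transpose[OF squareD(3)[OF s] res_obj[OF squareD(4)[OF s] lo_obj[OF squareD(2)[OF s] X]] cotranspose_hom[OF s X]]
  by simp_all

text \<open>A mate is the only map with the prescribed adjunct. The pasting and change lemmas below
  compute the adjunct of the proposed value and then appeal to this uniqueness.\<close>

lemma mate_unique:
  assumes s: "square A' A B' B p u q b \<alpha>" and X: "X \<in> Obj (onc D A)"
    and g: "g \<in> hom (onc D B') (lo q (res p X)) (res b (lo u X))"
    and e: "resa q g \<cdot>\<^bsub>onc D A'\<^esub> eta q (res p X) = cotranspose A' p u \<alpha> X"
  shows "g = lan_mate D p u q b \<alpha> X"
  using lan_eqI[OF squareD(3)[OF s] res_obj[OF squareD(1)[OF s] X] g mate_hom[OF s X]] e mate_transpose[OF s X] by simp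

text \<open>On adjuncts the claim is a composite of three naturalities: those of the unit of q, of
  the unit of u and of \<alpha>.\<close>

lemma mate_natural:
  assumes s: "square A' A B' B p u q b \<alpha>" and f: "f \<in> hom (onc D A) X Y"
  shows "lan_mate D p u q b \<alpha> Y \<cdot>\<^bsub>onc D B'\<^esub> la q (resa p f) = resa b (la u f) \<cdot>\<^bsub>onc D B'\<^esub> lan_mate D p u q b \<alpha> X"
proof -
  note sD = squareD[OF s]
  note A = D_cat[OF sfuncD(2)[OF sD(1)]] and A' = D_cat[OF sfuncD(1)[OF sD(1)]] and B' = D_cat[OF sfuncD(1)[OF sD(4)]]
  note X = hom_Obj(1)[OF A f] and Y = hom_Obj(2)[OF A f]
  note pf = resa_hom[OF sD(1) f]
  note mX = mate_hom[OF s X] and mY = mate_hom[OF s Y]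
  note uf = la_hom[OF sD(2) f] note buf = resa_hom[OF sD(4) uf]
  note lpf = la_hom[OF sD(3) pf]
  note eX = eta_hom[OF sD(3) res_obj[OF sD(1) X]] and eY = eta_hom[OF sD(3) res_obj[OF sD(1) Y]]
  let ?c = "\<lambda>g f. g \<cdot>\<^bsub>onc D A'\<^esub> f"
  have "?c (resa q (lan_mate D p u q b \<alpha> Y \<cdot>\<^bsub>onc D B'\<^esub> la q (resa p f))) (eta q (res p X))
     = ?c (resa q (lan_mate D p u q b \<alpha> Y)) (?c (resa q (la q (resa p f))) (eta q (res p X)))"
    unfolding resa_comp[OF sD(3) lpf mY]
    by (rule hom_assoc[OF A' eX resa_hom[OF sD(3) lpf] resa_hom[OF sD(3) mY], symmetric])
  also have "\<dots> = ?c (cotranspose A' p u \<alpha> Y) (resa p f)"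
    unfolding eta_nat[OF sD(3) pf, symmetric] mate_transpose[OF s Y, symmetric]
    by (rule hom_assoc[OF A' pf eY resa_hom[OF sD(3) mY]])
  also have "\<dots> = ?c (two \<alpha> (lo u Y)) (?c (resa p (eta u Y)) (resa p f))"
    unfolding cotranspose_def
    by (rule hom_assoc[OF A' pf resa_hom[OF sD(1) eta_hom[OF sD(2) Y]] square_two_hom[OF s lo_obj[OF sD(2) Y]], symmetric])
  also have "\<dots> = ?c (two \<alpha> (lo u Y)) (?c (resa p (resa u (la u f))) (resa p (eta u X)))"
    unfolding resa_comp[OF sD(1) f eta_hom[OF sD(2) Y], symmetric] eta_nat[OF sD(2) f]
    by (simp add: resa_comp[OF sD(1) eta_hom[OF sD(2) X] resa_hom[OF sD(2) uf]])
  \<comment> \<open>Naturality of \<alpha> at \<open>la u f\<close>, framed by two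
    reassociations.\<close>
  also have "\<dots> = ?c (resa q (resa b (la u f))) (cotranspose A' p u \<alpha> X)"
    unfolding cotranspose_def
    using hom_assoc[OF A' resa_hom[OF sD(1) eta_hom[OF sD(2) X]] resa_hom[OF sD(1) resa_hom[OF sD(2) uf]]
        square_two_hom[OF s lo_obj[OF sD(2) Y]]]
      hom_assoc[OF A' resa_hom[OF sD(1) eta_hom[OF sD(2) X]] square_two_hom[OF s lo_obj[OF sD(2) X]]
        resa_hom[OF sD(3) buf]] square_two_nat[OF s uf] by simp
  also have "\<dots> = ?c (resa q (resa b (la u f) \<cdot>\<^bsub>onc D B'\<^esub> lan_mate D p u q b \<alpha> X)) (eta q (res p X))"
    unfolding resa_comp[OF sD(3) mX buf] mate_transpose[OF s X, symmetric]
    by (rule hom_assoc[OF A' eX resa_hom[OF sD(3) mX] resa_hom[OF sD(3) buf]])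
  finally show ?thesis
    using lan_eqI[OF sD(3) res_obj[OF sD(1) X] hom_comp[OF B' lpf mY] hom_comp[OF B' mX buf]] by simp
qed

text \<open>The adjunct of this mate is the unit of u, which is also the adjunct of the identity of
  u_! X.\<close>

lemma mate_id:
  assumes u: "sfunc sm u A B" and X: "X \<in> Obj (onc D A)"
  shows "lan_mate D (id_func A) u u (id_func B) (id_ntr u) X = Ident (onc D B) (lo u X)"
proof -
  note uD = sfuncD[OF u] and A = D_cat[OF sfuncD(1)[OF u]] and B = D_cat[OF sfuncD(2)[OF u]]
  have s: "square A A B B (id_func A) u u (id_func B) (id_ntr u)"
    unfolding square_def using u uD sntr_id[OF u] by (simp add: sfunc_id comp_func_id[OF uD(3)])
  have e: "resa u (Ident (onc D B) (lo u X)) = Ident (onc D A) (res u (lo u X))"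
    by (rule resa_ident[OF u lo_obj[OF u X]])
  have i: "res (id_func A) X = X" "res (id_func B) (lo u X) = lo u X" "resa (id_func A) (eta u X) = eta u X"
    using X lo_obj[OF u X] eta_hom[OF u X] onf_id[OF uD(1)] onf_id[OF uD(2)] by (simp_all add: hom_iff)
  show ?thesis
    by (rule mate_unique[OF s X, symmetric])
      (simp_all add: e i hom_ident[OF B lo_obj[OF u X]] cotranspose_def two_id[OF u lo_obj[OF u X]])
qed

text \<open>Functoriality of mates under horizontal pasting, the two squares being glued along their
  common vertical side q. The right-hand side is tested against the unit of r: naturality of
  \<alpha>' carries the first mate past the second 2-cell, where the defining property of the first
  mate replaces the unit of q by the unit of u.\<close>

lemma mate_paste:
  assumes s: "square A' A B' B p u q b \<alpha>" and s': "square A'' A' B'' B' p' q r b' \<alpha>'"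
    and X: "X \<in> Obj (onc D A)"
  shows "lan_mate D (p \<odot> p') u r (b \<odot> b') ((id_ntr b \<star> \<alpha>') \<bullet> (\<alpha> \<star> id_ntr p')) X =
      resa b' (lan_mate D p u q b \<alpha> X) \<cdot>\<^bsub>onc D B''\<^esub> lan_mate D p' q r b' \<alpha>' (res p X)"
    and "square A'' A B'' B (p \<odot> p') u r (b \<odot> b') ((id_ntr b \<star> \<alpha>') \<bullet> (\<alpha> \<star> id_ntr p'))"
proof -
  note sD = squareD[OF s] and tD = squareD[OF s']
  note as = comp_func_assoc[OF sfuncD(3) sfuncD(3) sfuncD(3)]
  let ?g1 = "\<alpha> \<star> id_ntr p'" and ?g2 = "id_ntr b \<star> \<alpha>'"
  have g1: "sntr sm ?g1 (u \<odot> (p \<odot> p')) (b \<odot> q \<odot> p')"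
    using sntr_hcomp[OF tD(1) sD(6) sntr_id[OF tD(1)] sD(5)] by (simp add: as[OF tD(1) sD(1,2)])
  have g2: "sntr sm ?g2 (b \<odot> q \<odot> p') (b \<odot> b' \<odot> r)"
    using sntr_hcomp[OF tD(6) sD(4) tD(5) sntr_id[OF sD(4)]] by (simp add: as[OF tD(1) sD(3,4)] as[OF tD(3,4) sD(4)])
  have upp: "sfunc sm (u \<odot> (p \<odot> p')) A'' B" by (rule sfunc_comp[OF sfunc_comp[OF tD(1) sD(1)] sD(2)])
  show S: "square A'' A B'' B (p \<odot> p') u r (b \<odot> b') (?g2 \<bullet> ?g1)"
    unfolding square_def using sntr_vcomp[OF upp g1 g2] sD tD by (auto intro: sfunc_comp)
  have t: "two (?g2 \<bullet> ?g1) Y = two \<alpha>' (res b Y) \<cdot>\<^bsub>onc D A''\<^esub> resa p' (two \<alpha> Y)" if Y: "Y \<in> Obj (onc D B)" for Y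
    using two_vcomp[OF upp g1 g2 Y] two_whisker_left[OF tD(6) sD(4) tD(5) Y]
      two_whisker_right[OF tD(1) sD(6) sD(5) Y] by simp
  note A' = D_cat[OF sfuncD(1)[OF sD(1)]] and A'' = D_cat[OF sfuncD(1)[OF tD(1)]] and B'' = D_cat[OF sfuncD(1)[OF tD(4)]]
  let ?M = "lan_mate D p u q b \<alpha> X" and ?N = "lan_mate D p' q r b' \<alpha>' (res p X)"
  note pX = res_obj[OF sD(1) X]
  note M = mate_hom[OF s X] and N = mate_hom[OF s' pX]
  note L = lo_obj[OF sD(2) X]
  note b'M = resa_hom[OF tD(4) M] note rb'M = resa_hom[OF tD(3) b'M]
  note e = eta_hom[OF tD(3) res_obj[OF tD(1) pX]]
  note qM = resa_hom[OF sD(3) M] and eq = eta_hom[OF sD(3) pX]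
  let ?c = "\<lambda>g f. g \<cdot>\<^bsub>onc D A''\<^esub> f"
  have "?c (resa r (resa b' ?M \<cdot>\<^bsub>onc D B''\<^esub> ?N)) (eta r (res p' (res p X)))
     = ?c (resa r (resa b' ?M)) (cotranspose A'' p' q \<alpha>' (res p X))"
    unfolding resa_comp[OF tD(3) N b'M] mate_transpose[OF s' pX, symmetric]
    by (rule hom_assoc[OF A'' e resa_hom[OF tD(3) N] rb'M, symmetric])
  \<comment> \<open>Naturality of \<alpha>' at the first mate, which brings that mate next to the
    unit of q.\<close>
  also have "\<dots> = ?c (?c (two \<alpha>' (res b (lo u X))) (resa p' (resa q ?M))) (resa p' (eta q (res p X)))"
    unfolding cotranspose_def square_two_nat[OF s' M]
    by (rule hom_assoc[OF A'' resa_hom[OF tD(1) eq] square_two_hom[OF s' lo_obj[OF sD(3) pX]] rb'M])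
  also have "\<dots> = ?c (two \<alpha>' (res b (lo u X))) (resa p' (resa q ?M \<cdot>\<^bsub>onc D A'\<^esub> eta q (res p X)))"
    unfolding resa_comp[OF tD(1) eq qM]
    by (rule hom_assoc[OF A'' resa_hom[OF tD(1) eq] resa_hom[OF tD(1) qM] square_two_hom[OF s' res_obj[OF sD(4) L]], symmetric])
  also have "\<dots> = ?c (two \<alpha>' (res b (lo u X))) (?c (resa p' (two \<alpha> (lo u X))) (resa p' (resa p (eta u X))))"
    unfolding mate_transpose[OF s X] cotranspose_def
    by (simp add: resa_comp[OF tD(1) resa_hom[OF sD(1) eta_hom[OF sD(2) X]] square_two_hom[OF s L]])
  also have "\<dots> = cotranspose A'' (p \<odot> p') u (?g2 \<bullet> ?g1) X"
    unfolding cotranspose_def t[OF L] resa_comp_func[OF tD(1) sD(1) eta_hom[OF sD(2) X]]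
    by (rule hom_assoc[OF A'' resa_hom[OF tD(1) resa_hom[OF sD(1) eta_hom[OF sD(2) X]]] resa_hom[OF tD(1) square_two_hom[OF s L]]
          square_two_hom[OF s' res_obj[OF sD(4) L]]])
  finally have *: "?c (resa r (resa b' ?M \<cdot>\<^bsub>onc D B''\<^esub> ?N)) (eta r (res p' (res p X))) = cotranspose A'' (p \<odot> p') u (?g2 \<bullet> ?g1) X" .
  show "lan_mate D (p \<odot> p') u r (b \<odot> b') (?g2 \<bullet> ?g1) X = resa b' ?M \<cdot>\<^bsub>onc D B''\<^esub> ?N"
    by (rule mate_unique[OF S X, symmetric])
      (use * hom_comp[OF B'' N b'M] in \<open>simp_all add: res_comp[OF tD(1) sD(1) X] res_comp[OF tD(4) sD(4) L]\<close>)
qed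

text \<open>The adjunct of a composite with \<gamma> contains q^* applied to \<gamma>, which is the
  whiskering of \<gamma> with q. For a transformation between points this turns a transition map of
  a left Kan extension, precomposed with a mate, into a single mate.\<close>

lemma mate_change_base:
  assumes s: "square A' A B' B p u q b \<alpha>" and g: "sntr sm \<gamma> b b'" and X: "X \<in> Obj (onc D A)"
  shows "two \<gamma> (lo u X) \<cdot>\<^bsub>onc D B'\<^esub> lan_mate D p u q b \<alpha> X = lan_mate D p u q b' ((\<gamma> \<star> id_ntr q) \<bullet> \<alpha>) X"
proof -
  note sD = squareD[OF s]
  note b' = sntrD(2)[OF g sD(4)]
  have n: "sntr sm (\<gamma> \<star> id_ntr q) (b \<odot> q) (b' \<odot> q)" by (rule sntr_hcomp[OF sD(3,4) sntr_id[OF sD(3)] g])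
  have S: "square A' A B' B p u q b' ((\<gamma> \<star> id_ntr q) \<bullet> \<alpha>)"
    unfolding square_def using sD b' sntr_vcomp[OF sD(6,5) n] by simp
  note L = lo_obj[OF sD(2) X]
  note G = two_hom[OF sD(4) g L] and M = mate_hom[OF s X]
  note A' = D_cat[OF sfuncD(1)[OF sD(1)]] and B' = D_cat[OF sfuncD(1)[OF sD(4)]]
  have t: "two ((\<gamma> \<star> id_ntr q) \<bullet> \<alpha>) (lo u X) = resa q (two \<gamma> (lo u X)) \<cdot>\<^bsub>onc D A'\<^esub> two \<alpha> (lo u X)"
    using two_vcomp[OF sD(6,5) n L] two_whisker_right[OF sD(3,4) g L] by simp
  show ?thesis
  proof (rule mate_unique[OF S X hom_comp[OF B' M G]])
    show "resa q (two \<gamma> (lo u X) \<cdot>\<^bsub>onc D B'\<^esub> lan_mate D p u q b \<alpha> X) \<cdot>\<^bsub>onc D A'\<^esub> eta q (res p X) =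
      cotranspose A' p u ((\<gamma> \<star> id_ntr q) \<bullet> \<alpha>) X"
      unfolding resa_comp[OF sD(3) M G] t cotranspose_def
      using hom_assoc[OF A' eta_hom[OF sD(3) res_obj[OF sD(1) X]] resa_hom[OF sD(3) M] resa_hom[OF sD(3) G]]
        hom_assoc[OF A' resa_hom[OF sD(1) eta_hom[OF sD(2) X]] square_two_hom[OF s L] resa_hom[OF sD(3) G]]
        mate_transpose[OF s X] by (simp add: cotranspose_def)
  qed
qed

text \<open>The counterpart on the upper side: \<gamma> passes first the unit of q and then the unit
  of u, each time by naturality. It absorbs into a mate the map that a transformation of diagrams
  induces on left Kan extensions.\<close>

lemma mate_change_top:
  assumes s: "square A' A B' B p' u q b \<alpha>" and p: "sfunc sm p A' A" and g: "sntr sm \<gamma> p p'" and X: "X \<in> Obj (onc D A)"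
  shows "lan_mate D p' u q b \<alpha> X \<cdot>\<^bsub>onc D B'\<^esub> la q (two \<gamma> X) = lan_mate D p u q b (\<alpha> \<bullet> (id_ntr u \<star> \<gamma>)) X"
proof -
  note sD = squareD[OF s]
  have up: "sfunc sm (u \<odot> p) A' B" by (rule sfunc_comp[OF p sD(2)])
  have n: "sntr sm (id_ntr u \<star> \<gamma>) (u \<odot> p) (u \<odot> p')" by (rule sntr_hcomp[OF p sD(2) g sntr_id[OF sD(2)]])
  have S: "square A' A B' B p u q b (\<alpha> \<bullet> (id_ntr u \<star> \<gamma>))"
    unfolding square_def using sD p sntr_vcomp[OF up n sD(5)] by simp
  note L = lo_obj[OF sD(2) X] and p'X = res_obj[OF sD(1) X]
  note G = two_hom[OF p g X] and M = mate_hom[OF s X] and GL = two_hom[OF p g res_obj[OF sD(2) L]]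
  note A' = D_cat[OF sfuncD(1)[OF sD(1)]] and B' = D_cat[OF sfuncD(1)[OF sD(4)]]
  note lG = la_hom[OF sD(3) G] and e = eta_hom[OF sD(2) X]
  have t: "two (\<alpha> \<bullet> (id_ntr u \<star> \<gamma>)) (lo u X) = two \<alpha> (lo u X) \<cdot>\<^bsub>onc D A'\<^esub> two \<gamma> (res u (lo u X))"
    using two_vcomp[OF up n sD(5) L] two_whisker_left[OF p sD(2) g L] by simp
  let ?c = "\<lambda>g f. g \<cdot>\<^bsub>onc D A'\<^esub> f"
  show ?thesis
  proof (rule mate_unique[OF S X hom_comp[OF B' lG M]])
    have "?c (resa q (lan_mate D p' u q b \<alpha> X \<cdot>\<^bsub>onc D B'\<^esub> la q (two \<gamma> X))) (eta q (res p X))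
      = ?c (resa q (lan_mate D p' u q b \<alpha> X)) (?c (eta q (res p' X)) (two \<gamma> X))"
      unfolding resa_comp[OF sD(3) lG M] eta_nat[OF sD(3) G]
      by (rule hom_assoc[OF A' eta_hom[OF sD(3) res_obj[OF p X]] resa_hom[OF sD(3) lG] resa_hom[OF sD(3) M], symmetric])
    also have "\<dots> = ?c (cotranspose A' p' u \<alpha> X) (two \<gamma> X)"
      unfolding mate_transpose[OF s X, symmetric]
      by (rule hom_assoc[OF A' G eta_hom[OF sD(3) p'X] resa_hom[OF sD(3) M]])
    also have "\<dots> = ?c (two \<alpha> (lo u X)) (?c (resa p' (eta u X)) (two \<gamma> X))"
      unfolding cotranspose_def
      by (rule hom_assoc[OF A' G resa_hom[OF sD(1) e] square_two_hom[OF s L], symmetric])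
    also have "\<dots> = ?c (two \<alpha> (lo u X)) (?c (two \<gamma> (res u (lo u X))) (resa p (eta u X)))"
      using two_nat[OF p g e] by simp
    also have "\<dots> = cotranspose A' p u (\<alpha> \<bullet> (id_ntr u \<star> \<gamma>)) X"
      unfolding t cotranspose_def
      by (rule hom_assoc[OF A' resa_hom[OF p e] GL square_two_hom[OF s L]])
    finally show "?c (resa q (lan_mate D p' u q b \<alpha> X \<cdot>\<^bsub>onc D B'\<^esub> la q (two \<gamma> X))) (eta q (res p X))
      = cotranspose A' p u (\<alpha> \<bullet> (id_ntr u \<star> \<gamma>)) X" .
  qed
qed

text \<open>Uniqueness of left adjoints, carried out at one object: f and g are the adjuncts of the
  units of the two candidates, and both composites have the adjunct of an identity. An isomorphism
  at each object is what membership in an essential image asks for.\<close>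

lemma lan_comp_iso:
  assumes v: "sfunc sm v A B" and w: "sfunc sm w B C" and X: "X \<in> Obj (onc D A)"
  shows "\<exists>f. iso (onc D C) f \<and> f \<in> hom (onc D C) (lo w (lo v X)) (lo (w \<odot> v) X)"
proof -
  note wv = sfunc_comp[OF v w]
  note A = D_cat[OF sfuncD(1)[OF v]] and B = D_cat[OF sfuncD(2)[OF v]] and C = D_cat[OF sfuncD(2)[OF w]]
  let ?Y = "lo v X" and ?W = "lo w (lo v X)" and ?Z = "lo (w \<odot> v) X"
  note Y = lo_obj[OF v X] note W = lo_obj[OF w Y] and Z = lo_obj[OF wv X]
  have eZ: "eta (w \<odot> v) X \<in> hom (onc D A) X (res v (res w ?Z))"
    using eta_hom[OF wv X] res_comp[OF v w Z] by simp
  \<comment> \<open>The unit of the composite adjunction w_! v_! at X.\<close>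
  define e where "e = resa v (eta w ?Y) \<cdot>\<^bsub>onc D A\<^esub> eta v X"
  note ev = eta_hom[OF v X] and ew = eta_hom[OF w Y]
  have e: "e \<in> hom (onc D A) X (res v (res w ?W))"
    unfolding e_def by (rule hom_comp[OF A ev resa_hom[OF v ew]])
  have e': "e \<in> hom (onc D A) X (res (w \<odot> v) ?W)" using e res_comp[OF v w W] by simp
  define g where "g = eps (w \<odot> v) ?W \<cdot>\<^bsub>onc D C\<^esub> la (w \<odot> v) e"
  have g: "g \<in> hom (onc D C) ?Z ?W" and gt: "resa (w \<odot> v) g \<cdot>\<^bsub>onc D A\<^esub> eta (w \<odot> v) X = e"
    using transpose[OF wv W e'] by (auto simp add: g_def)
  define f1 where "f1 = eps v (res w ?Z) \<cdot>\<^bsub>onc D B\<^esub> la v (eta (w \<odot> v) X)"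
  have f1: "f1 \<in> hom (onc D B) ?Y (res w ?Z)" and f1t: "resa v f1 \<cdot>\<^bsub>onc D A\<^esub> eta v X = eta (w \<odot> v) X"
    using transpose[OF v res_obj[OF w Z] eZ] by (auto simp add: f1_def)
  define f where "f = eps w ?Z \<cdot>\<^bsub>onc D C\<^esub> la w f1"
  have f: "f \<in> hom (onc D C) ?W ?Z" and ft: "resa w f \<cdot>\<^bsub>onc D B\<^esub> eta w ?Y = f1"
    using transpose[OF w Z f1] by (auto simp add: f_def)
  let ?c = "\<lambda>g f. g \<cdot>\<^bsub>onc D A\<^esub> f"
  have fe: "?c (resa v (resa w f)) e = eta (w \<odot> v) X"
    unfolding e_def f1t[symmetric] ft[symmetric] resa_comp[OF v ew resa_hom[OF w f]]
    by (rule hom_assoc[OF A ev resa_hom[OF v ew] resa_hom[OF v resa_hom[OF w f]]])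
  have "?c (resa (w \<odot> v) (f \<cdot>\<^bsub>onc D C\<^esub> g)) (eta (w \<odot> v) X) = ?c (resa (w \<odot> v) f) e"
    unfolding resa_comp[OF wv g f] gt[symmetric]
    by (rule hom_assoc[OF A eta_hom[OF wv X] resa_hom[OF wv g] resa_hom[OF wv f], symmetric])
  then have "f \<cdot>\<^bsub>onc D C\<^esub> g = Ident (onc D C) ?Z"
    using lan_eqI[OF wv X hom_comp[OF C g f] hom_ident[OF C Z]] fe resa_comp_func[OF v w f]
      resa_ident[OF wv Z] hom_unit(1)[OF A eta_hom[OF wv X]] by simp
  moreover have "g \<cdot>\<^bsub>onc D C\<^esub> f = Ident (onc D C) ?W"
  proof (rule lan_eqI[OF w Y hom_comp[OF C f g] hom_ident[OF C W]])
    note wg = resa_hom[OF w g] and wf = resa_hom[OF w f]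
    have c1: "resa w (g \<cdot>\<^bsub>onc D C\<^esub> f) \<cdot>\<^bsub>onc D B\<^esub> eta w ?Y = resa w g \<cdot>\<^bsub>onc D B\<^esub> f1"
      unfolding ft[symmetric] resa_comp[OF w f g] by (rule hom_assoc[OF B ew wf wg, symmetric])
    have "?c (resa v (resa w g \<cdot>\<^bsub>onc D B\<^esub> f1)) (eta v X) = ?c (resa v (resa w g)) (eta (w \<odot> v) X)"
      unfolding f1t[symmetric] resa_comp[OF v f1 wg]
      by (rule hom_assoc[OF A ev resa_hom[OF v f1] resa_hom[OF v wg], symmetric])
    also have "\<dots> = ?c (resa v (eta w ?Y)) (eta v X)" using gt resa_comp_func[OF v w g] by (simp add: e_def)
    finally have "resa w g \<cdot>\<^bsub>onc D B\<^esub> f1 = eta w ?Y" by (rule lan_eqI[OF v X hom_comp[OF B f1 wg] ew])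
    then show "resa w (g \<cdot>\<^bsub>onc D C\<^esub> f) \<cdot>\<^bsub>onc D B\<^esub> eta w ?Y = resa w (Ident (onc D C) ?W) \<cdot>\<^bsub>onc D B\<^esub> eta w ?Y"
      using c1 resa_ident[OF w W] hom_unit(1)[OF B ew] by simp
  qed
  ultimately have "iso (onc D C) f" using iso_iff[OF f] g by blast
  then show ?thesis using f by blast
qed

end

section \<open>Exact squares\<close>

text \<open>
  A cone \<open>\<alpha> : u \<odot> p \<Rightarrow> b\<close> on \<open>J\<close> is reflective if the functor \<open>J \<rightarrow> (u/b)\<close> it induces has a left
  adjoint \<open>l\<close> that is moreover a strict retraction, with trivial unit on the image of \<open>J\<close>;
  \<open>h\<close> is the first component of the unit.
\<close>

definition reflective_cone ::
  "('k elem set \<Rightarrow> bool) \<Rightarrow> 'k scat \<Rightarrow> 'k sfunc \<Rightarrow> 'k sfunc \<Rightarrow> 'k elem \<Rightarrow> 'k sntr \<Rightarrow> bool" where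
  "reflective_cone sm J p u b \<alpha> \<longleftrightarrow> sfunc sm p J (Src u) \<and>
     sntr sm \<alpha> (u \<odot> p) (pt (Tgt u) b \<odot> to_one J) \<and>
     (\<exists>l h. sfunc sm l (slice u b) J \<and> sntr sm h (slice_proj u b) (p \<odot> l) \<and>
       (\<forall>x \<in> Obj (slice u b). cmp \<alpha> (omap l x) \<cdot>\<^bsub>Tgt u\<^esub> amap u (cmp h x) = psnd x) \<and>
       (\<forall>j \<in> Obj J. omap l (Pair (omap p j) (cmp \<alpha> j)) = j \<and>
          cmp h (Pair (omap p j) (cmp \<alpha> j)) = Ident (Src u) (omap p j)) \<and>
       (\<forall>t \<in> Arr J. amap l (Pair (amap p t) (cmp \<alpha> (Cod J t))) = t))"

text \<open>The functor \<open>p\<close> followed by the inclusion of A x {k} into A x K. The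
  categories J and A are read off from the record \<open>p\<close>, so only K and k are passed
  separately.\<close>

definition at_point :: "'k scat \<Rightarrow> 'k elem \<Rightarrow> 'k sfunc \<Rightarrow> 'k sfunc" where
  "at_point K k p = mk_func (Src p) (Tgt p \<otimes> K) (\<lambda>j. Pair (omap p j) k) (\<lambda>t. Pair (amap p t) (Ident K k))"

definition cone_at_point :: "'k scat \<Rightarrow> 'k elem \<Rightarrow> 'k sfunc \<Rightarrow> 'k sfunc \<Rightarrow> 'k elem \<Rightarrow> 'k sntr \<Rightarrow> 'k sntr" where
  "cone_at_point K k p u b \<alpha> = mk_ntr ((u \<otimes>\<^sub>f id_func K) \<odot> at_point K k p)
     (pt (Tgt u \<otimes> K) (Pair b k) \<odot> to_one (Src p)) (\<lambda>j. Pair (cmp \<alpha> j) (Ident K k))"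

lemma at_point_simps [simp]:
  "Src (at_point K k p) = Src p" "Tgt (at_point K k p) = Tgt p \<otimes> K"
  "j \<in> Obj (Src p) \<Longrightarrow> omap (at_point K k p) j = Pair (omap p j) k"
  "t \<in> Arr (Src p) \<Longrightarrow> amap (at_point K k p) t = Pair (amap p t) (Ident K k)"
  by (simp_all add: at_point_def)

lemma cone_at_point_simps [simp]:
  "NSrc (cone_at_point K k p u b \<alpha>) = (u \<otimes>\<^sub>f id_func K) \<odot> at_point K k p"
  "NTgt (cone_at_point K k p u b \<alpha>) = pt (Tgt u \<otimes> K) (Pair b k) \<odot> to_one (Src p)"
  "j \<in> Obj (Src p) \<Longrightarrow> cmp (cone_at_point K k p u b \<alpha>) j = Pair (cmp \<alpha> j) (Ident K k)"
  by (simp_all add: cone_at_point_def)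

lemma sfunc_at_point:
  assumes sm: "smallness sm" and p: "sfunc sm p J A" and K: "K \<in> Cat sm" and k: "k \<in> Obj K"
  shows "sfunc sm (at_point K k p) J (A \<otimes> K)"
proof -
  note pD = sfuncD[OF p] and P = is_funcD[OF sfuncD(3)[OF p]] and C = category_simps[OF Cat_category[OF K]]
  have "is_func (at_point K k p) J (A \<otimes> K)"
    unfolding at_point_def pD(4,5)
    by (rule is_func_mk) (auto simp add: P C k category_prod_cat Cat_category[OF K])
  then show ?thesis using pD prod_cat_Cat[OF sm pD(2) K] by (simp add: sfunc_def)
qed

section \<open>Colimits as universal maps to constant diagrams\<close>

context derivator_context
begin

text \<open>The map m exhibits W as a colimit of Y: it is initial among the maps from Y to constant
  diagrams. The chosen colimit \<open>lo (to_one J) Y\<close> does not occur, and this makes it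
  possible to move between index categories.\<close>

definition universal :: "'k scat \<Rightarrow> 'o \<Rightarrow> 'o \<Rightarrow> 'm \<Rightarrow> bool" where
  "universal J Y W m \<longleftrightarrow> W \<in> Obj (onc D one) \<and> m \<in> hom (onc D J) Y (res (to_one J) W) \<and>
     (\<forall>Z \<in> Obj (onc D one). \<forall>\<phi> \<in> hom (onc D J) Y (res (to_one J) Z).
        \<exists>!g. g \<in> hom (onc D one) W Z \<and> resa (to_one J) g \<cdot>\<^bsub>onc D J\<^esub> m = \<phi>)"

lemma D_one: "category (onc D one)"
  by (rule D_cat[OF one_Cat[OF small]])

lemma universal_iso:
  assumes J: "J \<in> Cat sm" and m: "universal J Y W m" and m': "universal J Y W' m'"
    and g: "g \<in> hom (onc D one) W W'" and e: "resa (to_one J) g \<cdot>\<^bsub>onc D J\<^esub> m = m'"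
  shows "iso (onc D one) g"
proof -
  note t = sfunc_to_one[OF small J] and DJ = D_cat[OF J]
  have W: "W \<in> Obj (onc D one)" and mh: "m \<in> hom (onc D J) Y (res (to_one J) W)"
    and mu: "\<And>Z \<phi>. Z \<in> Obj (onc D one) \<Longrightarrow> \<phi> \<in> hom (onc D J) Y (res (to_one J) Z) \<Longrightarrow>
        \<exists>!g. g \<in> hom (onc D one) W Z \<and> resa (to_one J) g \<cdot>\<^bsub>onc D J\<^esub> m = \<phi>"
    using m unfolding universal_def by blast+
  have W': "W' \<in> Obj (onc D one)" and mh': "m' \<in> hom (onc D J) Y (res (to_one J) W')"
    and mu': "\<And>Z \<phi>. Z \<in> Obj (onc D one) \<Longrightarrow> \<phi> \<in> hom (onc D J) Y (res (to_one J) Z) \<Longrightarrow>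
        \<exists>!g. g \<in> hom (onc D one) W' Z \<and> resa (to_one J) g \<cdot>\<^bsub>onc D J\<^esub> m' = \<phi>"
    using m' unfolding universal_def by blast+
  obtain f where f: "f \<in> hom (onc D one) W' W" and fe: "resa (to_one J) f \<cdot>\<^bsub>onc D J\<^esub> m' = m"
    using mu'[OF W mh] by blast
  have "resa (to_one J) (f \<cdot>\<^bsub>onc D one\<^esub> g) \<cdot>\<^bsub>onc D J\<^esub> m = m"
    unfolding resa_comp[OF t g f] using hom_assoc[OF DJ mh resa_hom[OF t g] resa_hom[OF t f]] e fe by simp
  moreover have "resa (to_one J) (Ident (onc D one) W) \<cdot>\<^bsub>onc D J\<^esub> m = m"
    using resa_ident[OF t W] hom_unit(1)[OF DJ mh] by simp
  ultimately have 1: "f \<cdot>\<^bsub>onc D one\<^esub> g = Ident (onc D one) W"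
    using mu[OF W mh] hom_comp[OF D_one g f] hom_ident[OF D_one W] by blast
  have "resa (to_one J) (g \<cdot>\<^bsub>onc D one\<^esub> f) \<cdot>\<^bsub>onc D J\<^esub> m' = m'"
    unfolding resa_comp[OF t f g] using hom_assoc[OF DJ mh' resa_hom[OF t f] resa_hom[OF t g]] e fe by simp
  moreover have "resa (to_one J) (Ident (onc D one) W') \<cdot>\<^bsub>onc D J\<^esub> m' = m'"
    using resa_ident[OF t W'] hom_unit(1)[OF DJ mh'] by simp
  ultimately have 2: "g \<cdot>\<^bsub>onc D one\<^esub> f = Ident (onc D one) W'"
    using mu'[OF W' mh'] hom_comp[OF D_one f g] hom_ident[OF D_one W'] by blast
  show ?thesis using iso_iff[OF g] f 1 2 by blast
qed

lemma eta_universal: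
  assumes J: "J \<in> Cat sm" and Y: "Y \<in> Obj (onc D J)"
  shows "universal J Y (lo (to_one J) Y) (eta (to_one J) Y)"
proof -
  note t = sfunc_to_one[OF small J]
  show ?thesis
    unfolding universal_def
  proof (intro conjI ballI)
    fix Z \<phi> assume Z: "Z \<in> Obj (onc D one)" and p: "\<phi> \<in> hom (onc D J) Y (res (to_one J) Z)"
    show "\<exists>!g. g \<in> hom (onc D one) (lo (to_one J) Y) Z \<and> resa (to_one J) g \<cdot>\<^bsub>onc D J\<^esub> eta (to_one J) Y = \<phi>"
      using transpose[OF t Z p] lan_eqI[OF t Y] by blast
  qed (simp_all add: lo_obj[OF t Y] eta_hom[OF t Y])
qed

lemma iso_universal:
  assumes J: "J \<in> Cat sm" and m: "universal J Y W m" and g: "g \<in> hom (onc D one) W W'" and i: "iso (onc D one) g"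
  shows "universal J Y W' (resa (to_one J) g \<cdot>\<^bsub>onc D J\<^esub> m)"
proof -
  note t = sfunc_to_one[OF small J] and DJ = D_cat[OF J]
  have W: "W \<in> Obj (onc D one)" and mh: "m \<in> hom (onc D J) Y (res (to_one J) W)"
    and mu: "\<And>Z \<phi>. Z \<in> Obj (onc D one) \<Longrightarrow> \<phi> \<in> hom (onc D J) Y (res (to_one J) Z) \<Longrightarrow>
        \<exists>!g. g \<in> hom (onc D one) W Z \<and> resa (to_one J) g \<cdot>\<^bsub>onc D J\<^esub> m = \<phi>"
    using m unfolding universal_def by blast+
  obtain f where f: "f \<in> hom (onc D one) W' W" "f \<cdot>\<^bsub>onc D one\<^esub> g = Ident (onc D one) W" "g \<cdot>\<^bsub>onc D one\<^esub> f = Ident (onc D one) W'"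
    using iso_iff[OF g] i by blast
  have a: "resa (to_one J) k \<cdot>\<^bsub>onc D J\<^esub> (resa (to_one J) g \<cdot>\<^bsub>onc D J\<^esub> m) = resa (to_one J) (k \<cdot>\<^bsub>onc D one\<^esub> g) \<cdot>\<^bsub>onc D J\<^esub> m"
    if k: "k \<in> hom (onc D one) W' Z" for k Z
    unfolding resa_comp[OF t g k] by (rule hom_assoc[OF DJ mh resa_hom[OF t g] resa_hom[OF t k]])
  show ?thesis
    unfolding universal_def
  proof (intro conjI ballI)
    fix Z \<phi> assume Z: "Z \<in> Obj (onc D one)" and p: "\<phi> \<in> hom (onc D J) Y (res (to_one J) Z)"
    obtain k where k: "k \<in> hom (onc D one) W Z" "resa (to_one J) k \<cdot>\<^bsub>onc D J\<^esub> m = \<phi>"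
      using mu[OF Z p] by blast
    show "\<exists>!h. h \<in> hom (onc D one) W' Z \<and> resa (to_one J) h \<cdot>\<^bsub>onc D J\<^esub> (resa (to_one J) g \<cdot>\<^bsub>onc D J\<^esub> m) = \<phi>"
    proof (rule ex1I[of _ "k \<cdot>\<^bsub>onc D one\<^esub> f"])
      have "k \<cdot>\<^bsub>onc D one\<^esub> f \<cdot>\<^bsub>onc D one\<^esub> g = k"
        using hom_assoc[OF D_one g f(1) k(1)] f(2) hom_unit(2)[OF D_one k(1)] by simp
      then show "k \<cdot>\<^bsub>onc D one\<^esub> f \<in> hom (onc D one) W' Z \<and>
          resa (to_one J) (k \<cdot>\<^bsub>onc D one\<^esub> f) \<cdot>\<^bsub>onc D J\<^esub> (resa (to_one J) g \<cdot>\<^bsub>onc D J\<^esub> m) = \<phi>"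
        using a[OF hom_comp[OF D_one f(1) k(1)]] hom_comp[OF D_one f(1) k(1)] k(2) by simp
      fix h assume h: "h \<in> hom (onc D one) W' Z \<and> resa (to_one J) h \<cdot>\<^bsub>onc D J\<^esub> (resa (to_one J) g \<cdot>\<^bsub>onc D J\<^esub> m) = \<phi>"
      then have hh: "h \<in> hom (onc D one) W' Z" by blast
      have "h \<cdot>\<^bsub>onc D one\<^esub> g = k"
        using mu[OF Z p] hom_comp[OF D_one g hh] h a[OF hh] k by auto
      then show "h = k \<cdot>\<^bsub>onc D one\<^esub> f"
        using hom_assoc[OF D_one f(1) g hh] f(3) hom_unit(2)[OF D_one hh] by simp
    qed
  qed (use hom_Obj(2)[OF D_one g] hom_comp[OF DJ mh resa_hom[OF t g]] in simp_all)
qed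

text \<open>The mate carries the unit of the chosen colimit over J, a universal map, to the
  cotranspose. A map between objects under Y is invertible exactly when it carries a universal map
  to a universal map.\<close>

lemma mate_iso_iff_universal:
  assumes s: "square J A one B p u (to_one J) b \<alpha>" and X: "X \<in> Obj (onc D A)"
  shows "iso (onc D one) (lan_mate D p u (to_one J) b \<alpha> X) \<longleftrightarrow>
    universal J (res p X) (res b (lo u X)) (cotranspose J p u \<alpha> X)"
proof -
  note J = sfuncD(1)[OF squareD(1)[OF s]]
  note e = eta_universal[OF J res_obj[OF squareD(1)[OF s] X]]
  show ?thesis
    using iso_universal[OF J e mate_hom[OF s X]] universal_iso[OF J e _ mate_hom[OF s X]] mate_transpose[OF s X] by auto
qed

text \<open>Der4 with the chosen colimit over the slice removed. In this form it can be restricted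
  along a functor into the slice.\<close>

lemma slice_universal:
  assumes u: "sfunc sm u A B" and b: "b \<in> Obj B" and X: "X \<in> Obj (onc D A)"
  shows "universal (slice u b) (res (slice_proj u b) X) (res (pt B b) (lo u X))
     (cotranspose (slice u b) (slice_proj u b) u (slice_ntr u b) X)"
proof -
  have s: "square (slice u b) A one B (slice_proj u b) u (to_one (slice u b)) (pt B b) (slice_ntr u b)"
    unfolding square_def using u sfunc_slice_proj[OF small u] sfunc_to_one[OF small slice_Cat[OF small u]]
      sfunc_pt[OF small sfuncD(2)[OF u] b] sntr_slice[OF small u b] by simp
  have "iso (onc D one) (lan_mate D (slice_proj u b) u (to_one (slice u b)) (pt B b) (slice_ntr u b) X)"
    using der u b X unfolding derivator_def Der4_def by blast
  then show ?thesis using mate_iso_iff_universal[OF s X] by simp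
qed

text \<open>Maps from Y to a constant diagram on S correspond to maps from r^* Y to the same
  constant diagram on J. One direction is r^*, the other sends \<phi> to l^* \<phi> composed with
  the component of \<eta> at Y. They are mutually inverse because \<eta> is trivial on the image of
  r and on constant diagrams.\<close>

lemma universal_restrict:
  assumes r: "sfunc sm r J S" and l: "sfunc sm l S J" and lr: "l \<odot> r = id_func J"
    and n: "sntr sm \<eta> (id_func S) (r \<odot> l)" and nr: "\<eta> \<star> id_ntr r = id_ntr r"
    and m: "universal S Y W m" and Y: "Y \<in> Obj (onc D S)"
  shows "universal J (res r Y) W (resa r m)"
proof -
  note J = sfuncD(1)[OF r] and S = sfuncD(2)[OF r]
  note tS = sfunc_to_one[OF small S] and tJ = sfunc_to_one[OF small J]
  note DJ = D_cat[OF J] and DS = D_cat[OF S]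
  have tr: "to_one S \<odot> r = to_one J" using func_to_one[OF small sfunc_comp[OF r tS]] .
  have tl: "to_one J \<odot> l = to_one S" using func_to_one[OF small sfunc_comp[OF l tJ]] .
  have W: "W \<in> Obj (onc D one)" and mh: "m \<in> hom (onc D S) Y (res (to_one S) W)"
    and mu: "\<And>Z \<phi>. Z \<in> Obj (onc D one) \<Longrightarrow> \<phi> \<in> hom (onc D S) Y (res (to_one S) Z) \<Longrightarrow>
        \<exists>!g. g \<in> hom (onc D one) W Z \<and> resa (to_one S) g \<cdot>\<^bsub>onc D S\<^esub> m = \<phi>"
    using m unfolding universal_def by blast+
  have rt: "res r (res (to_one S) Z) = res (to_one J) Z" if "Z \<in> Obj (onc D one)" for Z
    using res_comp[OF r tS that] tr by simp
  have rta: "resa r (resa (to_one S) g) = resa (to_one J) g" if "g \<in> hom (onc D one) Z Z'" for g Z Z'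
    using resa_comp_func[OF r tS that] tr by simp
  have lt: "res l (res (to_one J) Z) = res (to_one S) Z" if "Z \<in> Obj (onc D one)" for Z
    using res_comp[OF l tJ that] tl by simp
  have lta: "resa l (resa (to_one J) g) = resa (to_one S) g" if "g \<in> hom (onc D one) Z Z'" for g Z Z'
    using resa_comp_func[OF l tJ that] tl by simp
  have iS: "sfunc sm (id_func S) S S" by (rule sfunc_id[OF S])
  have resid: "res (id_func S) T = T" if "T \<in> Obj (onc D S)" for T using that onf_id[OF S] by simp
  have resaid: "resa (id_func S) g = g" if "g \<in> hom (onc D S) T T'" for g T T' using that onf_id[OF S] by (simp add: hom_iff)
  have rl: "res (r \<odot> l) T = res l (res r T)" if "T \<in> Obj (onc D S)" for T by (rule res_comp[OF l r that])
  have nh: "two \<eta> T \<in> hom (onc D S) T (res l (res r T))" if "T \<in> Obj (onc D S)" for T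
    using two_hom[OF iS n that] resid[OF that] rl[OF that] by simp
  have rn: "resa r (two \<eta> T) = Ident (onc D J) (res r T)" if "T \<in> Obj (onc D S)" for T
    using two_whisker_right[OF r iS n that] two_id[OF r that] nr by simp
  \<comment> \<open>Followed by the projection to \<open>one\<close>, \<eta> becomes an identity
    transformation, and its value at a constant diagram is the value of that composite.\<close>
  have nt: "two \<eta> (res (to_one S) Z) = Ident (onc D S) (res (to_one S) Z)" if Z: "Z \<in> Obj (onc D one)" for Z
  proof -
    have w: "sntr sm (id_ntr (to_one S) \<star> \<eta>) (to_one S) (to_one S \<odot> (r \<odot> l))"
      using sntr_hcomp[OF iS tS n sntr_id[OF tS]] by (simp add: comp_func_id(1)[OF sfuncD(3)[OF tS]])
    show ?thesis
      using two_whisker_left[OF iS tS n Z] ntr_to_one[OF small tS w] two_id[OF tS Z] by simp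
  qed
  have rm: "resa r m \<in> hom (onc D J) (res r Y) (res (to_one J) W)" using resa_hom[OF r mh] rt[OF W] by simp
  \<comment> \<open>Extending back from J undoes restriction to J. This is naturality of \<eta> at m
    together with the triviality of \<eta> on constant diagrams.\<close>
  have key: "resa l (resa (to_one J) g \<cdot>\<^bsub>onc D J\<^esub> resa r m) \<cdot>\<^bsub>onc D S\<^esub> two \<eta> Y = resa (to_one S) g \<cdot>\<^bsub>onc D S\<^esub> m"
    if g: "g \<in> hom (onc D one) W Z" for g Z
  proof -
    note tg = resa_hom[OF tJ g]
    have lrm: "resa l (resa r m) \<in> hom (onc D S) (res l (res r Y)) (res (to_one S) W)"
      using resa_hom[OF l rm] lt[OF W] by simp
    have tg': "resa (to_one S) g \<in> hom (onc D S) (res (to_one S) W) (res (to_one S) Z)" by (rule resa_hom[OF tS g])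
    have "resa l (resa r m) \<cdot>\<^bsub>onc D S\<^esub> two \<eta> Y = m"
      using two_nat[OF iS n mh] resa_comp_func[OF l r mh] resaid[OF mh] nt[OF W] hom_unit(1)[OF DS mh] by simp
    then show ?thesis
      unfolding resa_comp[OF l rm tg] lta[OF g] using hom_assoc[OF DS nh[OF Y] lrm tg'] by simp
  qed
  show ?thesis
    unfolding universal_def
  proof (intro conjI ballI)
    show "W \<in> Obj (onc D one)" by (rule W)
    show "resa r m \<in> hom (onc D J) (res r Y) (res (to_one J) W)" by (rule rm)
    fix Z \<phi> assume Z: "Z \<in> Obj (onc D one)" and p: "\<phi> \<in> hom (onc D J) (res r Y) (res (to_one J) Z)"
    have lp: "resa l \<phi> \<in> hom (onc D S) (res l (res r Y)) (res (to_one S) Z)" using resa_hom[OF l p] lt[OF Z] by simp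
    \<comment> \<open>The extension of \<phi> to S; universality of m over S is applied to
      it.\<close>
    define \<psi> where "\<psi> = resa l \<phi> \<cdot>\<^bsub>onc D S\<^esub> two \<eta> Y"
    have psi: "\<psi> \<in> hom (onc D S) Y (res (to_one S) Z)" unfolding \<psi>_def by (rule hom_comp[OF DS nh[OF Y] lp])
    obtain g where g: "g \<in> hom (onc D one) W Z" "resa (to_one S) g \<cdot>\<^bsub>onc D S\<^esub> m = \<psi>" using mu[OF Z psi] by blast
    have rlp: "resa r (resa l \<phi>) = \<phi>"
      using resa_comp_func[OF r l p] lr onf_id[OF J] p by (simp add: hom_iff)
    have "resa (to_one J) g \<cdot>\<^bsub>onc D J\<^esub> resa r m = resa r \<psi>"
      unfolding g(2)[symmetric] resa_comp[OF r mh resa_hom[OF tS g(1)]] rta[OF g(1)] ..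
    also have "\<dots> = \<phi> \<cdot>\<^bsub>onc D J\<^esub> Ident (onc D J) (res r Y)"
      unfolding \<psi>_def resa_comp[OF r nh[OF Y] lp] rn[OF Y] rlp ..
    also have "\<dots> = \<phi>" by (rule hom_unit(2)[OF DJ p])
    finally have ge: "resa (to_one J) g \<cdot>\<^bsub>onc D J\<^esub> resa r m = \<phi>" .
    show "\<exists>!g. g \<in> hom (onc D one) W Z \<and> resa (to_one J) g \<cdot>\<^bsub>onc D J\<^esub> resa r m = \<phi>"
    proof (rule ex1I[of _ g])
      fix g' assume "g' \<in> hom (onc D one) W Z \<and> resa (to_one J) g' \<cdot>\<^bsub>onc D J\<^esub> resa r m = \<phi>"
      then have g': "g' \<in> hom (onc D one) W Z" "resa (to_one J) g' \<cdot>\<^bsub>onc D J\<^esub> resa r m = \<phi>" by blast+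
      have "resa (to_one S) g' \<cdot>\<^bsub>onc D S\<^esub> m = \<psi>"
        using key[OF g'(1)] key[OF g(1)] g'(2) ge by (simp add: \<psi>_def)
      then show "g' = g" using mu[OF Z psi] g g'(1) by blast
    qed (use g(1) ge in simp)
  qed
qed

lemma square_at_point:
  assumes c: "reflective_cone sm J p u b \<alpha>" and u: "sfunc sm u A B" and b: "b \<in> Obj B" and K: "K \<in> Cat sm" and k: "k \<in> Obj K"
  shows "square J (A \<otimes> K) one (B \<otimes> K) (at_point K k p) (u \<otimes>\<^sub>f id_func K) (to_one J) (pt (B \<otimes> K) (Pair b k))
      (cone_at_point K k p u b \<alpha>)"
proof -
  note uD = sfuncD[OF u]
  have p: "sfunc sm p J A" and a: "sntr sm \<alpha> (u \<odot> p) (pt B b \<odot> to_one J)"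
    using c uD by (auto simp add: reflective_cone_def)
  note pD = sfuncD[OF p]
  note t = sfunc_to_one[OF small pD(1)] and pp = sfunc_at_point[OF small p K k]
  have bk: "Pair b k \<in> Obj (B \<otimes> K)" using b k by simp
  note pb = sfunc_pt[OF small prod_cat_Cat[OF small uD(2) K] bk]
  note uK = sfunc_prod[OF small u sfunc_id[OF K]]
  note s = sfunc_comp[OF pp uK]
  note aD = is_ntrD[OF sntrD(1)[OF a sfunc_comp[OF p u]] sfuncD(3)[OF sfunc_comp[OF p u]]]
  note F = is_funcD[OF pD(3)] is_funcD[OF uD(3)] category_simps[OF Cat_category[OF K]]
    category_simps[OF Cat_category[OF uD(2)]]
  have "sntr sm (cone_at_point K k p u b \<alpha>) ((u \<otimes>\<^sub>f id_func K) \<odot> at_point K k p) (pt (B \<otimes> K) (Pair b k) \<odot> to_one J)"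
  proof (rule sntrI[OF s], unfold cone_at_point_def uD(5) pD(4), rule is_ntr_mk[OF sfuncD(3)[OF s] sfuncD(3)[OF sfunc_comp[OF t pb]]])
    fix j assume "j \<in> Obj J"
    then show "Pair (cmp \<alpha> j) (Ident K k) \<in> hom (B \<otimes> K) (omap ((u \<otimes>\<^sub>f id_func K) \<odot> at_point K k p) j)
          (omap (pt (B \<otimes> K) (Pair b k) \<odot> to_one J) j)"
      using aD(5-7)[of j] b k by (simp add: hom_iff F)
  next
    fix f assume "f \<in> Arr J"
    then show "Pair (cmp \<alpha> (Cod J f)) (Ident K k) \<cdot>\<^bsub>B \<otimes> K\<^esub> amap ((u \<otimes>\<^sub>f id_func K) \<odot> at_point K k p) f =
         amap (pt (B \<otimes> K) (Pair b k) \<odot> to_one J) f \<cdot>\<^bsub>B \<otimes> K\<^esub> Pair (cmp \<alpha> (Dom J f)) (Ident K k)"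
      using aD(5-7)[of "Cod J f"] aD(5-7)[of "Dom J f"] aD(8)[of f] b k by (simp add: F category_simps[OF Cat_category[OF pD(1)]])
  qed
  then show ?thesis unfolding square_def using pp uK t pb by simp
qed

text \<open>The retraction onto J lifts from (u/b) to the slice of u x K over (b, k). The additional
  coordinate of that slice is an object of K over k, and the identity of k is terminal among those.
  Der4 provides a universal map over the large slice, and its restriction along the lifted inclusion
  of J is the cotranspose of the cone at k.\<close>

lemma reflective_cone_exact:
  assumes c: "reflective_cone sm J p u b \<alpha>" and u: "sfunc sm u A B" and b: "b \<in> Obj B" and K: "K \<in> Cat sm" and k: "k \<in> Obj K"
    and X: "X \<in> Obj (onc D (A \<otimes> K))"
  shows "iso (onc D one) (lan_mate D (at_point K k p) (u \<otimes>\<^sub>f id_func K) (to_one J) (pt (B \<otimes> K) (Pair b k))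
      (cone_at_point K k p u b \<alpha>) X)"
proof -
  note uD = sfuncD[OF u]
  obtain l h where p: "sfunc sm p J A" and a: "sntr sm \<alpha> (u \<odot> p) (pt B b \<odot> to_one J)"
    and l: "sfunc sm l (slice u b) J" and h: "sntr sm h (slice_proj u b) (p \<odot> l)"
    and fac: "\<And>x. x \<in> Obj (slice u b) \<Longrightarrow> cmp \<alpha> (omap l x) \<cdot>\<^bsub>B\<^esub> amap u (cmp h x) = psnd x"
    and lo: "\<And>j. j \<in> Obj J \<Longrightarrow> omap l (Pair (omap p j) (cmp \<alpha> j)) = j"
    and ho: "\<And>j. j \<in> Obj J \<Longrightarrow> cmp h (Pair (omap p j) (cmp \<alpha> j)) = Ident A (omap p j)"
    and la: "\<And>t. t \<in> Arr J \<Longrightarrow> amap l (Pair (amap p t) (cmp \<alpha> (Cod J t))) = t"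
    using c uD unfolding reflective_cone_def by auto
  note pD = sfuncD[OF p] and lD = sfuncD[OF l]
  note uK = sfunc_prod[OF small u sfunc_id[OF K]] note uKD = sfuncD[OF uK]
  have bk: "Pair b k \<in> Obj (B \<otimes> K)" using b k by simp
  define S where "S = slice (u \<otimes>\<^sub>f id_func K) (Pair b k)"
  note aD = is_ntrD[OF sntrD(1)[OF a sfunc_comp[OF p u]] sfuncD(3)[OF sfunc_comp[OF p u]]]
  note hD = is_ntrD[OF sntrD(1)[OF h sfunc_slice_proj[OF small u]] sfuncD(3)[OF sfunc_slice_proj[OF small u]]]
  note P = is_funcD[OF pD(3)] and U = is_funcD[OF uD(3)] and L = is_funcD[OF lD(3)]
  note F = P U category_simps[OF Cat_category[OF K]]
    category_simps[OF Cat_category[OF uD(2)]]  category_simps[OF Cat_category[OF uD(1)]] slice_simps[OF uD(3)]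
  note UK = slice_simps[OF uKD(3)]
  have Sc: "S \<in> Cat sm" unfolding S_def by (rule slice_Cat[OF small uK])
  have ac: "cmp \<alpha> j \<in> Arr B" "Dom B (cmp \<alpha> j) = omap u (omap p j)" "Cod B (cmp \<alpha> j) = b" if "j \<in> Obj J" for j
    using aD(5-7)[OF that] that P by simp_all
  have anat: "cmp \<alpha> (Cod J t) \<cdot>\<^bsub>B\<^esub> amap u (amap p t) = cmp \<alpha> (Dom J t)" if "t \<in> Arr J" for t
    using aD(8)[OF that] that ac[of "Dom J t"] b by (simp add: F category_simps[OF P(1)])
  \<comment> \<open>The lifted inclusion; the K-coordinate of each object in its image is the
    terminal object \<open>Ident K k\<close> of K/k.\<close>
  define r where "r = mk_func J S (\<lambda>j. Pair (Pair (omap p j) k) (Pair (cmp \<alpha> j) (Ident K k)))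
     (\<lambda>t. Pair (Pair (amap p t) (Ident K k)) (Pair (cmp \<alpha> (Cod J t)) (Ident K k)))"
  \<comment> \<open>The lifted retraction forgets K: only the object of A and the leg in B are
    handed to \<open>l\<close>.\<close>
  define l' where "l' = mk_func S J (\<lambda>x. omap l (Pair (pfst (pfst x)) (pfst (psnd x)))) (\<lambda>x. amap l (Pair (pfst (pfst x)) (pfst (psnd x))))"
  have r: "is_func r J S"
    unfolding r_def
  proof (rule is_func_mk)
    show "category J" "category S" using P(1) Sc Cat_category by auto
    show "Pair (Pair (omap p j) k) (Pair (cmp \<alpha> j) (Ident K k)) \<in> Obj S" if "j \<in> Obj J" for j
      unfolding S_def using that by (simp add: UK ac F k)
    fix t assume t: "t \<in> Arr J"
    show "Pair (Pair (amap p t) (Ident K k)) (Pair (cmp \<alpha> (Cod J t)) (Ident K k)) \<in> Arr S \<and>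
         Dom S (Pair (Pair (amap p t) (Ident K k)) (Pair (cmp \<alpha> (Cod J t)) (Ident K k))) =
         Pair (Pair (omap p (Dom J t)) k) (Pair (cmp \<alpha> (Dom J t)) (Ident K k)) \<and>
         Cod S (Pair (Pair (amap p t) (Ident K k)) (Pair (cmp \<alpha> (Cod J t)) (Ident K k))) =
         Pair (Pair (omap p (Cod J t)) k) (Pair (cmp \<alpha> (Cod J t)) (Ident K k))"
      unfolding S_def using t by (simp add: UK ac F k anat category_simps[OF P(1)])
  next
    fix j assume "j \<in> Obj J"
    then show "Pair (Pair (amap p (Ident J j)) (Ident K k)) (Pair (cmp \<alpha> (Cod J (Ident J j))) (Ident K k)) =
         Ident S (Pair (Pair (omap p j) k) (Pair (cmp \<alpha> j) (Ident K k)))"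
      unfolding S_def by (simp add: UK ac F k category_simps[OF P(1)])
  next
    fix t t' assume "t \<in> Arr J" "t' \<in> Arr J" "Dom J t' = Cod J t"
    then show "Pair (Pair (amap p (t' \<cdot>\<^bsub>J\<^esub> t)) (Ident K k)) (Pair (cmp \<alpha> (Cod J (t' \<cdot>\<^bsub>J\<^esub> t))) (Ident K k)) =
         Pair (Pair (amap p t') (Ident K k)) (Pair (cmp \<alpha> (Cod J t')) (Ident K k)) \<cdot>\<^bsub>S\<^esub>
         Pair (Pair (amap p t) (Ident K k)) (Pair (cmp \<alpha> (Cod J t)) (Ident K k))"
      unfolding S_def using anat[of t'] by (simp add: UK ac F k category_simps[OF P(1)])
  qed
  have Sx: "\<exists>a k' f g. x = Pair (Pair a k') (Pair f g) \<and> Pair a f \<in> Obj (slice u b) \<and> a \<in> Obj A \<and> f \<in> Arr B \<and> Dom B f = omap u a \<and> Cod B f = b \<and>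
     k' \<in> Obj K \<and> g \<in> Arr K \<and> Dom K g = k' \<and> Cod K g = k" if "x \<in> Obj S" for x
    using that unfolding S_def
    by (auto simp add: F elim!: Obj_sliceE[OF _ uKD(3)] Obj_prod_catE Arr_prod_catE)
  \<comment> \<open>The leg of an arrow of S splits into a leg in B and a leg in K, so the endpoints
    can be written out coordinatewise. The first coordinates form an arrow of the unparametrised
    slice.\<close>
  have Sm: "\<exists>t s f g. m = Pair (Pair t s) (Pair f g) \<and> t \<in> Arr A \<and> s \<in> Arr K \<and> f \<in> Arr B \<and> g \<in> Arr K \<and>
      Dom B f = omap u (Cod A t) \<and> Cod B f = b \<and> Dom K g = Cod K s \<and> Cod K g = k \<and> Pair t f \<in> Arr (slice u b) \<and>
      Dom S m = Pair (Pair (Dom A t) (Dom K s)) (Pair (f \<cdot>\<^bsub>B\<^esub> amap u t) (g \<cdot>\<^bsub>K\<^esub> s)) \<and>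
      Cod S m = Pair (Pair (Cod A t) (Cod K s)) (Pair f g)" if m: "m \<in> Arr S" for m
  proof -
    obtain t s f g where me: "m = Pair (Pair t s) (Pair f g)" "t \<in> Arr A" "s \<in> Arr K" "f \<in> Arr B" "g \<in> Arr K"
      "Dom B f = omap u (Cod A t)" "Cod B f = b" "Dom K g = Cod K s" "Cod K g = k"
      using m unfolding S_def by (auto simp add: F elim!: Arr_sliceE[OF _ uKD(3)] Arr_prod_catE)
    have "Dom S m = Pair (Pair (Dom A t) (Dom K s)) (Pair (f \<cdot>\<^bsub>B\<^esub> amap u t) (g \<cdot>\<^bsub>K\<^esub> s))"
      and "Cod S m = Pair (Pair (Cod A t) (Cod K s)) (Pair f g)"
      using m me(2-) unfolding S_def me(1) by (simp_all add: UK F)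
    moreover have "Pair t f \<in> Arr (slice u b)" using me by (simp add: F)
    ultimately show ?thesis using me by blast
  qed
  have l': "is_func l' S J"
    unfolding l'_def
  proof (rule is_func_mk[OF Cat_category[OF Sc] P(1)])
    fix x assume "x \<in> Obj S"
    then show "omap l (Pair (pfst (pfst x)) (pfst (psnd x))) \<in> Obj J" using Sx[of x] L(5) by auto
  next
    fix m assume "m \<in> Arr S"
    from Sm[OF this] obtain t s f g where m: "m = Pair (Pair t s) (Pair f g)" "Pair t f \<in> Arr (slice u b)"
      "Dom S m = Pair (Pair (Dom A t) (Dom K s)) (Pair (f \<cdot>\<^bsub>B\<^esub> amap u t) (g \<cdot>\<^bsub>K\<^esub> s))"
      "Cod S m = Pair (Pair (Cod A t) (Cod K s)) (Pair f g)" by blast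
    show "amap l (Pair (pfst (pfst m)) (pfst (psnd m))) \<in> Arr J \<and>
        Dom J (amap l (Pair (pfst (pfst m)) (pfst (psnd m)))) = omap l (Pair (pfst (pfst (Dom S m))) (pfst (psnd (Dom S m)))) \<and>
        Cod J (amap l (Pair (pfst (pfst m)) (pfst (psnd m)))) = omap l (Pair (pfst (pfst (Cod S m))) (pfst (psnd (Cod S m))))"
      unfolding m(3,4) using L(6-8)[OF m(2)] slice_simps(3,4)[OF uD(3) m(2)] by (simp add: m(1))
  next
    fix x assume x: "x \<in> Obj S"
    from Sx[OF this] obtain a k' f g where xe: "x = Pair (Pair a k') (Pair f g)" "Pair a f \<in> Obj (slice u b)" "a \<in> Obj A"
      "k' \<in> Obj K" by blast
    have "Ident S x = Pair (Pair (Ident A a) (Ident K k')) (Pair f g)"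
      using x xe(3,4) unfolding S_def xe(1) by (simp add: UK)
    then show "amap l (Pair (pfst (pfst (Ident S x))) (pfst (psnd (Ident S x)))) = Ident J (omap l (Pair (pfst (pfst x)) (pfst (psnd x))))"
      using L(9)[OF xe(2)] slice_simps(5)[OF uD(3) xe(2)] by (simp add: xe(1))
  next
    fix m m' assume mm: "m \<in> Arr S" "m' \<in> Arr S" "Dom S m' = Cod S m"
    from Sm[OF mm(1)] obtain t s f g where m: "m = Pair (Pair t s) (Pair f g)" "Pair t f \<in> Arr (slice u b)" "t \<in> Arr A" "s \<in> Arr K"
      "Cod S m = Pair (Pair (Cod A t) (Cod K s)) (Pair f g)" by blast
    from Sm[OF mm(2)] obtain t' s' f' g' where m': "m' = Pair (Pair t' s') (Pair f' g')" "Pair t' f' \<in> Arr (slice u b)" "t' \<in> Arr A" "s' \<in> Arr K"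
      "Dom S m' = Pair (Pair (Dom A t') (Dom K s')) (Pair (f' \<cdot>\<^bsub>B\<^esub> amap u t') (g' \<cdot>\<^bsub>K\<^esub> s'))" by blast
    have q: "Dom A t' = Cod A t" "Dom K s' = Cod K s" "f = f' \<cdot>\<^bsub>B\<^esub> amap u t'" "g = g' \<cdot>\<^bsub>K\<^esub> s'" using mm(3) m(5) m'(5) by simp_all
    have "m' \<cdot>\<^bsub>S\<^esub> m = Pair (Pair t' s' \<cdot>\<^bsub>A \<otimes> K\<^esub> Pair t s) (Pair f' g')"
      using mm q m(3,4) m'(2-4) unfolding S_def m(1) m'(1) by (subst slice_simps(6)[OF uKD(3)]) (auto simp add: UK F)
    then have "m' \<cdot>\<^bsub>S\<^esub> m = Pair (Pair (t' \<cdot>\<^bsub>A\<^esub> t) (s' \<cdot>\<^bsub>K\<^esub> s)) (Pair f' g')" using m(3,4) m'(3,4) q by simp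
    moreover have "amap l (Pair (t' \<cdot>\<^bsub>A\<^esub> t) f') = amap l (Pair t' f') \<cdot>\<^bsub>J\<^esub> amap l (Pair t f)"
      using L(10)[OF m(2) m'(2)] slice_simps(3)[OF uD(3) m'(2)] slice_simps(4)[OF uD(3) m(2)] slice_simps(6)[OF uD(3) m(2) m'(2)] q by simp
    ultimately show "amap l (Pair (pfst (pfst (m' \<cdot>\<^bsub>S\<^esub> m))) (pfst (psnd (m' \<cdot>\<^bsub>S\<^esub> m)))) =
       amap l (Pair (pfst (pfst m')) (pfst (psnd m'))) \<cdot>\<^bsub>J\<^esub> amap l (Pair (pfst (pfst m)) (pfst (psnd m)))"
      by (simp add: m(1) m'(1))
  qed
  have rs: "sfunc sm r J S" and ls: "sfunc sm l' S J" using r l' Sc pD(1) by (simp_all add: sfunc_def)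
  have lr: "l' \<odot> r = id_func J"
    by (rule func_eqI[OF is_func_comp_func[OF r l'] is_func_id[OF P(1)]])
      (use is_funcD(5,6)[OF r] in \<open>auto simp add: r_def l'_def lo la\<close>)
  have hc: "cmp h x \<in> Arr A" "Dom A (cmp h x) = pfst x" "Cod A (cmp h x) = omap p (omap l x)" if "x \<in> Obj (slice u b)" for x
    using hD(5-7)[OF that] that L by simp_all
  \<comment> \<open>In the A-coordinate this is \<open>h\<close>. In the K-coordinate it is the
    structure map of the object itself, stored at \<open>psnd (psnd x)\<close>, viewed as the unique
    map to the terminal object of K/k.\<close>
  define \<eta> where "\<eta> = mk_ntr (id_func S) (r \<odot> l') (\<lambda>x. let y = Pair (pfst (pfst x)) (pfst (psnd x)) in
      Pair (Pair (cmp h y) (psnd (psnd x))) (Pair (cmp \<alpha> (omap l y)) (Ident K k)))"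
  have n: "is_ntr \<eta> (id_func S) (r \<odot> l')"
    unfolding \<eta>_def
  proof (rule is_ntr_mk[OF is_func_id[OF Cat_category[OF Sc]] is_func_comp_func[OF l' r]])
    fix x assume x: "x \<in> Obj S"
    obtain a k' f g where xe: "x = Pair (Pair a k') (Pair f g)" "Pair a f \<in> Obj (slice u b)" "a \<in> Obj A" "f \<in> Arr B"
      "Dom B f = omap u a" "Cod B f = b" "k' \<in> Obj K" "g \<in> Arr K" "Dom K g = k'" "Cod K g = k" using Sx[OF x] by blast
    show "(let y = Pair (pfst (pfst x)) (pfst (psnd x)) in
            Pair (Pair (cmp h y) (psnd (psnd x))) (Pair (cmp \<alpha> (omap l y)) (Ident K k)))
         \<in> hom S (omap (id_func S) x) (omap (r \<odot> l') x)"
      using x is_funcD(5)[OF l' x] xe(2-) hc[OF xe(2)] fac[OF xe(2)] L(5)[OF xe(2)] is_funcD(3)[OF l']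
      by (simp add: l'_def r_def) (simp add: S_def xe(1) hom_iff UK F ac k Let_def)
  next
    fix m assume m: "m \<in> Arr S"
    obtain t s f g where me: "m = Pair (Pair t s) (Pair f g)" "t \<in> Arr A" "s \<in> Arr K" "f \<in> Arr B" "g \<in> Arr K"
      "Dom B f = omap u (Cod A t)" "Cod B f = b" "Dom K g = Cod K s" "Cod K g = k"
      and tf: "Pair t f \<in> Arr (slice u b)"
      and dm: "Dom S m = Pair (Pair (Dom A t) (Dom K s)) (Pair (f \<cdot>\<^bsub>B\<^esub> amap u t) (g \<cdot>\<^bsub>K\<^esub> s))"
      and cm: "Cod S m = Pair (Pair (Cod A t) (Cod K s)) (Pair f g)"
      using Sm[OF m] by blast
    have tfd: "Dom (slice u b) (Pair t f) = Pair (Dom A t) (f \<cdot>\<^bsub>B\<^esub> amap u t)" "Cod (slice u b) (Pair t f) = Pair (Cod A t) f"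
      using tf by (simp_all add: F)
    have d: "Pair (Dom A t) (f \<cdot>\<^bsub>B\<^esub> amap u t) \<in> Obj (slice u b)" and c: "Pair (Cod A t) f \<in> Obj (slice u b)"
      using me by (simp_all add: F)
    have ltf: "amap l (Pair t f) \<in> Arr J" "Dom J (amap l (Pair t f)) = omap l (Pair (Dom A t) (f \<cdot>\<^bsub>B\<^esub> amap u t))"
      "Cod J (amap l (Pair t f)) = omap l (Pair (Cod A t) f)"
      using L(6-8)[OF tf] tfd by simp_all
    have hn: "cmp h (Pair (Cod A t) f) \<cdot>\<^bsub>A\<^esub> t = amap p (amap l (Pair t f)) \<cdot>\<^bsub>A\<^esub> cmp h (Pair (Dom A t) (f \<cdot>\<^bsub>B\<^esub> amap u t))"
      using hD(8)[OF tf] tf tfd L(3) by simp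
    have rl: "amap (r \<odot> l') m = Pair (Pair (amap p (amap l (Pair t f))) (Ident K k)) (Pair (cmp \<alpha> (omap l (Pair (Cod A t) f))) (Ident K k))"
      using m is_funcD(6)[OF l' m] ltf is_funcD(3)[OF l'] by (simp add: l'_def r_def me(1))
    show "(let y = Pair (pfst (pfst (Cod S m))) (pfst (psnd (Cod S m))) in
            Pair (Pair (cmp h y) (psnd (psnd (Cod S m)))) (Pair (cmp \<alpha> (omap l y)) (Ident K k))) \<cdot>\<^bsub>S\<^esub> amap (id_func S) m =
         amap (r \<odot> l') m \<cdot>\<^bsub>S\<^esub> (let y = Pair (pfst (pfst (Dom S m))) (pfst (psnd (Dom S m))) in
            Pair (Pair (cmp h y) (psnd (psnd (Dom S m)))) (Pair (cmp \<alpha> (omap l y)) (Ident K k)))"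
      unfolding rl dm cm using m me(2-) hc[OF c] hc[OF d] fac[OF c] fac[OF d] L(5)[OF c] L(5)[OF d] ltf anat[OF ltf(1)]
      by (simp add: me(1)) (simp add: S_def UK F ac k hn Let_def)
  qed
  have ns: "sntr sm \<eta> (id_func S) (r \<odot> l')" by (rule sntrI[OF sfunc_id[OF Sc] n])
  have e0: "id_func S \<odot> r = r" by (rule comp_func_id(2)[OF r])
  have e1: "r \<odot> l' \<odot> r = r" using comp_func_assoc[OF r l' r] lr comp_func_id(1)[OF r] by simp
  have nr0: "is_ntr (\<eta> \<star> id_ntr r) r r"
    using is_ntr_hcomp[OF r is_func_id[OF Cat_category[OF Sc]] is_ntr_id[OF r] n] by (simp add: e0 e1)
  have nr: "\<eta> \<star> id_ntr r = id_ntr r"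
  proof (rule ntr_eqI[OF nr0 is_ntr_id[OF r]])
    fix j assume "j \<in> Obj (Src r)"
    then have j: "j \<in> Obj J" by (simp add: is_funcD(3)[OF r])
    note rj = is_funcD(5)[OF r j]
    have ij: "Ident S (omap r j) \<in> Arr S" using rj category_simps[OF Cat_category[OF Sc]] by simp
    have "cmp (\<eta> \<star> id_ntr r) j = cmp \<eta> (omap r j) \<cdot>\<^bsub>S\<^esub> Ident S (omap r j)"
      using j ij by (simp add: is_funcD(3,4)[OF r] is_ntrD(2)[OF n is_func_id[OF Cat_category[OF Sc]]])
    also have "\<dots> = cmp \<eta> (omap r j)"
      using is_ntrD(5,6)[OF n is_func_id[OF Cat_category[OF Sc]] rj] rj
      by (simp add: category_simps[OF Cat_category[OF Sc]])
    \<comment> \<open>The assumptions on \<open>l\<close> and \<open>h\<close> over the image of J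
      enter here and make the A-coordinate an identity; the K-coordinate is the identity of k by the
      choice of \<open>r\<close>.\<close>
    also have "\<dots> = Ident S (omap r j)"
      using rj j by (simp add: \<eta>_def r_def lo ho) (simp add: S_def UK F k ac Let_def lo ho)
    finally show "cmp (\<eta> \<star> id_ntr r) j = cmp (id_ntr r) j" using j by (simp add: is_funcD(3,4)[OF r])
  qed
  note pr = sfunc_slice_proj[OF small uK, of "Pair b k"]
  note sn = sntr_slice[OF small uK bk]
  note su = slice_universal[OF uK bk X]
  have U1: "universal J (res r (res (slice_proj (u \<otimes>\<^sub>f id_func K) (Pair b k)) X)) (res (pt (B \<otimes> K) (Pair b k)) (lo (u \<otimes>\<^sub>f id_func K) X))
      (resa r (cotranspose S (slice_proj (u \<otimes>\<^sub>f id_func K) (Pair b k)) (u \<otimes>\<^sub>f id_func K) (slice_ntr (u \<otimes>\<^sub>f id_func K) (Pair b k)) X))"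
    using universal_restrict[OF rs ls lr ns nr] su res_obj[OF pr X] unfolding S_def by blast
  \<comment> \<open>Composing \<open>r\<close> with the projection of the slice, and with its
    canonical transformation below, returns the given cone at k. This identifies the restricted
    universal map with the cotranspose wanted.\<close>
  have prr: "slice_proj (u \<otimes>\<^sub>f id_func K) (Pair b k) \<odot> r = at_point K k p"
    by (rule func_eqI[OF is_func_comp_func[OF r sfuncD(3)[OF pr, folded S_def]] sfuncD(3)[OF sfunc_at_point[OF small p K k]]])
      (use is_funcD(5,6)[OF r] in \<open>auto simp add: is_funcD(3)[OF r] S_def[symmetric] pD r_def\<close>)
  note sq = square_at_point[OF c u b K k]
  note cn = sntrD(1)[OF squareD(5,6)[OF sq]]
  let ?s = "slice_ntr (u \<otimes>\<^sub>f id_func K) (Pair b k)" and ?pr = "slice_proj (u \<otimes>\<^sub>f id_func K) (Pair b k)"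
  note upr = sfunc_comp[OF pr uK]
  have tr: "to_one S \<odot> r = to_one J" using func_to_one[OF small sfunc_comp[OF rs sfunc_to_one[OF small Sc]]] .
  have c1: "(u \<otimes>\<^sub>f id_func K) \<odot> ?pr \<odot> r = (u \<otimes>\<^sub>f id_func K) \<odot> at_point K k p"
    using comp_func_assoc[OF r sfuncD(3)[OF pr, folded S_def] uKD(3)] prr by simp
  have c2: "pt (B \<otimes> K) (Pair b k) \<odot> to_one S \<odot> r = pt (B \<otimes> K) (Pair b k) \<odot> to_one J"
    using comp_func_assoc[OF r sfuncD(3)[OF sfunc_to_one[OF small Sc]] sfuncD(3)[OF sfunc_pt[OF small prod_cat_Cat[OF small uD(2) K] bk]]] tr by simp
  have w: "sntr sm (?s \<star> id_ntr r) ((u \<otimes>\<^sub>f id_func K) \<odot> at_point K k p) (pt (B \<otimes> K) (Pair b k) \<odot> to_one J)"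
    using sntr_hcomp[OF rs upr[folded S_def] sntr_id[OF rs] sn[folded S_def]] by (simp add: c1 c2)
  have sc: "?s \<star> id_ntr r = cone_at_point K k p u b \<alpha>"
  proof (rule ntr_eqI[OF sntrD(1)[OF w squareD(6)[OF sq]] cn])
    fix j assume "j \<in> Obj (Src ((u \<otimes>\<^sub>f id_func K) \<odot> at_point K k p))"
    then have j: "j \<in> Obj J" by (simp add: pD)
    note rj = is_funcD(5)[OF r j]
    have rj': "omap r j = Pair (Pair (omap p j) k) (Pair (cmp \<alpha> j) (Ident K k))" using j by (simp add: r_def)
    have ri: "Ident S (omap r j) \<in> Arr S" using rj category_simps[OF Cat_category[OF Sc]] by simp
    have ri': "Ident S (omap r j) = Pair (Pair (Ident A (omap p j)) (Ident K k)) (Pair (cmp \<alpha> j) (Ident K k))"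
      using rj j by (simp add: rj' S_def UK F k)
    show "cmp (?s \<star> id_ntr r) j = cmp (cone_at_point K k p u b \<alpha>) j"
      using j rj ri by (simp add: is_funcD(3,4)[OF r] pD uD S_def[symmetric])
        (simp add: ri'[unfolded rj'] rj' F k ac)
  qed
  note eX = eta_hom[OF uK X] and LX = lo_obj[OF uK X]
  have "resa r (cotranspose S ?pr (u \<otimes>\<^sub>f id_func K) ?s X) = cotranspose J (at_point K k p) (u \<otimes>\<^sub>f id_func K) (cone_at_point K k p u b \<alpha>) X"
  proof -
    have th: "two ?s (lo (u \<otimes>\<^sub>f id_func K) X) \<in> hom (onc D S) (res ?pr (res (u \<otimes>\<^sub>f id_func K) (lo (u \<otimes>\<^sub>f id_func K) X)))
       (res (pt (B \<otimes> K) (Pair b k) \<odot> to_one S) (lo (u \<otimes>\<^sub>f id_func K) X))"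
      using two_hom[OF upr sn LX] res_comp[OF pr uK LX] by (simp add: S_def)
    show ?thesis
      unfolding cotranspose_def resa_comp[OF rs resa_hom[OF pr eX, folded S_def] th]
      using two_whisker_right[OF rs upr[folded S_def] sn[folded S_def] LX]
        resa_comp_func[OF rs pr[folded S_def] eX] by (simp add: sc prr)
  qed
  moreover have "res r (res ?pr X) = res (at_point K k p) X"
    using res_comp[OF rs pr[folded S_def] X] prr by simp
  ultimately show ?thesis using U1 mate_iso_iff_universal[OF sq X] by simp
qed

end

section \<open>Two sources of reflective cones\<close>

lemma reflective_cone_slice:
  assumes sm: "smallness sm" and u: "sfunc sm u A B" and b: "b \<in> Obj B"
  shows "reflective_cone sm (slice u b) (slice_proj u b) u b (slice_ntr u b)"
proof -
  note uD = sfuncD[OF u] and S = slice_Cat[OF sm u, of b] and pr = sfunc_slice_proj[OF sm u, of b]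
  note F = is_funcD[OF uD(3)] slice_simps[OF uD(3)] category_simps[OF Cat_category[OF uD(1)]] category_simps[OF Cat_category[OF uD(2)]]
  \<comment> \<open>Here J is the slice itself; the retraction is the identity functor and the unit
    is trivial.\<close>
  have "sntr sm (id_ntr (slice_proj u b)) (slice_proj u b) (slice_proj u b \<odot> id_func (slice u b))"
    using sntr_id[OF pr] by (simp add: comp_func_id[OF sfuncD(3)[OF pr]])
  then show ?thesis
    unfolding reflective_cone_def uD(4,5)
    by (intro conjI pr sntr_slice[OF sm u b] exI[of _ "id_func (slice u b)"] exI[of _ "id_ntr (slice_proj u b)"] sfunc_id[OF S])
      (auto elim!: Obj_sliceE[OF _ uD(3)] Arr_sliceE[OF _ uD(3)] simp add: F uD)
qed

text \<open>When each hom-set into b has at most one element, the leg of an object of the slice is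
  forced to be the component of \<alpha>. The projection from the slice to A is then inverse to the
  functor induced by \<alpha>, and serves as the retraction with trivial unit.\<close>

lemma reflective_cone_subterminal:
  assumes sm: "smallness sm" and u: "sfunc sm u A B" and b: "b \<in> Obj B"
    and a: "sntr sm \<alpha> (u \<odot> id_func A) (pt B b \<odot> to_one A)"
    and sub: "\<And>a f g. a \<in> Obj A \<Longrightarrow> f \<in> hom B (omap u a) b \<Longrightarrow> g \<in> hom B (omap u a) b \<Longrightarrow> f = g"
  shows "reflective_cone sm A (id_func A) u b \<alpha>"
proof -
  note uD = sfuncD[OF u] and S = slice_Cat[OF sm u, of b] and pr = sfunc_slice_proj[OF sm u, of b]
  note F = is_funcD[OF uD(3)] slice_simps[OF uD(3)] category_simps[OF Cat_category[OF uD(1)]] category_simps[OF Cat_category[OF uD(2)]]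
  have h: "sntr sm (id_ntr (slice_proj u b)) (slice_proj u b) (id_func A \<odot> slice_proj u b)"
    using sntr_id[OF pr] by (simp add: comp_func_id[OF sfuncD(3)[OF pr]])
  have u1: "u \<odot> id_func A = u" by (rule comp_func_id[OF uD(3)])
  note aD = is_ntrD[OF sntrD(1)[OF a[unfolded u1] u] uD(3)]
  have ac: "cmp \<alpha> j \<in> Arr B" "Dom B (cmp \<alpha> j) = omap u j" "Cod B (cmp \<alpha> j) = b" if "j \<in> Obj A" for j
    using aD(5-7)[OF that] that by simp_all
  have fac: "cmp \<alpha> j = f" if "j \<in> Obj A" "f \<in> Arr B" "Dom B f = omap u j" "Cod B f = b" for j f
    using sub[of j "cmp \<alpha> j" f] that ac[of j] by (simp add: hom_iff)
  show ?thesis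
    unfolding reflective_cone_def uD(4,5)
    by (intro conjI sfunc_id[OF uD(1)] a exI[of _ "slice_proj u b"] exI[of _ "id_ntr (slice_proj u b)"] pr h)
      (auto elim!: Obj_sliceE[OF _ uD(3)] Arr_sliceE[OF _ uD(3)] simp add: F uD ac fac)
qed

section \<open>Mates of squares with parameters\<close>

context derivator_context
begin

text \<open>The parameters change along v only on the two horizontal sides; the vertical sides are
  multiplied with the identities of K and K'. The identity square thus gives the structure cell of
  \<open>push\<close> at v, and v = id gives the mate at K of the square itself.\<close>

abbreviation pmate :: "'k sfunc \<Rightarrow> 'k sfunc \<Rightarrow> 'k sfunc \<Rightarrow> 'k sfunc \<Rightarrow> 'k sntr \<Rightarrow> 'k sfunc \<Rightarrow> 'o \<Rightarrow> 'm" where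
  "pmate p u q b \<alpha> v X \<equiv>
     lan_mate D (p \<otimes>\<^sub>f v) (u \<otimes>\<^sub>f id_func (Tgt v)) (q \<otimes>\<^sub>f id_func (Src v)) (b \<otimes>\<^sub>f v) (\<alpha> \<otimes>\<^sub>n id_ntr v) X"

lemma square_prod:
  assumes s: "square A' A B' B p u q b \<alpha>" and v: "sfunc sm v K' K"
  shows "square (A' \<otimes> K') (A \<otimes> K) (B' \<otimes> K') (B \<otimes> K) (p \<otimes>\<^sub>f v) (u \<otimes>\<^sub>f id_func (Tgt v)) (q \<otimes>\<^sub>f id_func (Src v))
     (b \<otimes>\<^sub>f v) (\<alpha> \<otimes>\<^sub>n id_ntr v)"
proof -
  note sD = squareD[OF s] and vD = sfuncD[OF v]
  note i = sfunc_id[OF vD(1)] and j = sfunc_id[OF vD(2)]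
  have "(u \<odot> p) \<otimes>\<^sub>f v = (u \<otimes>\<^sub>f id_func K) \<odot> (p \<otimes>\<^sub>f v)" "(b \<odot> q) \<otimes>\<^sub>f v = (b \<otimes>\<^sub>f v) \<odot> (q \<otimes>\<^sub>f id_func K')"
    using prod_func_comp[OF sfuncD(3)[OF sD(1)] vD(3) sfuncD(3)[OF sD(2)] sfuncD(3)[OF j]]
      prod_func_comp[OF sfuncD(3)[OF sD(3)] sfuncD(3)[OF i] sfuncD(3)[OF sD(4)] vD(3)] comp_func_id[OF vD(3)] by simp_all
  then show ?thesis
    unfolding square_def vD(4,5)
    using sfunc_prod[OF small sD(1) v] sfunc_prod[OF small sD(2) j] sfunc_prod[OF small sD(3) i] sfunc_prod[OF small sD(4) v]
      sntr_prod[OF small sD(6) v sD(5) sntr_id[OF v]] by simp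
qed

lemma square_id: "sfunc sm u A B \<Longrightarrow> square A A B B (id_func A) u u (id_func B) (id_ntr u)"
  unfolding square_def using sntr_id[of sm u A B] comp_func_id[OF sfuncD(3)[of sm u A B]] sfuncD(1,2)[of sm u A B]
  by (simp add: sfunc_id)

lemma pmate_hom:
  assumes s: "square A' A B' B p u q b \<alpha>" and v: "sfunc sm v K' K" and X: "X \<in> Obj (onc D (A \<otimes> K))"
  shows "pmate p u q b \<alpha> v X \<in> hom (onc D (B' \<otimes> K')) (lo (q \<otimes>\<^sub>f id_func K') (res (p \<otimes>\<^sub>f v) X))
     (res (b \<otimes>\<^sub>f v) (lo (u \<otimes>\<^sub>f id_func K) X))"
  using mate_hom[OF square_prod[OF s v] X] sfuncD(4,5)[OF v] by simp

text \<open>Products are compatible with both compositions of transformations, so pasting two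
  squares times their parameter changes gives the pasted square times the composite parameter
  change. Pasting a square with v to one with an identity, or the reverse, separates the two
  directions.\<close>

lemma pmate_paste:
  assumes s: "square A' A B' B p u q b \<alpha>" and s': "square A'' A' B'' B' p' q r b' \<alpha>'"
    and v: "sfunc sm v K' K" and v': "sfunc sm v' K'' K'" and X: "X \<in> Obj (onc D (A \<otimes> K))"
  shows "pmate (p \<odot> p') u r (b \<odot> b') ((id_ntr b \<star> \<alpha>') \<bullet> (\<alpha> \<star> id_ntr p')) (v \<odot> v') X =
      resa (b' \<otimes>\<^sub>f v') (pmate p u q b \<alpha> v X) \<cdot>\<^bsub>onc D (B'' \<otimes> K'')\<^esub> pmate p' q r b' \<alpha>' v' (res (p \<otimes>\<^sub>f v) X)"
proof -
  note sD = squareD[OF s] and tD = squareD[OF s'] and vD = sfuncD[OF v] and wD = sfuncD[OF v']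
  note n = sfuncD(3)
  note S = square_prod[OF s v, unfolded vD(4,5)] and T = square_prod[OF s' v', unfolded wD(4,5)]
  have f: "(p \<otimes>\<^sub>f v) \<odot> (p' \<otimes>\<^sub>f v') = (p \<odot> p') \<otimes>\<^sub>f (v \<odot> v')" "(b \<otimes>\<^sub>f v) \<odot> (b' \<otimes>\<^sub>f v') = (b \<odot> b') \<otimes>\<^sub>f (v \<odot> v')"
    by (rule prod_func_comp[OF n[OF tD(1)] wD(3) n[OF sD(1)] vD(3)], rule prod_func_comp[OF n[OF tD(4)] wD(3) n[OF sD(4)] vD(3)])
  note vv = sfunc_comp[OF v' v] note ib = id_ntr_hcomp[OF wD(3) vD(3)]
  have g1: "(\<alpha> \<otimes>\<^sub>n id_ntr v) \<star> id_ntr (p' \<otimes>\<^sub>f v') = (\<alpha> \<star> id_ntr p') \<otimes>\<^sub>n id_ntr (v \<odot> v')"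
    unfolding prod_ntr_id[OF n[OF tD(1)] wD(3), symmetric] ib[symmetric]
    by (rule prod_ntr_hcomp[OF n[OF tD(1)] wD(3) is_ntr_id[OF n[OF tD(1)]] is_ntr_id[OF wD(3)] n[OF sD(6)] vD(3)
          sntrD(1)[OF sD(5,6)] is_ntr_id[OF vD(3)]])
  have g2: "id_ntr (b \<otimes>\<^sub>f v) \<star> (\<alpha>' \<otimes>\<^sub>n id_ntr v') = (id_ntr b \<star> \<alpha>') \<otimes>\<^sub>n id_ntr (v \<odot> v')"
    unfolding prod_ntr_id[OF n[OF sD(4)] vD(3), symmetric] ib[symmetric]
    by (rule prod_ntr_hcomp[OF n[OF tD(6)] wD(3) sntrD(1)[OF tD(5,6)] is_ntr_id[OF wD(3)] n[OF sD(4)] vD(3)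
          is_ntr_id[OF n[OF sD(4)]] is_ntr_id[OF vD(3)]])
  have h1: "is_ntr (\<alpha> \<star> id_ntr p') (u \<odot> p \<odot> p') (b \<odot> q \<odot> p')"
    by (rule is_ntr_hcomp[OF n[OF tD(1)] n[OF sD(6)] is_ntr_id[OF n[OF tD(1)]] sntrD(1)[OF sD(5,6)]])
  have h2: "is_ntr (id_ntr b \<star> \<alpha>') (b \<odot> q \<odot> p') (b \<odot> (b' \<odot> r))"
    using is_ntr_hcomp[OF n[OF tD(6)] n[OF sD(4)] sntrD(1)[OF tD(5,6)] is_ntr_id[OF n[OF sD(4)]]]
      comp_func_assoc[OF n[OF tD(1)] n[OF sD(3)] n[OF sD(4)]] by simp
  have g: "(id_ntr (b \<otimes>\<^sub>f v) \<star> (\<alpha>' \<otimes>\<^sub>n id_ntr v')) \<bullet> ((\<alpha> \<otimes>\<^sub>n id_ntr v) \<star> id_ntr (p' \<otimes>\<^sub>f v'))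
     = ((id_ntr b \<star> \<alpha>') \<bullet> (\<alpha> \<star> id_ntr p')) \<otimes>\<^sub>n id_ntr (v \<odot> v')"
    unfolding g1 g2
    using prod_ntr_vcomp[OF n[OF sfunc_comp[OF tD(1) sD(6)]] n[OF vv] h1 is_ntr_id[OF n[OF vv]] h2 is_ntr_id[OF n[OF vv]]]
      vcomp_id(1)[OF n[OF vv] is_ntr_id[OF n[OF vv]]] by simp
  show ?thesis
    using mate_paste(1)[OF S T X] unfolding f g by (simp add: vD wD)
qed

lemma pmate_change_base:
  assumes s: "square A' A B' B p u q b \<alpha>" and g: "sntr sm \<gamma> b b'" and v: "sfunc sm v K' K" and X: "X \<in> Obj (onc D (A \<otimes> K))"
  shows "two (\<gamma> \<otimes>\<^sub>n id_ntr v) (lo (u \<otimes>\<^sub>f id_func K) X) \<cdot>\<^bsub>onc D (B' \<otimes> K')\<^esub> pmate p u q b \<alpha> v X =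
    pmate p u q b' ((\<gamma> \<star> id_ntr q) \<bullet> \<alpha>) v X"
proof -
  note sD = squareD[OF s] and vD = sfuncD[OF v]
  note n = sfuncD(3)
  note i = sfunc_id[OF vD(1)]
  have e: "(\<gamma> \<otimes>\<^sub>n id_ntr v) \<star> id_ntr (q \<otimes>\<^sub>f id_func K') = (\<gamma> \<star> id_ntr q) \<otimes>\<^sub>n id_ntr v"
    unfolding prod_ntr_id[OF n[OF sD(3)] n[OF i], symmetric]
    using prod_ntr_hcomp[OF n[OF sD(3)] n[OF i] is_ntr_id[OF n[OF sD(3)]] is_ntr_id[OF n[OF i]] n[OF sD(4)] vD(3)
      sntrD(1)[OF g sD(4)] is_ntr_id[OF vD(3)]] hcomp_id_func(1)[OF vD(3) is_ntr_id[OF vD(3)]] by simp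
  have e': "((\<gamma> \<otimes>\<^sub>n id_ntr v) \<star> id_ntr (q \<otimes>\<^sub>f id_func K')) \<bullet> (\<alpha> \<otimes>\<^sub>n id_ntr v) = ((\<gamma> \<star> id_ntr q) \<bullet> \<alpha>) \<otimes>\<^sub>n id_ntr v"
    unfolding e using prod_ntr_vcomp[OF n[OF sD(6)] vD(3) sntrD(1)[OF sD(5,6)] is_ntr_id[OF vD(3)]
      is_ntr_hcomp[OF n[OF sD(3)] n[OF sD(4)] is_ntr_id[OF n[OF sD(3)]] sntrD(1)[OF g sD(4)]] is_ntr_id[OF vD(3)]]
      vcomp_id(1)[OF vD(3) is_ntr_id[OF vD(3)]] by simp
  show ?thesis
    using mate_change_base[OF square_prod[OF s v] sntr_prod[OF small sD(4) v g sntr_id[OF v]] X] e' vD by simp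
qed

lemma pmate_change_top:
  assumes s: "square A' A B' B p' u q b \<alpha>" and p: "sfunc sm p A' A" and g: "sntr sm \<gamma> p p'"
    and v: "sfunc sm v K' K" and X: "X \<in> Obj (onc D (A \<otimes> K))"
  shows "pmate p' u q b \<alpha> v X \<cdot>\<^bsub>onc D (B' \<otimes> K')\<^esub> la (q \<otimes>\<^sub>f id_func K') (two (\<gamma> \<otimes>\<^sub>n id_ntr v) X) =
    pmate p u q b (\<alpha> \<bullet> (id_ntr u \<star> \<gamma>)) v X"
proof -
  note sD = squareD[OF s] and vD = sfuncD[OF v]
  note n = sfuncD(3)
  note i = sfunc_id[OF vD(2)]
  have e: "id_ntr (u \<otimes>\<^sub>f id_func K) \<star> (\<gamma> \<otimes>\<^sub>n id_ntr v) = (id_ntr u \<star> \<gamma>) \<otimes>\<^sub>n id_ntr v"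
    unfolding prod_ntr_id[OF n[OF sD(2)] n[OF i], symmetric]
    using prod_ntr_hcomp[OF n[OF p] vD(3) sntrD(1)[OF g p] is_ntr_id[OF vD(3)] n[OF sD(2)] n[OF i]
      is_ntr_id[OF n[OF sD(2)]] is_ntr_id[OF n[OF i]]] hcomp_id_func(2)[OF vD(3) is_ntr_id[OF vD(3)]] by simp
  have e': "(\<alpha> \<otimes>\<^sub>n id_ntr v) \<bullet> (id_ntr (u \<otimes>\<^sub>f id_func K) \<star> (\<gamma> \<otimes>\<^sub>n id_ntr v)) = (\<alpha> \<bullet> (id_ntr u \<star> \<gamma>)) \<otimes>\<^sub>n id_ntr v"
    unfolding e using prod_ntr_vcomp[OF n[OF sfunc_comp[OF p sD(2)]] vD(3)
      is_ntr_hcomp[OF n[OF p] n[OF sD(2)] sntrD(1)[OF g p] is_ntr_id[OF n[OF sD(2)]]] is_ntr_id[OF vD(3)]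
      sntrD(1)[OF sD(5,6)] is_ntr_id[OF vD(3)]]
      vcomp_id(1)[OF vD(3) is_ntr_id[OF vD(3)]] by simp
  show ?thesis
    using mate_change_top[OF square_prod[OF s v] sfunc_prod[OF small p v] sntr_prod[OF small p v g sntr_id[OF v]] X] e' vD by simp
qed

text \<open>Both sides are the mate of the square with parameters varying along \<open>v\<close>.\<close>

lemma pmate_modification:
  assumes s: "square A' A B' B p u q b \<alpha>" and v: "sfunc sm v K' K" and X: "X \<in> Obj (onc D (A \<otimes> K))"
  shows "resa (b \<otimes>\<^sub>f id_func K') (pmate (id_func A) u u (id_func B) (id_ntr u) v X) \<cdot>\<^bsub>onc D (B' \<otimes> K')\<^esub>
      pmate p u q b \<alpha> (id_func K') (res (id_func A \<otimes>\<^sub>f v) X) =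
    resa (id_func B' \<otimes>\<^sub>f v) (pmate p u q b \<alpha> (id_func K) X) \<cdot>\<^bsub>onc D (B' \<otimes> K')\<^esub>
      pmate (id_func A') q q (id_func B') (id_ntr q) v (res (p \<otimes>\<^sub>f id_func K) X)"
proof -
  note sD = squareD[OF s] and vD = sfuncD[OF v]
  note n = sfuncD(3)
  note i = sfunc_id[OF vD(1)] and j = sfunc_id[OF vD(2)]
  have e1: "(id_ntr (id_func B) \<star> \<alpha>) \<bullet> (id_ntr u \<star> id_ntr p) = \<alpha>"
    using id_ntr_hcomp[OF n[OF sD(1)] n[OF sD(2)]] hcomp_id_func(2)[OF n[OF sD(6)] sntrD(1)[OF sD(5,6)]]
      vcomp_id(1)[OF n[OF sD(6)] sntrD(1)[OF sD(5,6)]] by simp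
  have e2: "(id_ntr b \<star> id_ntr q) \<bullet> (\<alpha> \<star> id_ntr (id_func A')) = \<alpha>"
    using id_ntr_hcomp[OF n[OF sD(3)] n[OF sD(4)]] hcomp_id_func(1)[OF n[OF sD(6)] sntrD(1)[OF sD(5,6)]]
      vcomp_id(2)[OF n[OF sD(6)] sntrD(1)[OF sD(5,6)]] by simp
  have "pmate p u q b \<alpha> v X = resa (b \<otimes>\<^sub>f id_func K') (pmate (id_func A) u u (id_func B) (id_ntr u) v X) \<cdot>\<^bsub>onc D (B' \<otimes> K')\<^esub>
      pmate p u q b \<alpha> (id_func K') (res (id_func A \<otimes>\<^sub>f v) X)"
    using pmate_paste[OF square_id[OF sD(2)] s v i X]
    by (simp add: e1 comp_func_id[OF vD(3)] comp_func_id[OF n[OF sD(1)]] comp_func_id[OF n[OF sD(4)]])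
  moreover have "pmate p u q b \<alpha> v X = resa (id_func B' \<otimes>\<^sub>f v) (pmate p u q b \<alpha> (id_func K) X) \<cdot>\<^bsub>onc D (B' \<otimes> K')\<^esub>
      pmate (id_func A') q q (id_func B') (id_ntr q) v (res (p \<otimes>\<^sub>f id_func K) X)"
    using pmate_paste[OF s square_id[OF sD(3)] j v X]
    by (simp add: e2 comp_func_id[OF vD(3)] comp_func_id[OF n[OF sD(1)]] comp_func_id[OF n[OF sD(4)]])
  ultimately show ?thesis by simp
qed

text \<open>By Der2 the mate is tested at the points (x, k) of B' x K'. A cone over x that is
  reflective for q, and whose pasting with the square is reflective for u, makes two of the three
  mates in the pasting identity invertible; the third is the mate evaluated at the point.\<close>

lemma pmate_exact:
  assumes s: "square A' A B' B p u q b \<alpha>" and v: "sfunc sm v K' K" and X: "X \<in> Obj (onc D (A \<otimes> K))"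
    and ref: "\<And>x. x \<in> Obj B' \<Longrightarrow> \<exists>J s \<beta>. reflective_cone sm J s q x \<beta> \<and>
      reflective_cone sm J (p \<odot> s) u (omap b x) ((id_ntr b \<star> \<beta>) \<bullet> (\<alpha> \<star> id_ntr s))"
  shows "iso (onc D (B' \<otimes> K')) (pmate p u q b \<alpha> v X)"
proof -
  note sD = squareD[OF s] and vD = sfuncD[OF v]
  note n = sfuncD(3)
  note P = square_prod[OF s v, unfolded vD(4,5)]
  note BK = prod_cat_Cat[OF small sfuncD(1)[OF sD(4)] vD(1)]
  note M = pmate_hom[OF s v X]
  have pt: "iso (onc D one) (resa (pt (B' \<otimes> K') y) (pmate p u q b \<alpha> v X))" if "y \<in> Obj (B' \<otimes> K')" for y
  proof -
    obtain x k where y: "y = Pair x k" "x \<in> Obj B'" "k \<in> Obj K'" using \<open>y \<in> Obj (B' \<otimes> K')\<close> by (auto elim: Obj_prod_catE)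
    obtain J t \<beta> where c1: "reflective_cone sm J t q x \<beta>"
      and c2: "reflective_cone sm J (p \<odot> t) u (omap b x) ((id_ntr b \<star> \<beta>) \<bullet> (\<alpha> \<star> id_ntr t))"
      using ref[OF y(2)] by blast
    note bx = is_funcD(5)[OF n[OF sD(4)] y(2)] and vk = is_funcD(5)[OF vD(3) y(3)]
    note T = square_at_point[OF c1 sD(3) y(2) vD(1) y(3)] and V = square_at_point[OF c2 sD(2) bx vD(2) vk]
    have t: "sfunc sm t J A'" and be: "sntr sm \<beta> (q \<odot> t) (pt B' x \<odot> to_one J)"
      using c1 sfuncD(4,5)[OF sD(3)] by (auto simp add: reflective_cone_def)
    note tD = sfuncD[OF t]
    have f1: "(p \<otimes>\<^sub>f v) \<odot> at_point K' k t = at_point K (omap v k) (p \<odot> t)"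
      by (rule func_eqI[OF n[OF sfunc_comp[OF squareD(1)[OF T] squareD(1)[OF P]]] n[OF squareD(1)[OF V]]])
        (use y(3) category_simps[OF is_funcD(1)[OF vD(3)]] in
        \<open>simp_all add: tD is_funcD[OF tD(3)] is_funcD[OF vD(3)] is_funcD[OF n[OF sD(1)]]\<close>)
    have f2: "(b \<otimes>\<^sub>f v) \<odot> pt (B' \<otimes> K') (Pair x k) = pt (B \<otimes> K) (Pair (omap b x) (omap v k))"
      by (rule func_eqI[OF n[OF sfunc_comp[OF squareD(4)[OF T] squareD(4)[OF P]]] n[OF squareD(4)[OF V]]])
        (use y bx vk category_simps[OF is_funcD(1)[OF vD(3)]] category_simps[OF is_funcD(1)[OF n[OF sD(4)]]] in
        \<open>simp_all add: is_funcD[OF vD(3)] is_funcD[OF n[OF sD(4)]]\<close>)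
    let ?c = "cone_at_point K' k t q x \<beta>"
    let ?g = "(id_ntr (b \<otimes>\<^sub>f v) \<star> ?c) \<bullet> ((\<alpha> \<otimes>\<^sub>n id_ntr v) \<star> id_ntr (at_point K' k t))"
    note MP = mate_paste[OF P T, unfolded f1 f2]
    note aD = is_ntrD[OF sntrD(1)[OF sD(5,6)] n[OF sD(6)]]
    note bD = is_ntrD[OF sntrD(1)[OF be sfunc_comp[OF t sD(3)]] n[OF sfunc_comp[OF t sD(3)]]]
    \<comment> \<open>In the parameter coordinate only identities are composed, because v preserves
      them. In the other coordinate the component is that of \<alpha> pasted with \<beta>.\<close>
    have f3: "?g = cone_at_point K (omap v k) (p \<odot> t) u (omap b x) ((id_ntr b \<star> \<beta>) \<bullet> (\<alpha> \<star> id_ntr t))"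
    proof (rule ntr_eqI[OF sntrD(1)[OF squareD(5,6)[OF MP(2)[OF X]]] sntrD(1)[OF squareD(5,6)[OF V]]])
      fix j assume "j \<in> Obj (Src ((u \<otimes>\<^sub>f id_func K) \<odot> at_point K (omap v k) (p \<odot> t)))"
      then have j: "j \<in> Obj J" by (simp add: tD)
      note F = tD is_funcD[OF tD(3)] is_funcD[OF vD(3)] is_funcD[OF n[OF sD(1)]] is_funcD[OF n[OF sD(2)]] is_funcD[OF n[OF sD(3)]]
        is_funcD[OF n[OF sD(4)]] category_simps[OF is_funcD(1)[OF vD(3)]] category_simps[OF is_funcD(2)[OF vD(3)]]
        category_simps[OF is_funcD(1)[OF n[OF sD(4)]]] category_simps[OF is_funcD(2)[OF n[OF sD(4)]]]
        category_simps[OF is_funcD(2)[OF tD(3)]]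
      show "cmp ?g j = cmp (cone_at_point K (omap v k) (p \<odot> t) u (omap b x) ((id_ntr b \<star> \<beta>) \<bullet> (\<alpha> \<star> id_ntr t))) j"
        using j bD(5-7)[OF j] aD(5-7)[OF is_funcD(5)[OF tD(3) j]] y bx vk
        by (simp add: F aD(2,3) bD(2,3))
    qed
    note pX = res_obj[OF squareD(1)[OF P] X]
    let ?N = "lan_mate D (at_point K' k t) (q \<otimes>\<^sub>f id_func K') (to_one J) (pt (B' \<otimes> K') (Pair x k)) ?c (res (p \<otimes>\<^sub>f v) X)"
    note N = mate_hom[OF T pX]
    \<comment> \<open>By pasting, this composite is the mate of the cone over the image point
      \<open>(omap b x, omap v k)\<close>; the next step treats the inner factor, the mate of the
      cone over (x, k).\<close>
    have "iso (onc D one) (resa (pt (B' \<otimes> K') (Pair x k)) (pmate p u q b \<alpha> v X) \<cdot>\<^bsub>onc D one\<^esub> ?N)"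
      using reflective_cone_exact[OF c2 sD(2) bx vD(2) vk X] MP(1)[OF X] f3 vD by simp
    moreover have "iso (onc D one) ?N" by (rule reflective_cone_exact[OF c1 sD(3) y(2) vD(1) y(3) pX])
    ultimately show ?thesis
      using iso_cancel_left_factor[OF D_one N] resa_hom[OF squareD(4)[OF T] M] y(1) by blast
  qed
  then show ?thesis using der BK M unfolding derivator_def Der2_def by (auto simp add: hom_iff)
qed

text \<open>Over x the canonical cone on (u/x) is a suitable test cone, and pasting it with the
  identity square gives the same cone again. This is the invertibility of the structure cells of a
  push.\<close>

lemma pmate_push_exact:
  assumes u: "sfunc sm u A B" and v: "sfunc sm v K' K" and X: "X \<in> Obj (onc D (A \<otimes> K))"
  shows "iso (onc D (B \<otimes> K')) (pmate (id_func A) u u (id_func B) (id_ntr u) v X)"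
proof (rule pmate_exact[OF square_id[OF u] v X])
  note uD = sfuncD[OF u]
  fix x assume x: "x \<in> Obj B"
  note sp = sfunc_slice_proj[OF small u, of x] and sn = sntr_slice[OF small u x]
  note us = sfunc_comp[OF sp u]
  have "(id_ntr (id_func B) \<star> slice_ntr u x) \<bullet> (id_ntr u \<star> id_ntr (slice_proj u x)) = slice_ntr u x"
    using id_ntr_hcomp[OF sfuncD(3)[OF sp] uD(3)] hcomp_id_func(2)[OF sfuncD(3)[OF us] sntrD(1)[OF sn us]]
      vcomp_id(1)[OF sfuncD(3)[OF us] sntrD(1)[OF sn us]] by simp
  then show "\<exists>J s \<beta>. reflective_cone sm J s u x \<beta> \<and>
      reflective_cone sm J (id_func A \<odot> s) u (omap (id_func B) x) ((id_ntr (id_func B) \<star> \<beta>) \<bullet> (id_ntr u \<star> id_ntr s))"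
    using reflective_cone_slice[OF small u x] x comp_func_id(2)[OF sfuncD(3)[OF sp]]
    by (intro exI[of _ "slice u x"] exI[of _ "slice_proj u x"] exI[of _ "slice_ntr u x"]) simp
qed

text \<open>The base \<open>one\<close> has a single object, over which the slice of the projection
  from J is J itself. The identity of J is therefore a test cone, and its pasting with the square is
  the given cone \<alpha>.\<close>

lemma pmate_point_exact:
  assumes c: "reflective_cone sm J p u b \<alpha>" and u: "sfunc sm u A B" and b: "b \<in> Obj B"
    and v: "sfunc sm v K' K" and X: "X \<in> Obj (onc D (A \<otimes> K))"
  shows "iso (onc D (one \<otimes> K')) (pmate p u (to_one J) (pt B b) \<alpha> v X)"
    and "square J A one B p u (to_one J) (pt B b) \<alpha>"
proof -
  note uD = sfuncD[OF u]
  have p: "sfunc sm p J A" and a: "sntr sm \<alpha> (u \<odot> p) (pt B b \<odot> to_one J)"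
    using c uD by (auto simp add: reflective_cone_def)
  note J = sfuncD(1)[OF p] note t = sfunc_to_one[OF small J]
  note pb = sfunc_pt[OF small uD(2) b]
  show s: "square J A one B p u (to_one J) (pt B b) \<alpha>"
    unfolding square_def using p u t pb a by simp
  note n = sfuncD(3)
  show "iso (onc D (one \<otimes> K')) (pmate p u (to_one J) (pt B b) \<alpha> v X)"
  proof (rule pmate_exact[OF s v X])
    fix x :: "'k elem" assume "x \<in> Obj one"
    then have x: "x = Pt" by simp
    have i1: "(pt one Pt :: 'k sfunc) = id_func one"
      using func_to_one[OF small sfunc_pt[OF small one_Cat[OF small], of Pt]]
        func_to_one[OF small sfunc_id[OF one_Cat[OF small]]] by simp
    have e: "pt one Pt \<odot> to_one J = to_one J" "to_one J \<odot> id_func J = to_one J"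
      using comp_func_id[OF n[OF t]] i1 by simp_all
    have r1: "reflective_cone sm J (id_func J) (to_one J) Pt (id_ntr (to_one J))"
      by (rule reflective_cone_subterminal[OF small t]) (use sntr_id[OF t] in \<open>auto simp add: e hom_iff\<close>)
    have a': "(id_ntr (pt B b) \<star> id_ntr (to_one J)) \<bullet> (\<alpha> \<star> id_ntr (id_func J)) = \<alpha>"
      using id_ntr_hcomp[OF n[OF t] n[OF pb]] hcomp_id_func(1)[OF n[OF squareD(6)[OF s]] sntrD(1)[OF a squareD(6)[OF s]]]
       vcomp_id(2)[OF n[OF squareD(6)[OF s]] sntrD(1)[OF a squareD(6)[OF s]]] by simp
    show "\<exists>J' s \<beta>. reflective_cone sm J' s (to_one J) x \<beta> \<and>
      reflective_cone sm J' (p \<odot> s) u (omap (pt B b) x) ((id_ntr (pt B b) \<star> \<beta>) \<bullet> (\<alpha> \<star> id_ntr s))"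
      using r1 c x comp_func_id(1)[OF n[OF p]] a'
      by (intro exI[of _ J] exI[of _ "id_func J"] exI[of _ "id_ntr (to_one J)"]) simp
  qed
qed

end

section \<open>Morphisms of derivators and modifications\<close>

text \<open>The typing part of \<open>is_dmor\<close>, separated from invertibility and coherence.
  It is enough to evaluate the structure cells of composites, which has to be possible before
  coherence of those composites is discussed.\<close>

definition typed_dmor ::
  "('k elem set \<Rightarrow> bool) \<Rightarrow> ('k, 'o, 'm) dmor \<Rightarrow> ('k, 'o, 'm) pder \<Rightarrow> ('k, 'o, 'm) pder \<Rightarrow> bool" where
  "typed_dmor sm T E E' \<longleftrightarrow> (\<forall>K \<in> Cat sm. is_func (at T K) (onc E K) (onc E' K)) \<and>
     (\<forall>v K' K. sfunc sm v K' K \<longrightarrow> is_ntr (cell T v) (at T K' \<odot> onf E v) (onf E' v \<odot> at T K))"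

lemma typed_dmorD:
  assumes "typed_dmor sm T E E'"
  shows "K \<in> Cat sm \<Longrightarrow> is_func (at T K) (onc E K) (onc E' K)"
    and "sfunc sm v K' K \<Longrightarrow> is_ntr (cell T v) (at T K' \<odot> onf E v) (onf E' v \<odot> at T K)"
  using assms unfolding typed_dmor_def by blast+

text \<open>The identity transformations in \<open>comp_dmor\<close> contribute identity arrows.
  What remains is the cell of T under the functor S, followed by the cell of S at the image of
  X.\<close>

lemma typed_dmor_comp:
  assumes E: "prederivator sm E" "prederivator sm E'" "prederivator sm E''"
    and T: "typed_dmor sm T E E'" and S: "typed_dmor sm S E' E''"
  shows "typed_dmor sm (S \<odot>\<^sub>d T) E E''"
    and "sfunc sm v K' K \<Longrightarrow> X \<in> Obj (onc E K) \<Longrightarrow>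
      cmp (cell (S \<odot>\<^sub>d T) v) X =
        cmp (cell S v) (omap (at T K) X) \<cdot>\<^bsub>onc E'' K'\<^esub> amap (at S K') (cmp (cell T v) X)"
proof -
  note TD = typed_dmorD[OF T] and SD = typed_dmorD[OF S]
  note f1 = prederivatorD(2)[OF E(1), rule_format] and f2 = prederivatorD(2)[OF E(2), rule_format]
    and f3 = prederivatorD(2)[OF E(3), rule_format]
  have "is_ntr (cell (S \<odot>\<^sub>d T) v) (at (S \<odot>\<^sub>d T) K' \<odot> onf E v) (onf E'' v \<odot> at (S \<odot>\<^sub>d T) K) \<and>
      (X \<in> Obj (onc E K) \<longrightarrow> cmp (cell (S \<odot>\<^sub>d T) v) X =
        cmp (cell S v) (omap (at T K) X) \<cdot>\<^bsub>onc E'' K'\<^esub> amap (at S K') (cmp (cell T v) X))" if v: "sfunc sm v K' K" for v K' K X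
  proof -
    note vD = sfuncD[OF v]
    note e1 = f1[OF v] and e2 = f2[OF v] and e3 = f3[OF v]
    note TK = TD(1)[OF vD(2)] and TK' = TD(1)[OF vD(1)] and SK = SD(1)[OF vD(2)] and SK' = SD(1)[OF vD(1)]
    note tn = TD(2)[OF v] and sn = SD(2)[OF v]
    have a: "is_ntr (id_ntr (at S K') \<star> cell T v) (at S K' \<odot> at T K' \<odot> onf E v) (at S K' \<odot> onf E' v \<odot> at T K)"
      using is_ntr_hcomp[OF is_func_comp_func[OF e1 TK'] SK' tn is_ntr_id[OF SK']]
        comp_func_assoc[OF e1 TK' SK'] comp_func_assoc[OF TK e2 SK'] by simp
    have b: "is_ntr (cell S v \<star> id_ntr (at T K)) (at S K' \<odot> onf E' v \<odot> at T K) (onf E'' v \<odot> (at S K \<odot> at T K))"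
      using is_ntr_hcomp[OF TK is_func_comp_func[OF e2 SK'] is_ntr_id[OF TK] sn]
        comp_func_assoc[OF TK SK e3] by simp
    note c = is_ntr_vcomp[OF is_func_comp_func[OF e1 is_func_comp_func[OF TK' SK']] a b]
    note tD = is_ntrD[OF tn is_func_comp_func[OF e1 TK']] and sD = is_ntrD[OF sn is_func_comp_func[OF e2 SK']]
    note F = is_funcD[OF TK] is_funcD[OF TK'] is_funcD[OF SK] is_funcD[OF SK'] is_funcD[OF e1] is_funcD[OF e2] is_funcD[OF e3]
    have "cmp (cell (S \<odot>\<^sub>d T) v) X = cmp (cell S v) (omap (at T K) X) \<cdot>\<^bsub>onc E'' K'\<^esub> amap (at S K') (cmp (cell T v) X)"
      if X: "X \<in> Obj (onc E K)"
    proof -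
      have o: "omap (at S K') (omap (onf E' v) (omap (at T K) X)) \<in> Obj (onc E'' K')" using X by (simp add: F)
      show ?thesis
        using X o sD(5-7)[of "omap (at T K) X"] tD(5-7)[of X]
        by (simp add: comp_dmor_def vD F sD(2,3) tD(2,3) category_simps[OF is_funcD(2)[OF e3]]
            category_simps[OF is_funcD(2)[OF TK]])
    qed
    then show ?thesis using c by (simp add: comp_dmor_def vD)
  qed
  then show "sfunc sm v K' K \<Longrightarrow> X \<in> Obj (onc E K) \<Longrightarrow>
      cmp (cell (S \<odot>\<^sub>d T) v) X =
        cmp (cell S v) (omap (at T K) X) \<cdot>\<^bsub>onc E'' K'\<^esub> amap (at S K') (cmp (cell T v) X)"
    and "typed_dmor sm (S \<odot>\<^sub>d T) E E''"
    unfolding typed_dmor_def using is_func_comp_func[OF TD(1) SD(1)] by (auto simp add: comp_dmor_def)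
qed

text \<open>The axioms are equalities of natural transformations and can be checked on components,
  where whiskering with identities leaves only an application of a functor or an evaluation.\<close>

lemma is_modificationI:
  assumes E: "prederivator sm E" "prederivator sm E'"
    and T: "typed_dmor sm T E E'" and S: "typed_dmor sm S E E'"
    and t: "\<And>K X. K \<in> Cat sm \<Longrightarrow> X \<in> Obj (onc E K) \<Longrightarrow> t K X \<in> hom (onc E' K) (omap (at T K) X) (omap (at S K) X)"
    and n: "\<And>K f X Y. K \<in> Cat sm \<Longrightarrow> f \<in> hom (onc E K) X Y \<Longrightarrow>
      t K Y \<cdot>\<^bsub>onc E' K\<^esub> amap (at T K) f = amap (at S K) f \<cdot>\<^bsub>onc E' K\<^esub> t K X"
    and m: "\<And>v K' K X. sfunc sm v K' K \<Longrightarrow> X \<in> Obj (onc E K) \<Longrightarrow>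
      amap (onf E' v) (t K X) \<cdot>\<^bsub>onc E' K'\<^esub> cmp (cell T v) X =
        cmp (cell S v) X \<cdot>\<^bsub>onc E' K'\<^esub> t K' (omap (onf E v) X)"
  shows "is_modification sm (\<lambda>K. mk_ntr (at T K) (at S K) (t K)) E E' T S"
proof -
  note TD = typed_dmorD[OF T] and SD = typed_dmorD[OF S]
  note f1 = prederivatorD(2)[OF E(1), rule_format] and f2 = prederivatorD(2)[OF E(2), rule_format]
  let ?t = "\<lambda>K. mk_ntr (at T K) (at S K) (t K)"
  have tn: "is_ntr (?t K) (at T K) (at S K)" if K: "K \<in> Cat sm" for K
    by (rule is_ntr_mk[OF TD(1)[OF K] SD(1)[OF K] t[OF K]]) (auto intro!: n[OF K] simp add: hom_iff)
  have "(id_ntr (onf E' v) \<star> ?t K) \<bullet> cell T v = cell S v \<bullet> (?t K' \<star> id_ntr (onf E v))" if v: "sfunc sm v K' K" for v K' K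
  proof -
    note vD = sfuncD[OF v] and e1 = f1[OF v] and e2 = f2[OF v]
    note TK = TD(1)[OF vD(2)] and TK' = TD(1)[OF vD(1)] and SK = SD(1)[OF vD(2)] and SK' = SD(1)[OF vD(1)]
    note s = is_func_comp_func[OF e1 TK']
    note a = is_ntr_vcomp[OF s TD(2)[OF v] is_ntr_hcomp[OF TK e2 tn[OF vD(2)] is_ntr_id[OF e2]]]
    note b = is_ntr_vcomp[OF s is_ntr_hcomp[OF e1 TK' is_ntr_id[OF e1] tn[OF vD(1)]] SD(2)[OF v]]
    note tD = is_ntrD[OF TD(2)[OF v] s]
    show ?thesis
    proof (rule ntr_eqI[OF a b])
      fix X assume "X \<in> Obj (Src (at T K' \<odot> onf E v))"
      then have X: "X \<in> Obj (onc E K)" by (simp add: is_funcD(3)[OF e1])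
      note F = is_funcD[OF TK] is_funcD[OF TK'] is_funcD[OF SK] is_funcD[OF SK'] is_funcD[OF e1] is_funcD[OF e2]
      have h: "t K X \<in> Arr (onc E' K)" "Dom (onc E' K) (t K X) = omap (at T K) X" "Cod (onc E' K) (t K X) = omap (at S K) X"
        using t[OF vD(2) X] by (auto simp add: hom_iff)
      have eX: "omap (onf E v) X \<in> Obj (onc E K')" using X by (simp add: F)
      have h': "t K' (omap (onf E v) X) \<in> Arr (onc E' K')" "Dom (onc E' K') (t K' (omap (onf E v) X)) = omap (at T K') (omap (onf E v) X)"
        using t[OF vD(1) eX] by (auto simp add: hom_iff)
      show "cmp ((id_ntr (onf E' v) \<star> ?t K) \<bullet> cell T v) X = cmp (cell S v \<bullet> (?t K' \<star> id_ntr (onf E v))) X"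
        using X eX h h' m[OF v X] by (simp add: F tD(2,3) category_simps[OF is_funcD(2)[OF e2]])
    qed
  qed
  then show ?thesis unfolding is_modification_def using tn by blast
qed

text \<open>The axioms are again checked on components. For a composite parameter change, strict
  functoriality of the prederivators and strict associativity first give both sides the same source
  and target.\<close>

lemma is_dmorI:
  assumes E: "prederivator sm E" "prederivator sm E'" and T: "typed_dmor sm T E E'"
    and i: "\<And>v K' K X. sfunc sm v K' K \<Longrightarrow> X \<in> Obj (onc E K) \<Longrightarrow> iso (onc E' K') (cmp (cell T v) X)"
    and u: "\<And>K X. K \<in> Cat sm \<Longrightarrow> X \<in> Obj (onc E K) \<Longrightarrow> cmp (cell T (id_func K)) X = Ident (onc E' K) (omap (at T K) X)"
    and c: "\<And>v w K'' K' K X. sfunc sm v K'' K' \<Longrightarrow> sfunc sm w K' K \<Longrightarrow> X \<in> Obj (onc E K) \<Longrightarrow>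
      cmp (cell T (w \<odot> v)) X =
        amap (onf E' v) (cmp (cell T w) X) \<cdot>\<^bsub>onc E' K''\<^esub> cmp (cell T v) (omap (onf E w) X)"
    and n: "\<And>\<alpha> v w K' K X. sfunc sm v K' K \<Longrightarrow> sntr sm \<alpha> v w \<Longrightarrow> X \<in> Obj (onc E K) \<Longrightarrow>
      cmp (onn E' \<alpha>) (omap (at T K) X) \<cdot>\<^bsub>onc E' K'\<^esub> cmp (cell T v) X =
        cmp (cell T w) X \<cdot>\<^bsub>onc E' K'\<^esub> amap (at T K') (cmp (onn E \<alpha>) X)"
  shows "is_dmor sm T E E'"
proof -
  note TD = typed_dmorD[OF T]
  note f1 = prederivatorD(2)[OF E(1), rule_format] and f2 = prederivatorD(2)[OF E(2), rule_format]
  show ?thesis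
    unfolding is_dmor_def
  proof (intro conjI ballI allI impI)
    fix K assume K: "K \<in> Cat sm"
    show TK: "is_func (at T K) (onc E K) (onc E' K)" by (rule TD(1)[OF K])
    have "is_ntr (cell T (id_func K)) (at T K) (at T K)"
      using TD(2)[OF sfunc_id[OF K]] prederivatorD(4)[OF E(1)] prederivatorD(4)[OF E(2)] K comp_func_id[OF TK] by simp
    then show "cell T (id_func K) = id_ntr (at T K)"
      by (rule ntr_eqI[OF _ is_ntr_id[OF TK]]) (simp add: is_funcD[OF TK] u[OF K])
  next
    fix v K' K assume v: "sfunc sm v K' K"
    note e1 = f1[OF v] and TK' = TD(1)[OF sfuncD(1)[OF v]]
    show "is_iso_ntr (cell T v) (at T K' \<odot> onf E v) (onf E' v \<odot> at T K)"
      unfolding is_iso_ntr_def using TD(2)[OF v] i[OF v] by (simp add: is_funcD[OF e1] is_funcD[OF TK'])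
  next
    fix v w K'' K' K assume v: "sfunc sm v K'' K'" and w: "sfunc sm w K' K"
    note vD = sfuncD[OF v] and wD = sfuncD[OF w]
    note v1 = f1[OF v] and v2 = f2[OF v] and w1 = f1[OF w] and w2 = f2[OF w]
    note TK = TD(1)[OF wD(2)] and TK' = TD(1)[OF vD(2)] and TK'' = TD(1)[OF vD(1)]
    have e: "onf E (w \<odot> v) = onf E v \<odot> onf E w" "onf E' (w \<odot> v) = onf E' v \<odot> onf E' w"
      using prederivatorD(5)[OF E(1), rule_format, OF v w] prederivatorD(5)[OF E(2), rule_format, OF v w] by auto
    have l: "is_ntr (cell T (w \<odot> v)) (at T K'' \<odot> onf E v \<odot> onf E w) (onf E' v \<odot> onf E' w \<odot> at T K)"
      using TD(2)[OF sfunc_comp[OF v w]] e comp_func_assoc[OF w1 v1 TK''] by simp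
    have r1: "is_ntr (cell T v \<star> id_ntr (onf E w)) (at T K'' \<odot> onf E v \<odot> onf E w) (onf E' v \<odot> at T K' \<odot> onf E w)"
      by (rule is_ntr_hcomp[OF w1 is_func_comp_func[OF v1 TK''] is_ntr_id[OF w1] TD(2)[OF v]])
    have r2: "is_ntr (id_ntr (onf E' v) \<star> cell T w) (onf E' v \<odot> at T K' \<odot> onf E w) (onf E' v \<odot> onf E' w \<odot> at T K)"
      using is_ntr_hcomp[OF is_func_comp_func[OF w1 TK'] v2 TD(2)[OF w] is_ntr_id[OF v2]]
        comp_func_assoc[OF w1 TK' v2] comp_func_assoc[OF TK w2 v2] by simp
    note s = is_func_comp_func[OF w1 is_func_comp_func[OF v1 TK'']]
    note tv = is_ntrD[OF TD(2)[OF v] is_func_comp_func[OF v1 TK'']] and tw = is_ntrD[OF TD(2)[OF w] is_func_comp_func[OF w1 TK']]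
    note F = is_funcD[OF TK] is_funcD[OF TK'] is_funcD[OF TK''] is_funcD[OF v1] is_funcD[OF v2] is_funcD[OF w1] is_funcD[OF w2]
    show "cell T (w \<odot> v) = (id_ntr (onf E' v) \<star> cell T w) \<bullet> (cell T v \<star> id_ntr (onf E w))"
    proof (rule ntr_eqI[OF l is_ntr_vcomp[OF s r1 r2]])
      fix X assume "X \<in> Obj (Src (at T K'' \<odot> onf E v \<odot> onf E w))"
      then have X: "X \<in> Obj (onc E K)" by (simp add: F)
      show "cmp (cell T (w \<odot> v)) X = cmp ((id_ntr (onf E' v) \<star> cell T w) \<bullet> (cell T v \<star> id_ntr (onf E w))) X"
        using X tv(5-7)[of "omap (onf E w) X"] tw(5-7)[of X]
        by (simp add: c[OF v w X] F tv(2,3) tw(2,3) category_simps[OF is_funcD(2)[OF v2]]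
            category_simps[OF is_funcD(1)[OF v1]])
    qed
  next
    fix \<alpha> v w assume a: "sntr sm \<alpha> v w"
    define K' K where "K' = Src v" and "K = Tgt v"
    have v: "sfunc sm v K' K" using a by (simp add: sntr_def K'_def K_def)
    note w = sntrD(2)[OF a v] note vD = sfuncD[OF v]
    note v1 = f1[OF v] and v2 = f2[OF v] and w1 = f1[OF w] and w2 = f2[OF w]
    note TK = TD(1)[OF vD(2)] and TK' = TD(1)[OF vD(1)]
    note a1 = prederivatorD(3)[OF E(1), rule_format, OF a] and a2 = prederivatorD(3)[OF E(2), rule_format, OF a]
    note s = is_func_comp_func[OF v1 TK']
    note l = is_ntr_vcomp[OF s TD(2)[OF v] is_ntr_hcomp[OF TK v2 is_ntr_id[OF TK] a2]]
    note r = is_ntr_vcomp[OF s is_ntr_hcomp[OF v1 TK' a1 is_ntr_id[OF TK']] TD(2)[OF w]]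
    note tv = is_ntrD[OF TD(2)[OF v] s]
    note d1 = is_ntrD[OF a1 v1] and d2 = is_ntrD[OF a2 v2]
    note F = is_funcD[OF TK] is_funcD[OF TK'] is_funcD[OF v1] is_funcD[OF v2] is_funcD[OF w1] is_funcD[OF w2]
    have "(onn E' \<alpha> \<star> id_ntr (at T K)) \<bullet> cell T v = cell T w \<bullet> (id_ntr (at T K') \<star> onn E \<alpha>)"
    proof (rule ntr_eqI[OF l r])
      fix X assume "X \<in> Obj (Src (at T K' \<odot> onf E v))"
      then have X: "X \<in> Obj (onc E K)" by (simp add: F)
      show "cmp ((onn E' \<alpha> \<star> id_ntr (at T K)) \<bullet> cell T v) X = cmp (cell T w \<bullet> (id_ntr (at T K') \<star> onn E \<alpha>)) X"
        using X n[OF v a X] d1(5-7)[of X] d2(5-7)[of "omap (at T K) X"]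
        by (simp add: F tv(2,3) d1(2,3) d2(2,3) category_simps[OF is_funcD(2)[OF v2]])
    qed
    then show "(onn E' \<alpha> \<star> id_ntr (at T (Tgt v))) \<bullet> cell T v = cell T w \<bullet> (id_ntr (at T (Src v)) \<star> onn E \<alpha>)"
      by (simp add: K'_def K_def)
  qed
qed

section \<open>Shifted prederivators and the morphisms induced by a functor\<close>

context derivator_context
begin

lemma shift_simps [simp]:
  "onc (shift D A) K = onc D (A \<otimes> K)" "onf (shift D A) v = onf D (id_func A \<otimes>\<^sub>f v)"
  "onn (shift D A) \<alpha> = onn D (id_ntr (id_func A) \<otimes>\<^sub>n \<alpha>)"
  by (simp_all add: shift_def)

text \<open>The product with A is a strict 2-functor by the compatibilities of products with
  identities and both compositions, and D is composed with it.\<close>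

lemma prederivator_shift: assumes A: "A \<in> Cat sm" shows "prederivator sm (shift D A)"
proof -
  note i = sfunc_id[OF A] and n = sfuncD(3)
  have iA: "is_func (id_func A) A A" by (rule n[OF i])
  have p: "sfunc sm (id_func A \<otimes>\<^sub>f v) (A \<otimes> K') (A \<otimes> K)" if "sfunc sm v K' K" for v K' K
    by (rule sfunc_prod[OF small i that])
  have a: "sntr sm (id_ntr (id_func A) \<otimes>\<^sub>n \<alpha>) (id_func A \<otimes>\<^sub>f v) (id_func A \<otimes>\<^sub>f w)" if "sntr sm \<alpha> v w" for \<alpha> v w
    using sntr_prod[OF small i _ sntr_id[OF i] that] that by (auto simp add: sntr_def)
  show ?thesis
    unfolding prederivator_def shift_simps
  proof (intro conjI ballI allI impI)
    show "category (onc D (A \<otimes> K))" if "K \<in> Cat sm" for K by (rule D_cat[OF prod_cat_Cat[OF small A that]])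
    show "is_func (onf D (id_func A \<otimes>\<^sub>f v)) (onc D (A \<otimes> K)) (onc D (A \<otimes> K'))" if "sfunc sm v K' K" for v K' K
      by (rule D_func[OF p[OF that]])
    show "is_ntr (onn D (id_ntr (id_func A) \<otimes>\<^sub>n \<alpha>)) (onf D (id_func A \<otimes>\<^sub>f v)) (onf D (id_func A \<otimes>\<^sub>f w))" if "sntr sm \<alpha> v w" for \<alpha> v w
      by (rule D_ntr[OF a[OF that]])
    show "onf D (id_func A \<otimes>\<^sub>f id_func K) = id_func (onc D (A \<otimes> K))" if "K \<in> Cat sm" for K
      using prod_func_id[OF Cat_category[OF A] Cat_category[OF that]] onf_id[OF prod_cat_Cat[OF small A that]] by simp
    show "onf D (id_func A \<otimes>\<^sub>f (w \<odot> v)) = onf D (id_func A \<otimes>\<^sub>f v) \<odot> onf D (id_func A \<otimes>\<^sub>f w)"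
      if v: "sfunc sm v K'' K'" and w: "sfunc sm w K' K" for v w K'' K' K
      using onf_comp[OF p[OF v] p[OF w]] prod_func_comp[OF iA n[OF v] iA n[OF w]] comp_func_id[OF iA] by simp
    show "onn D (id_ntr (id_func A) \<otimes>\<^sub>n id_ntr v) = id_ntr (onf D (id_func A \<otimes>\<^sub>f v))" if v: "sfunc sm v K' K" for v K' K
      using prod_ntr_id[OF iA n[OF v]] onn_id[OF p[OF v]] by simp
  next
    fix \<alpha> \<beta> u v w assume al: "sntr sm \<alpha> u v" and be: "sntr sm \<beta> v w"
    then have u: "sfunc sm u (Src u) (Tgt u)" by (simp add: sntr_def)
    note v = sntrD(2)[OF al u]
    show "onn D (id_ntr (id_func A) \<otimes>\<^sub>n (\<beta> \<bullet> \<alpha>)) = onn D (id_ntr (id_func A) \<otimes>\<^sub>n \<beta>) \<bullet> onn D (id_ntr (id_func A) \<otimes>\<^sub>n \<alpha>)"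
      using prederivator_raw(7)[rule_format, OF a[OF al] a[OF be]]
        prod_ntr_vcomp[OF iA n[OF u] is_ntr_id[OF iA] sntrD(1)[OF al u] is_ntr_id[OF iA] sntrD(1)[OF be v]]
        vcomp_id(1)[OF iA is_ntr_id[OF iA]] by simp
  next
    fix \<alpha> \<beta> u u' v v' assume al: "sntr sm \<alpha> u u'" and be: "sntr sm \<beta> v v'" and e: "Src v = Tgt u"
    from al have u: "sfunc sm u (Src u) (Tgt u)" by (simp add: sntr_def)
    from be e have v: "sfunc sm v (Tgt u) (Tgt v)" by (simp add: sntr_def)
    show "onn D (id_ntr (id_func A) \<otimes>\<^sub>n (\<beta> \<star> \<alpha>)) = onn D (id_ntr (id_func A) \<otimes>\<^sub>n \<alpha>) \<star> onn D (id_ntr (id_func A) \<otimes>\<^sub>n \<beta>)"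
      using onn_hcomp[OF p[OF u] p[OF v] a[OF al] a[OF be]]
        prod_ntr_hcomp[OF iA n[OF u] is_ntr_id[OF iA] sntrD(1)[OF al u] iA n[OF v] is_ntr_id[OF iA] sntrD(1)[OF be v]]
        hcomp_id_func(1)[OF iA is_ntr_id[OF iA]] by simp
  qed
qed

text \<open>The structure cell is defined as the mate of an identity transformation on a composite.
  Written as a product of the identities of w and v, it falls under the pasting lemmas.\<close>

lemma push_cell:
  assumes w: "sfunc sm w A B" and v: "sfunc sm v K' K" and X: "X \<in> Obj (onc D (A \<otimes> K))"
  shows "cmp (cell (push D w) v) X = pmate (id_func A) w w (id_func B) (id_ntr w) v X"
proof -
  note wD = sfuncD[OF w] and vD = sfuncD[OF v]
  note n = sfuncD(3)
  note q = sfunc_prod[OF small w sfunc_id[OF vD(1)]] and p = sfunc_prod[OF small sfunc_id[OF wD(1)] v]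
  have "id_ntr ((w \<otimes>\<^sub>f id_func K) \<odot> (id_func A \<otimes>\<^sub>f v)) = id_ntr w \<otimes>\<^sub>n id_ntr v"
    unfolding prod_func_comp[OF is_func_id[OF is_funcD(1)[OF wD(3)]] vD(3) wD(3) is_func_id[OF is_funcD(2)[OF vD(3)]]]
      comp_func_id[OF vD(3)] comp_func_id[OF wD(3)] prod_ntr_id[OF wD(3) vD(3)] ..
  then show ?thesis
    using X is_funcD(3)[OF D_func[OF p]] by (simp add: push_def Let_def wD vD)
qed

lemma typed_push: assumes w: "sfunc sm w A B" shows "typed_dmor sm (push D w) (shift D A) (shift D B)"
  unfolding typed_dmor_def shift_simps
proof (intro conjI ballI allI impI)
  note wD = sfuncD[OF w]
  fix K assume K: "K \<in> Cat sm"
  show "is_func (at (push D w) K) (onc D (A \<otimes> K)) (onc D (B \<otimes> K))"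
    using lan_func[OF sfunc_prod[OF small w sfunc_id[OF K]]] by (simp add: push_def)
next
  note wD = sfuncD[OF w]
  fix v K' K assume v: "sfunc sm v K' K"
  note vD = sfuncD[OF v]
  note p = sfunc_prod[OF small sfunc_id[OF wD(1)] v] and b = sfunc_prod[OF small sfunc_id[OF wD(2)] v]
    and u = sfunc_prod[OF small w sfunc_id[OF vD(2)]] and q = sfunc_prod[OF small w sfunc_id[OF vD(1)]]
  note sq = square_prod[OF square_id[OF w] v, unfolded vD(4,5)]
  define F G where "F = lan D (w \<otimes>\<^sub>f id_func K') \<odot> onf D (id_func A \<otimes>\<^sub>f v)" and "G = onf D (id_func B \<otimes>\<^sub>f v) \<odot> lan D (w \<otimes>\<^sub>f id_func K)"
  have F: "is_func F (onc D (A \<otimes> K)) (onc D (B \<otimes> K'))" and G: "is_func G (onc D (A \<otimes> K)) (onc D (B \<otimes> K'))"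
    unfolding F_def G_def using is_func_comp_func[OF D_func[OF p] lan_func[OF q]] is_func_comp_func[OF lan_func[OF u] D_func[OF b]] by auto
  have s: "Src (onf D (id_func A \<otimes>\<^sub>f v)) = onc D (A \<otimes> K)" "Src (lan D (w \<otimes>\<^sub>f id_func K)) = onc D (A \<otimes> K)"
    using is_funcD(3)[OF D_func[OF p]] is_funcD(3)[OF lan_func[OF u]] .
  have "is_ntr (mk_ntr F G (pmate (id_func A) w w (id_func B) (id_ntr w) v)) F G"
  proof (rule is_ntr_mk[OF F G])
    fix X assume X: "X \<in> Obj (onc D (A \<otimes> K))"
    then show "pmate (id_func A) w w (id_func B) (id_ntr w) v X \<in> hom (onc D (B \<otimes> K')) (omap F X) (omap G X)"
      using pmate_hom[OF square_id[OF w] v X] by (simp add: F_def G_def s)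
  next
    fix f assume f: "f \<in> Arr (onc D (A \<otimes> K))"
    then have fh: "f \<in> hom (onc D (A \<otimes> K)) (Dom (onc D (A \<otimes> K)) f) (Cod (onc D (A \<otimes> K)) f)" by (simp add: hom_iff)
    show "pmate (id_func A) w w (id_func B) (id_ntr w) v (Cod (onc D (A \<otimes> K)) f) \<cdot>\<^bsub>onc D (B \<otimes> K')\<^esub> amap F f =
        amap G f \<cdot>\<^bsub>onc D (B \<otimes> K')\<^esub> pmate (id_func A) w w (id_func B) (id_ntr w) v (Dom (onc D (A \<otimes> K)) f)"
      using mate_natural[OF sq fh] f by (simp add: F_def G_def s vD)
  qed
  moreover have "cell (push D w) v = mk_ntr F G (pmate (id_func A) w w (id_func B) (id_ntr w) v)"
  proof -
    have "id_ntr ((w \<otimes>\<^sub>f id_func K) \<odot> (id_func A \<otimes>\<^sub>f v)) = id_ntr w \<otimes>\<^sub>n id_ntr v"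
      unfolding prod_func_comp[OF is_func_id[OF is_funcD(1)[OF wD(3)]] vD(3) wD(3) is_func_id[OF is_funcD(2)[OF vD(3)]]]
        comp_func_id[OF vD(3)] comp_func_id[OF wD(3)] prod_ntr_id[OF wD(3) vD(3)] ..
    then show ?thesis by (simp add: push_def Let_def wD vD F_def G_def)
  qed
  ultimately show "is_ntr (cell (push D w) v) (at (push D w) K' \<odot> onf D (id_func A \<otimes>\<^sub>f v)) (onf D (id_func B \<otimes>\<^sub>f v) \<odot> at (push D w) K)"
    by (simp add: F_def G_def) (simp add: push_def)
qed

lemma interchange:
  assumes w: "sfunc sm w A B" and v: "sfunc sm v K' K"
  shows "(id_func B \<otimes>\<^sub>f v) \<odot> (w \<otimes>\<^sub>f id_func K') = w \<otimes>\<^sub>f v" "(w \<otimes>\<^sub>f id_func K) \<odot> (id_func A \<otimes>\<^sub>f v) = w \<otimes>\<^sub>f v"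
  using prod_func_comp[OF sfuncD(3)[OF w] is_func_id[OF is_funcD(1)[OF sfuncD(3)[OF v]]] is_func_id[OF is_funcD(2)[OF sfuncD(3)[OF w]]] sfuncD(3)[OF v]]
    prod_func_comp[OF is_func_id[OF is_funcD(1)[OF sfuncD(3)[OF w]]] sfuncD(3)[OF v] sfuncD(3)[OF w] is_func_id[OF is_funcD(2)[OF sfuncD(3)[OF v]]]]
    comp_func_id[OF sfuncD(3)[OF w]] comp_func_id[OF sfuncD(3)[OF v]] by simp_all

lemma res_interchange:
  assumes w: "sfunc sm w A B" and v: "sfunc sm v K' K" and X: "X \<in> Obj (onc D (B \<otimes> K))"
  shows "res (w \<otimes>\<^sub>f id_func K') (res (id_func B \<otimes>\<^sub>f v) X) = res (id_func A \<otimes>\<^sub>f v) (res (w \<otimes>\<^sub>f id_func K) X)"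
  using res_comp[OF sfunc_prod[OF small w sfunc_id[OF sfuncD(1)[OF v]]] sfunc_prod[OF small sfunc_id[OF sfuncD(2)[OF w]] v] X]
    res_comp[OF sfunc_prod[OF small sfunc_id[OF sfuncD(1)[OF w]] v] sfunc_prod[OF small w sfunc_id[OF sfuncD(2)[OF v]]] X]
    interchange[OF w v] by simp

lemma pull_cell:
  assumes w: "sfunc sm w A B" and v: "sfunc sm v K' K" and X: "X \<in> Obj (onc D (B \<otimes> K))"
  shows "cmp (cell (pull D w) v) X = Ident (onc D (A \<otimes> K')) (res (w \<otimes>\<^sub>f id_func K') (res (id_func B \<otimes>\<^sub>f v) X))"
  using X sfuncD(4,5)[OF w] sfuncD(4,5)[OF v] is_funcD(3,4)[OF D_func[OF sfunc_prod[OF small w sfunc_id[OF sfuncD(1)[OF v]]]]]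
    is_funcD(3)[OF D_func[OF sfunc_prod[OF small sfunc_id[OF sfuncD(2)[OF w]] v]]] by (simp add: pull_def)

lemma typed_pull: assumes w: "sfunc sm w A B" shows "typed_dmor sm (pull D w) (shift D B) (shift D A)"
  unfolding typed_dmor_def shift_simps
proof (intro conjI ballI allI impI)
  note wD = sfuncD[OF w]
  fix K assume K: "K \<in> Cat sm"
  show "is_func (at (pull D w) K) (onc D (B \<otimes> K)) (onc D (A \<otimes> K))"
    using D_func[OF sfunc_prod[OF small w sfunc_id[OF K]]] by (simp add: pull_def)
next
  note wD = sfuncD[OF w]
  fix v K' K assume v: "sfunc sm v K' K"
  note vD = sfuncD[OF v]
  note w' = sfunc_prod[OF small w sfunc_id[OF vD(1)]] and bv = sfunc_prod[OF small sfunc_id[OF wD(2)] v]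
  note w0 = sfunc_prod[OF small w sfunc_id[OF vD(2)]] and av = sfunc_prod[OF small sfunc_id[OF wD(1)] v]
  have "onf D (w \<otimes>\<^sub>f id_func K') \<odot> onf D (id_func B \<otimes>\<^sub>f v) = onf D (id_func A \<otimes>\<^sub>f v) \<odot> onf D (w \<otimes>\<^sub>f id_func K)"
    using onf_comp[OF w' bv] onf_comp[OF av w0] interchange[OF w v] by simp
  then show "is_ntr (cell (pull D w) v) (at (pull D w) K' \<odot> onf D (id_func B \<otimes>\<^sub>f v)) (onf D (id_func A \<otimes>\<^sub>f v) \<odot> at (pull D w) K)"
    using is_ntr_id[OF is_func_comp_func[OF D_func[OF bv] D_func[OF w']]] by (simp add: pull_def wD vD)
qed

text \<open>Restriction is a strict morphism, so its cell is an identity, and an identity composed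
  on the right disappears. The underlying objects match because w and v act on different factors of
  the product.\<close>

lemma cell_comp_pull:
  assumes w: "sfunc sm w A B" and E: "prederivator sm E" and S: "typed_dmor sm S (shift D A) E"
    and v: "sfunc sm v K' K" and X: "X \<in> Obj (onc D (B \<otimes> K))"
  shows "cmp (cell (S \<odot>\<^sub>d pull D w) v) X = cmp (cell S v) (res (w \<otimes>\<^sub>f id_func K) X)"
proof -
  note wD = sfuncD[OF w] and vD = sfuncD[OF v]
  note w0 = sfunc_prod[OF small w sfunc_id[OF vD(2)]] and av = sfunc_prod[OF small sfunc_id[OF wD(1)] v]
  note pA = prederivator_shift[OF wD(1)] and pB = prederivator_shift[OF wD(2)]
  note SD = typed_dmorD[OF S]
  note Y = res_obj[OF w0 X] note Y' = res_obj[OF av Y]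
  note f = is_func_comp_func[OF D_func[OF av] SD(1)[OF vD(1), unfolded shift_simps]]
  note sD = is_ntrD[OF SD(2)[OF v, unfolded shift_simps] f]
  note S' = is_funcD[OF SD(1)[OF vD(1), unfolded shift_simps]]
  show ?thesis
    using typed_dmor_comp(2)[OF pB pA E typed_pull[OF w] S v, of X] X Y Y' sD(5,6)[OF Y]
    by (simp add: pull_cell[OF w v X] res_interchange[OF w v X] S' category_simps[OF S'(2)] is_funcD(3)[OF D_func[OF av]])
      (simp add: pull_def S' category_simps[OF S'(2)])
qed

lemma cell_pull_comp:
  assumes w: "sfunc sm w A B" and E: "prederivator sm E" and T: "typed_dmor sm T E (shift D B)"
    and v: "sfunc sm v K' K" and X: "X \<in> Obj (onc E K)"
  shows "cmp (cell (pull D w \<odot>\<^sub>d T) v) X = resa (w \<otimes>\<^sub>f id_func K') (cmp (cell T v) X)"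
proof -
  note wD = sfuncD[OF w] and vD = sfuncD[OF v]
  note w' = sfunc_prod[OF small w sfunc_id[OF vD(1)]] and bv = sfunc_prod[OF small sfunc_id[OF wD(2)] v]
  note pA = prederivator_shift[OF wD(1)] and pB = prederivator_shift[OF wD(2)]
  note TD = typed_dmorD[OF T]
  note TK = TD(1)[OF vD(2), unfolded shift_simps] and TK' = TD(1)[OF vD(1), unfolded shift_simps]
  note e = prederivatorD(2)[OF E, rule_format, OF v]
  note Y = is_funcD(5)[OF TK X]
  note h = is_ntrD(4)[OF TD(2)[OF v] is_func_comp_func[OF e TK'] X]
  have h': "cmp (cell T v) X \<in> hom (onc D (B \<otimes> K')) (omap (at T K') (omap (onf E v) X)) (res (id_func B \<otimes>\<^sub>f v) (omap (at T K) X))"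
    using h X is_funcD(3)[OF e] is_funcD(3)[OF TK] by simp
  show ?thesis
    using typed_dmor_comp(2)[OF E pB pA T typed_pull[OF w] v X]
      hom_unit(1)[OF D_cat[OF sfuncD(1)[OF w']] resa_hom[OF w' h']]
    by (simp add: pull_cell[OF w v Y]) (simp add: pull_def)
qed

end

section \<open>Cocones and the Grothendieck construction\<close>

lemma rcone_simps [simp]:
  "x \<in> Obj (rcone C) \<longleftrightarrow> x = Pt \<or> x \<in> Old ` Obj C"
  "f \<in> Arr (rcone C) \<longleftrightarrow> f = Pt \<or> f \<in> Old ` Arr C \<or> f \<in> Pair Pt ` Obj C"
  "Dom (rcone C) Pt = Pt" "Cod (rcone C) Pt = Pt" "Ident (rcone C) Pt = Pt"
  "f \<in> Arr C \<Longrightarrow> Dom (rcone C) (Old f) = Old (Dom C f)"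
  "f \<in> Arr C \<Longrightarrow> Cod (rcone C) (Old f) = Old (Cod C f)"
  "c \<in> Obj C \<Longrightarrow> Dom (rcone C) (Pair Pt c) = Old c"
  "c \<in> Obj C \<Longrightarrow> Cod (rcone C) (Pair Pt c) = Pt"
  "c \<in> Obj C \<Longrightarrow> Ident (rcone C) (Old c) = Old (Ident C c)"
  "f \<in> Arr C \<Longrightarrow> g \<in> Arr C \<Longrightarrow> Dom C g = Cod C f \<Longrightarrow> Old g \<cdot>\<^bsub>rcone C\<^esub> Old f = Old (g \<cdot>\<^bsub>C\<^esub> f)"
  "f \<in> Arr C \<Longrightarrow> c \<in> Obj C \<Longrightarrow> Cod C f = c \<Longrightarrow> Pair Pt c \<cdot>\<^bsub>rcone C\<^esub> Old f = Pair Pt (Dom C f)"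
  "c \<in> Obj C \<Longrightarrow> Pt \<cdot>\<^bsub>rcone C\<^esub> Pair Pt c = Pair Pt c"
  "Pt \<cdot>\<^bsub>rcone C\<^esub> Pt = Pt"
  by (auto simp add: rcone_def)

lemma rcone_Cat: assumes sm: "smallness sm" and C: "C \<in> Cat sm" shows "rcone C \<in> Cat sm"
proof -
  note F = category_simps[OF Cat_category[OF C]]
  have "category (rcone C)"
    unfolding rcone_def by (rule category_mk_cat) (auto simp add: F)
  moreover have "sm (Obj (rcone C))" "sm (Arr (rcone C))"
    using C small_Un[OF sm smallnessD(4)[OF sm] smallnessD(4)[OF sm]]
    by (auto simp add: rcone_def Cat_def intro!: smallnessD(2,4)[OF sm])
  ultimately show ?thesis by (simp add: Cat_def)
qed

lemma rcone_in_simps [simp]: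
  "Src (rcone_in C) = C" "Tgt (rcone_in C) = rcone C"
  "c \<in> Obj C \<Longrightarrow> omap (rcone_in C) c = Old c" "f \<in> Arr C \<Longrightarrow> amap (rcone_in C) f = Old f"
  by (simp_all add: rcone_in_def)

lemma sfunc_rcone_in: assumes sm: "smallness sm" and C: "C \<in> Cat sm" shows "sfunc sm (rcone_in C) C (rcone C)"
proof -
  have "is_func (rcone_in C) C (rcone C)"
    unfolding rcone_in_def
    by (rule is_func_mk) (auto simp add: Cat_category[OF C] Cat_category[OF rcone_Cat[OF sm C]] category_simps[OF Cat_category[OF C]])
  then show ?thesis using C rcone_Cat[OF sm C] by (simp add: sfunc_def)
qed

text \<open>The apex is terminal in the cocone category, which is the condition under which a slice
  over it reduces to the source of the functor.\<close>

lemma rcone_subterminal: "f \<in> hom (rcone C) x Pt \<Longrightarrow> g \<in> hom (rcone C) x Pt \<Longrightarrow> f = g"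
  by (auto simp add: hom_iff)

section \<open>Functors to Cat and their Grothendieck construction\<close>

lemma Cat1_simps:
  "Obj (Cat1 sm) = Cat sm" "u \<in> Arr (Cat1 sm) \<longleftrightarrow> sfunc sm u (Src u) (Tgt u)"
  "sfunc sm u (Src u) (Tgt u) \<Longrightarrow> Dom (Cat1 sm) u = Src u" "sfunc sm u (Src u) (Tgt u) \<Longrightarrow> Cod (Cat1 sm) u = Tgt u"
  "A \<in> Cat sm \<Longrightarrow> Ident (Cat1 sm) A = id_func A"
  "sfunc sm u (Src u) (Tgt u) \<Longrightarrow> sfunc sm v (Src v) (Tgt v) \<Longrightarrow> Src v = Tgt u \<Longrightarrow> v \<cdot>\<^bsub>Cat1 sm\<^esub> u = v \<odot> u"
  by (simp_all add: Cat1_def)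

text \<open>Smallness of \<open>groth F\<close> is recorded here as an assumption; a left
  decomposition supplies it through the typing of u, whose source is a small category.\<close>

locale small_diagram =
  fixes sm :: "'k elem set \<Rightarrow> bool" and C :: "'k scat" and F :: "'k diag"
  assumes small: "smallness sm" and C: "C \<in> Cat sm" and F: "is_func F C (Cat1 sm)" and groth: "groth F \<in> Cat sm"
begin

lemma fibre_Cat: "c \<in> Obj C \<Longrightarrow> omap F c \<in> Cat sm"
  using is_funcD(5)[OF F] by (simp add: Cat1_simps)

lemma fibre_func: assumes f: "f \<in> Arr C" shows "sfunc sm (amap F f) (omap F (Dom C f)) (omap F (Cod C f))"
  using is_funcD(6-8)[OF F f] by (auto simp add: Cat1_simps)

lemma fibre_id: "c \<in> Obj C \<Longrightarrow> amap F (Ident C c) = id_func (omap F c)"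
  using is_funcD(9)[OF F] fibre_Cat by (simp add: Cat1_simps)

lemma fibre_comp: assumes "f \<in> Arr C" "g \<in> Arr C" "Dom C g = Cod C f"
  shows "amap F (g \<cdot>\<^bsub>C\<^esub> f) = amap F g \<odot> amap F f"
proof -
  note f = fibre_func[OF assms(1)] and g = fibre_func[OF assms(2)]
  show ?thesis
    using is_funcD(10)[OF F assms] f g assms(3) sfuncD(4,5)[OF f] sfuncD(4,5)[OF g] by (simp add: Cat1_simps)
qed

abbreviation "E \<equiv> groth F"

lemma Src_F: "Src F = C"
  by (rule is_funcD(3)[OF F])

lemma groth_simps:
  "Pair c x \<in> Obj E \<longleftrightarrow> c \<in> Obj C \<and> x \<in> Obj (omap F c)"
  "Pair f (Pair x g) \<in> Arr E \<longleftrightarrow> f \<in> Arr C \<and> x \<in> Obj (omap F (Dom C f)) \<and>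
        g \<in> Arr (omap F (Cod C f)) \<and> Dom (omap F (Cod C f)) g = omap (amap F f) x"
  "Pair f (Pair x g) \<in> Arr E \<Longrightarrow> Dom E (Pair f (Pair x g)) = Pair (Dom C f) x"
  "Pair f (Pair x g) \<in> Arr E \<Longrightarrow> Cod E (Pair f (Pair x g)) = Pair (Cod C f) (Cod (omap F (Cod C f)) g)"
  "Pair c x \<in> Obj E \<Longrightarrow> Ident E (Pair c x) = Pair (Ident C c) (Pair x (Ident (omap F c) x))"
  "Pair f (Pair x g) \<in> Arr E \<Longrightarrow> Pair f' (Pair x' g') \<in> Arr E \<Longrightarrow> Dom C f' = Cod C f \<Longrightarrow> x' = Cod (omap F (Cod C f)) g \<Longrightarrow>
    Pair f' (Pair x' g') \<cdot>\<^bsub>E\<^esub> Pair f (Pair x g) =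
      Pair (f' \<cdot>\<^bsub>C\<^esub> f) (Pair x (g' \<cdot>\<^bsub>omap F (Cod C f')\<^esub> amap (amap F f') g))"
  by (auto simp add: groth_def Let_def Src_F)

lemma Obj_grothE: assumes "z \<in> Obj E" obtains c x where "z = Pair c x" "c \<in> Obj C" "x \<in> Obj (omap F c)"
  using assms by (auto simp add: groth_def Let_def Src_F)

lemma Arr_grothE: assumes "z \<in> Arr E"
  obtains f x g where "z = Pair f (Pair x g)" "f \<in> Arr C" "x \<in> Obj (omap F (Dom C f))"
    "g \<in> Arr (omap F (Cod C f))" "Dom (omap F (Cod C f)) g = omap (amap F f) x"
  using assms by (auto simp add: groth_def Let_def Src_F)

lemma fib_simps:
  "Src (fib F c) = omap F c" "Tgt (fib F c) = E"
  "x \<in> Obj (omap F c) \<Longrightarrow> omap (fib F c) x = Pair c x"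
  "g \<in> Arr (omap F c) \<Longrightarrow> amap (fib F c) g = Pair (Ident C c) (Pair (Dom (omap F c) g) g)"
  by (simp_all add: fib_def Src_F)

lemmas C_simps = category_simps[OF Cat_category[OF C]]

lemma sfunc_fib: assumes c: "c \<in> Obj C" shows "sfunc sm (fib F c) (omap F c) E"
proof -
  note A = category_simps[OF Cat_category[OF fibre_Cat[OF c]]]
  have "is_func (fib F c) (omap F c) E"
    unfolding fib_def Src_F
    by (rule is_func_mk)
      (auto simp add: Cat_category[OF fibre_Cat[OF c]] Cat_category[OF groth] groth_simps C_simps A c fibre_id)
  then show ?thesis using fibre_Cat[OF c] groth by (simp add: sfunc_def)
qed

lemma fib_ntr_simps:
  "NSrc (fib_ntr F f) = fib F (Dom C f)" "NTgt (fib_ntr F f) = fib F (Cod C f) \<odot> amap F f"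
  "x \<in> Obj (omap F (Dom C f)) \<Longrightarrow> cmp (fib_ntr F f) x = Pair f (Pair x (Ident (omap F (Cod C f)) (omap (amap F f) x)))"
  by (simp_all add: fib_ntr_def Let_def Src_F fib_simps)

lemma sntr_fib: assumes f: "f \<in> Arr C" shows "sntr sm (fib_ntr F f) (fib F (Dom C f)) (fib F (Cod C f) \<odot> amap F f)"
proof -
  note d = sfunc_fib[OF C_simps(1)[OF f]] and c = sfunc_fib[OF C_simps(2)[OF f]] and m = fibre_func[OF f]
  note mD = sfuncD[OF m]
  note M = is_funcD[OF mD(3)] category_simps[OF Cat_category[OF mD(1)]] category_simps[OF Cat_category[OF mD(2)]]
  show ?thesis
    by (rule sntrI[OF d], unfold fib_ntr_def Let_def Src_F, rule is_ntr_mk[OF sfuncD(3)[OF d] sfuncD(3)[OF sfunc_comp[OF m c]]])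
     (auto simp add: hom_iff fib_simps groth_simps f C_simps M fibre_id)
qed

definition proj :: "'k sfunc" where "proj = mk_func E C pfst pfst"

lemma sfunc_proj: "sfunc sm proj E C"
proof -
  have "is_func proj E C"
    unfolding proj_def
    by (rule is_func_mk[OF Cat_category[OF groth] Cat_category[OF C]])
      (auto simp add: groth_simps C_simps elim!: Obj_grothE Arr_grothE)
  then show ?thesis using groth C by (simp add: sfunc_def)
qed

definition cproj :: "'k sfunc" where "cproj = rcone_in C \<odot> proj"

lemma sfunc_cproj: "sfunc sm cproj E (rcone C)"
  unfolding cproj_def by (rule sfunc_comp[OF sfunc_proj sfunc_rcone_in[OF small C]])

lemma cproj_simps:
  "Src cproj = E" "Tgt cproj = rcone C"
  "Pair c x \<in> Obj E \<Longrightarrow> omap cproj (Pair c x) = Old c"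
  "Pair f (Pair x g) \<in> Arr E \<Longrightarrow> amap cproj (Pair f (Pair x g)) = Old f"
  by (simp_all add: cproj_def proj_def groth_simps)

lemma cproj_fib: assumes c: "c \<in> Obj C" shows "cproj \<odot> fib F c = pt (rcone C) (Old c) \<odot> to_one (omap F c)"
proof (rule func_eqI[OF sfuncD(3)[OF sfunc_comp[OF sfunc_fib[OF c] sfunc_cproj]] sfuncD(3)[OF sfunc_comp[OF sfunc_to_one[OF small fibre_Cat[OF c]]
      sfunc_pt[OF small rcone_Cat[OF small C]]]]])
  note A = category_simps[OF Cat_category[OF fibre_Cat[OF c]]]
  show "Old c \<in> Obj (rcone C)" using c by simp
  show "omap (cproj \<odot> fib F c) x = omap (pt (rcone C) (Old c) \<odot> to_one (omap F c)) x" if "x \<in> Obj (omap F c)" for x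
    using that c by (simp add: fib_simps cproj_simps groth_simps)
  show "amap (cproj \<odot> fib F c) x = amap (pt (rcone C) (Old c) \<odot> to_one (omap F c)) x" if "x \<in> Arr (omap F c)" for x
    using that c by (simp add: fib_simps cproj_simps groth_simps C_simps A fibre_id)
qed

text \<open>All arrows into \<open>Old c\<close> come from C, so the slice is the slice of the
  projection over c. Functoriality of the reflection comes from F(f h) = F f F h, and it is a strict
  retraction because F preserves identities on the nose. The composite of \<open>cproj\<close> with
  the fibre inclusion is constant, which allows the cone to be an identity transformation.\<close>

lemma reflective_cone_fib:
  assumes c: "c \<in> Obj C"
  shows "reflective_cone sm (omap F c) (fib F c) cproj (Old c) (id_ntr (cproj \<odot> fib F c))"
proof -
  note fc = sfunc_fib[OF c] and g = sfunc_cproj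
  note gD = sfuncD[OF g] and fD = sfuncD[OF fc]
  note A = category_simps[OF Cat_category[OF fibre_Cat[OF c]]]
  define S where "S = slice cproj (Old c)"
  note S = slice_Cat[OF small g, of "Old c", folded S_def] and sp = sfunc_slice_proj[OF small g, of "Old c", folded S_def]
  note SS = slice_simps[OF gD(3), of _ _ "Old c", folded S_def]
  \<comment> \<open>Decodes an arrow into \<open>Old c\<close>. On such arrows the constructor is
    always \<open>Old\<close>, so the undefined branch is never reached on S.\<close>
  define out where "out = (\<lambda>y :: 'k elem. case y of Old f \<Rightarrow> f | _ \<Rightarrow> undefined)"
  define l where "l = mk_func S (omap F c) (\<lambda>x. omap (amap F (out (psnd x))) (psnd (pfst x)))
     (\<lambda>m. amap (amap F (out (psnd m))) (psnd (psnd (pfst m))))"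
  have out [simp]: "out (Old f) = f" for f by (simp add: out_def)
  have Sx: "\<exists>d y f. x = Pair (Pair d y) (Old f) \<and> d \<in> Obj C \<and> y \<in> Obj (omap F d) \<and> f \<in> Arr C \<and> Dom C f = d \<and> Cod C f = c"
    if "x \<in> Obj S" for x
    using that by (auto simp add: S_def cproj_simps groth_simps elim!: Obj_sliceE[OF _ gD(3)] Obj_grothE)
  have Sm: "\<exists>h y t f. m = Pair (Pair h (Pair y t)) (Old f) \<and> h \<in> Arr C \<and> y \<in> Obj (omap F (Dom C h)) \<and>
      t \<in> Arr (omap F (Cod C h)) \<and> Dom (omap F (Cod C h)) t = omap (amap F h) y \<and> f \<in> Arr C \<and> Dom C f = Cod C h \<and> Cod C f = c \<and>
      Pair h (Pair y t) \<in> Arr E \<and>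
      Dom S m = Pair (Pair (Dom C h) y) (Old (f \<cdot>\<^bsub>C\<^esub> h)) \<and> Cod S m = Pair (Pair (Cod C h) (Cod (omap F (Cod C h)) t)) (Old f)"
    if m: "m \<in> Arr S" for m
  proof -
    obtain z q where z: "m = Pair z q" "z \<in> Arr E" "q \<in> Arr (rcone C)" "Dom (rcone C) q = omap cproj (Cod E z)" "Cod (rcone C) q = Old c"
      using m unfolding S_def by (auto elim!: Arr_sliceE[OF _ gD(3)])
    obtain h y t where e: "z = Pair h (Pair y t)" "h \<in> Arr C" "y \<in> Obj (omap F (Dom C h))" "t \<in> Arr (omap F (Cod C h))"
      "Dom (omap F (Cod C h)) t = omap (amap F h) y" using z(2) by (auto elim!: Arr_grothE)
    note A' = category_simps[OF Cat_category[OF fibre_Cat[OF C_simps(2)[OF e(2)]]]]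
    obtain f where f: "q = Old f" "f \<in> Arr C" "Dom C f = Cod C h" "Cod C f = c"
      using z e by (auto simp add: groth_simps cproj_simps C_simps A')
    have "Dom S m = Pair (Pair (Dom C h) y) (Old (f \<cdot>\<^bsub>C\<^esub> h))" "Cod S m = Pair (Pair (Cod C h) (Cod (omap F (Cod C h)) t)) (Old f)"
      using m z(2) e(2-) f unfolding z(1) e(1) f(1) by (simp_all add: SS groth_simps cproj_simps)
    then show ?thesis using z(1,2) e f(1-4) by blast
  qed
  have l: "is_func l S (omap F c)"
    unfolding l_def
  proof (rule is_func_mk[OF Cat_category[OF S] Cat_category[OF fibre_Cat[OF c]]])
    fix x assume "x \<in> Obj S"
    from Sx[OF this] show "omap (amap F (out (psnd x))) (psnd (pfst x)) \<in> Obj (omap F c)"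
      using is_funcD(5)[OF sfuncD(3)[OF fibre_func]] by auto
  next
    fix m assume "m \<in> Arr S"
    from Sm[OF this] obtain h y t f where m: "m = Pair (Pair h (Pair y t)) (Old f)" "h \<in> Arr C" "y \<in> Obj (omap F (Dom C h))"
      "t \<in> Arr (omap F (Cod C h))" "Dom (omap F (Cod C h)) t = omap (amap F h) y" "f \<in> Arr C" "Dom C f = Cod C h" "Cod C f = c"
      "Dom S m = Pair (Pair (Dom C h) y) (Old (f \<cdot>\<^bsub>C\<^esub> h))" "Cod S m = Pair (Pair (Cod C h) (Cod (omap F (Cod C h)) t)) (Old f)"
      by blast
    note ff = is_funcD[OF sfuncD(3)[OF fibre_func[OF m(6)]], unfolded m(7,8)] and fh = is_funcD[OF sfuncD(3)[OF fibre_func[OF m(2)]]]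
    show "amap (amap F (out (psnd m))) (psnd (psnd (pfst m))) \<in> Arr (omap F c) \<and>
         Dom (omap F c) (amap (amap F (out (psnd m))) (psnd (psnd (pfst m)))) = omap (amap F (out (psnd (Dom S m)))) (psnd (pfst (Dom S m))) \<and>
         Cod (omap F c) (amap (amap F (out (psnd m))) (psnd (psnd (pfst m)))) = omap (amap F (out (psnd (Cod S m)))) (psnd (pfst (Cod S m)))"
      unfolding m(9,10) using m(2-8) ff(3-8) fh(3-8) by (simp add: m(1) fibre_comp)
  next
    fix x assume x: "x \<in> Obj S"
    from Sx[OF this] obtain d y f where xe: "x = Pair (Pair d y) (Old f)" "d \<in> Obj C" "y \<in> Obj (omap F d)" "f \<in> Arr C" "Dom C f = d" "Cod C f = c"
      by blast
    note ff = is_funcD[OF sfuncD(3)[OF fibre_func[OF xe(4)]], unfolded xe(5,6)]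
    show "amap (amap F (out (psnd (Ident S x)))) (psnd (psnd (pfst (Ident S x)))) = Ident (omap F c) (omap (amap F (out (psnd x))) (psnd (pfst x)))"
      using x xe(2-) ff(9) unfolding xe(1) by (simp add: SS groth_simps)
  next
    fix m m' assume mm: "m \<in> Arr S" "m' \<in> Arr S" "Dom S m' = Cod S m"
    from Sm[OF mm(1)] obtain h y t f where m: "m = Pair (Pair h (Pair y t)) (Old f)" "h \<in> Arr C" "y \<in> Obj (omap F (Dom C h))"
      "t \<in> Arr (omap F (Cod C h))" "Dom (omap F (Cod C h)) t = omap (amap F h) y" "f \<in> Arr C" "Dom C f = Cod C h" "Cod C f = c"
      "Pair h (Pair y t) \<in> Arr E"
      "Cod S m = Pair (Pair (Cod C h) (Cod (omap F (Cod C h)) t)) (Old f)"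
      by blast
    from Sm[OF mm(2)] obtain h' y' t' f' where m': "m' = Pair (Pair h' (Pair y' t')) (Old f')" "h' \<in> Arr C" "y' \<in> Obj (omap F (Dom C h'))"
      "t' \<in> Arr (omap F (Cod C h'))" "Dom (omap F (Cod C h')) t' = omap (amap F h') y'" "f' \<in> Arr C" "Dom C f' = Cod C h'" "Cod C f' = c"
      "Pair h' (Pair y' t') \<in> Arr E"
      "Dom S m' = Pair (Pair (Dom C h') y') (Old (f' \<cdot>\<^bsub>C\<^esub> h'))"
      by blast
    have q: "Dom C h' = Cod C h" "y' = Cod (omap F (Cod C h)) t" "f = f' \<cdot>\<^bsub>C\<^esub> h'" using mm(3) m(10) m'(10) by simp_all
    have zz: "Pair h' (Pair y' t') \<cdot>\<^bsub>E\<^esub> Pair h (Pair y t) =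
        Pair (h' \<cdot>\<^bsub>C\<^esub> h) (Pair y (t' \<cdot>\<^bsub>omap F (Cod C h')\<^esub> amap (amap F h') t))"
      by (rule groth_simps(6)[OF m(9) m'(9) q(1,2)])
    have "m' \<cdot>\<^bsub>S\<^esub> m = Pair (Pair h' (Pair y' t') \<cdot>\<^bsub>E\<^esub> Pair h (Pair y t)) (Old f')"
      using mm m(9) m'(9) q m(2-8) m'(2-8) unfolding m(1) m'(1) by (subst SS(6)) (auto simp add: groth_simps cproj_simps)
    note mc = this[unfolded zz]
    note ff' = is_funcD[OF sfuncD(3)[OF fibre_func[OF m'(6)]], unfolded m'(7,8)] and fh' = is_funcD[OF sfuncD(3)[OF fibre_func[OF m'(2)]], unfolded q(1)]
    show "amap (amap F (out (psnd (m' \<cdot>\<^bsub>S\<^esub> m)))) (psnd (psnd (pfst (m' \<cdot>\<^bsub>S\<^esub> m)))) =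
       amap (amap F (out (psnd m'))) (psnd (psnd (pfst m'))) \<cdot>\<^bsub>omap F c\<^esub> amap (amap F (out (psnd m))) (psnd (psnd (pfst m)))"
      unfolding mc using m(2-8) m'(2-8) q(1,2) ff'(3-10) fh'(3-10)
      by (simp add: m(1) m'(1) q(3) fibre_comp)
  qed
  have ls: "sfunc sm l S (omap F c)" using l S fibre_Cat[OF c] by (simp add: sfunc_def)
  \<comment> \<open>At the object ((d, y), f) the unit is (f, id) from (d, y) to (c, F f y), the
    opcartesian lift of f.\<close>
  define h where "h = mk_ntr (slice_proj cproj (Old c)) (fib F c \<odot> l) (\<lambda>x. Pair (out (psnd x)) (Pair (psnd (pfst x)) (Ident (omap F c) (omap (amap F (out (psnd x))) (psnd (pfst x))))))"
  have h: "sntr sm h (slice_proj cproj (Old c)) (fib F c \<odot> l)"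
  proof (rule sntrI[OF sp], unfold h_def, rule is_ntr_mk[OF sfuncD(3)[OF sp] sfuncD(3)[OF sfunc_comp[OF ls fc]]])
    fix x assume x: "x \<in> Obj S"
    from Sx[OF this] obtain d y f where xe: "x = Pair (Pair d y) (Old f)" "d \<in> Obj C" "y \<in> Obj (omap F d)" "f \<in> Arr C" "Dom C f = d" "Cod C f = c"
      by blast
    note ff = is_funcD[OF sfuncD(3)[OF fibre_func[OF xe(4)]], unfolded xe(5,6)]
    show "Pair (out (psnd x)) (Pair (psnd (pfst x)) (Ident (omap F c) (omap (amap F (out (psnd x))) (psnd (pfst x)))))
      \<in> hom E (omap (slice_proj cproj (Old c)) x) (omap (fib F c \<odot> l) x)"
      using x xe(2-) ff is_funcD(5)[OF l x] is_funcD(3)[OF l] by (simp add: S_def[symmetric] fib_simps) (simp add: xe(1) hom_iff groth_simps A l_def)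
  next
    fix m assume mS: "m \<in> Arr S"
    from Sm[OF this] obtain h y t f where m: "m = Pair (Pair h (Pair y t)) (Old f)" "h \<in> Arr C" "y \<in> Obj (omap F (Dom C h))"
      "t \<in> Arr (omap F (Cod C h))" "Dom (omap F (Cod C h)) t = omap (amap F h) y" "f \<in> Arr C" "Dom C f = Cod C h" "Cod C f = c"
      "Pair h (Pair y t) \<in> Arr E"
      "Dom S m = Pair (Pair (Dom C h) y) (Old (f \<cdot>\<^bsub>C\<^esub> h))" "Cod S m = Pair (Pair (Cod C h) (Cod (omap F (Cod C h)) t)) (Old f)"
      by blast
    note ff = is_funcD[OF sfuncD(3)[OF fibre_func[OF m(6)]], unfolded m(7,8)] and fh = is_funcD[OF sfuncD(3)[OF fibre_func[OF m(2)]]]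
    have lm: "amap l m = amap (amap F f) t" using mS by (simp add: l_def m(1))
    have c1: "amap (slice_proj cproj (Old c)) m = Pair h (Pair y t)" using mS by (simp add: S_def[symmetric] m(1))
    have c2: "amap (fib F c \<odot> l) m = Pair (Ident C c) (Pair (omap (amap F f) (omap (amap F h) y)) (amap (amap F f) t))"
      using mS lm m(2-8) ff(3-8) is_funcD(3)[OF l] by (simp add: fib_simps)
    note A2 = category_simps[OF ff(1)]
    show "Pair (out (psnd (Cod S m))) (Pair (psnd (pfst (Cod S m))) (Ident (omap F c) (omap (amap F (out (psnd (Cod S m)))) (psnd (pfst (Cod S m)))))) \<cdot>\<^bsub>E\<^esub>
        amap (slice_proj cproj (Old c)) m =
      amap (fib F c \<odot> l) m \<cdot>\<^bsub>E\<^esub>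
        Pair (out (psnd (Dom S m))) (Pair (psnd (pfst (Dom S m))) (Ident (omap F c) (omap (amap F (out (psnd (Dom S m)))) (psnd (pfst (Dom S m))))))"
      unfolding c1 c2 m(10,11) using m(2-9) ff(3-10) fh(3-8) c
      by (simp add: groth_simps C_simps A A2 fibre_comp fibre_id)
  qed
  have ac: "cmp (id_ntr (cproj \<odot> fib F c)) j = Old (Ident C c)" if "j \<in> Obj (omap F c)" for j
    using that c by (simp add: fib_simps cproj_simps groth_simps)
  have ic: "Pair (Pair c j) (Old (Ident C c)) \<in> Obj S" if "j \<in> Obj (omap F c)" for j
    using that c by (simp add: SS groth_simps cproj_simps C_simps)
  show ?thesis
    unfolding reflective_cone_def gD(4,5)
  proof (intro conjI exI[of _ l] exI[of _ h] ballI)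
    show "sfunc sm (fib F c) (omap F c) E" by (rule fc)
    show "sntr sm (id_ntr (cproj \<odot> fib F c)) (cproj \<odot> fib F c) (pt (rcone C) (Old c) \<odot> to_one (omap F c))"
      using sntr_id[OF sfunc_comp[OF fc g]] cproj_fib[OF c] by simp
    show "sfunc sm l (slice cproj (Old c)) (omap F c)" using ls by (simp add: S_def)
    show "sntr sm h (slice_proj cproj (Old c)) (fib F c \<odot> l)" by (rule h)
  next
    fix x assume "x \<in> Obj (slice cproj (Old c))"
    then have x: "x \<in> Obj S" by (simp add: S_def)
    from Sx[OF this] obtain d y f where xe: "x = Pair (Pair d y) (Old f)" "d \<in> Obj C" "y \<in> Obj (omap F d)" "f \<in> Arr C" "Dom C f = d" "Cod C f = c"
      by blast
    note ff = is_funcD[OF sfuncD(3)[OF fibre_func[OF xe(4)]], unfolded xe(5,6)]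
    show "cmp (id_ntr (cproj \<odot> fib F c)) (omap l x) \<cdot>\<^bsub>rcone C\<^esub> amap cproj (cmp h x) = psnd x"
      using x xe(2-) ff(5) c unfolding ac[OF is_funcD(5)[OF l x]]
      by (simp add: h_def S_def[symmetric]) (simp add: xe(1) cproj_simps groth_simps A C_simps)
  next
    fix j assume j: "j \<in> Obj (omap F c)"
    show "omap l (Pair (omap (fib F c) j) (cmp (id_ntr (cproj \<odot> fib F c)) j)) = j"
      unfolding ac[OF j] using j c ic[OF j] by (simp add: l_def fib_simps fibre_id)
    show "cmp h (Pair (omap (fib F c) j) (cmp (id_ntr (cproj \<odot> fib F c)) j)) = Ident E (omap (fib F c) j)"
      unfolding ac[OF j] using j c ic[OF j] by (simp add: h_def S_def[symmetric] fib_simps fibre_id groth_simps)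
  next
    fix t assume t: "t \<in> Arr (omap F c)"
    have "Pair (Pair (Ident C c) (Pair (Dom (omap F c) t) t)) (Old (Ident C c)) \<in> Arr S"
      using t c by (simp add: SS groth_simps cproj_simps C_simps A fibre_id)
    then show "amap l (Pair (amap (fib F c) t) (cmp (id_ntr (cproj \<odot> fib F c)) (Cod (omap F c) t))) = t"
      unfolding ac[OF A(2)[OF t]] using t c by (simp add: l_def fib_simps fibre_id)
  qed
qed

text \<open>The unique transformation from \<open>cproj\<close> to the constant functor at the
  terminal object. At (c, x) it is the arrow from \<open>Old c\<close> to the apex, encoded by the
  object c.\<close>

definition apex_ntr :: "'k sntr" where
  "apex_ntr = mk_ntr cproj (pt (rcone C) Pt \<odot> to_one E) (\<lambda>x. Pair Pt (pfst x))"

lemma sntr_apex: "sntr sm apex_ntr cproj (pt (rcone C) Pt \<odot> to_one E)"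
proof -
  have Pt: "Pt \<in> Obj (rcone C)" by simp
  note R = category_simps[OF Cat_category[OF rcone_Cat[OF small C]]]
  show ?thesis
    by (rule sntrI[OF sfunc_cproj], unfold apex_ntr_def,
       rule is_ntr_mk[OF sfuncD(3)[OF sfunc_cproj] sfuncD(3)[OF sfunc_comp[OF sfunc_to_one[OF small groth] sfunc_pt[OF small rcone_Cat[OF small C] Pt]]]])
      (auto simp add: hom_iff cproj_simps groth_simps C_simps category_simps[OF Cat_category[OF groth]]
         category_simps[OF Cat_category[OF fibre_Cat]] elim!: Obj_grothE Arr_grothE)
qed

lemma apex_ntr_simps:
  "NSrc apex_ntr = cproj" "NTgt apex_ntr = pt (rcone C) Pt \<odot> to_one E"
  "x \<in> Obj E \<Longrightarrow> cmp apex_ntr x = Pair Pt (pfst x)"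
  by (simp_all add: apex_ntr_def cproj_simps)

lemma reflective_cone_apex: "reflective_cone sm E (id_func E) cproj Pt apex_ntr"
  by (rule reflective_cone_subterminal[OF small sfunc_cproj])
    (use sntr_apex rcone_subterminal in \<open>auto simp add: comp_func_id[OF sfuncD(3)[OF sfunc_cproj]]\<close>)

text \<open>Both sides have all components equal to \<open>Old f\<close>. The identity trades an
  arrow between two points of the cocone category for a transformation between fibre inclusions,
  that is, for a change of index diagrams.\<close>

lemma transition_fib:
  assumes f: "f \<in> Arr C"
  shows "pt_ntr (rcone C) (Old f) \<star> id_ntr (to_one (omap F (Dom C f))) = id_ntr cproj \<star> fib_ntr F f"
proof -
  note d = C_simps(1)[OF f] and c = C_simps(2)[OF f]
  note R = rcone_Cat[OF small C]
  have old: "Old f \<in> Arr (rcone C)" "Dom (rcone C) (Old f) = Old (Dom C f)" "Cod (rcone C) (Old f) = Old (Cod C f)"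
    using f by simp_all
  note t = sfunc_to_one[OF small fibre_Cat[OF d]] and m = fibre_func[OF f]
  have od: "Old (Dom C f) \<in> Obj (rcone C)" using d by simp
  have l: "sntr sm (pt_ntr (rcone C) (Old f) \<star> id_ntr (to_one (omap F (Dom C f)))) (cproj \<odot> fib F (Dom C f))
     (pt (rcone C) (Old (Cod C f)) \<odot> to_one (omap F (Dom C f)))"
    using sntr_hcomp[OF t sfunc_pt[OF small R od] sntr_id[OF t] sntr_pt[OF small R old(1), unfolded old(2,3)]] cproj_fib[OF d] by simp
  have tm: "to_one (omap F (Cod C f)) \<odot> amap F f = to_one (omap F (Dom C f))"
    using func_to_one[OF small sfunc_comp[OF m sfunc_to_one[OF small fibre_Cat[OF c]]]] .
  have oc: "Old (Cod C f) \<in> Obj (rcone C)" using c by simp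
  have "cproj \<odot> (fib F (Cod C f) \<odot> amap F f) = pt (rcone C) (Old (Cod C f)) \<odot> to_one (omap F (Dom C f))"
    using comp_func_assoc[OF sfuncD(3)[OF m] sfuncD(3)[OF sfunc_fib[OF c]] sfuncD(3)[OF sfunc_cproj]]
      comp_func_assoc[OF sfuncD(3)[OF m] sfuncD(3)[OF sfunc_to_one[OF small fibre_Cat[OF c]]] sfuncD(3)[OF sfunc_pt[OF small R oc]]]
      cproj_fib[OF c] tm by simp
  then have r: "sntr sm (id_ntr cproj \<star> fib_ntr F f) (cproj \<odot> fib F (Dom C f)) (pt (rcone C) (Old (Cod C f)) \<odot> to_one (omap F (Dom C f)))"
    using sntr_hcomp[OF sfunc_fib[OF d] sfunc_cproj sntr_fib[OF f] sntr_id[OF sfunc_cproj]] by simp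
  note s = sfunc_comp[OF sfunc_fib[OF d] sfunc_cproj]
  note M = is_funcD[OF sfuncD(3)[OF m]]
  show ?thesis
  proof (rule ntr_eqI[OF sntrD(1)[OF l s] sntrD(1)[OF r s]])
    fix x assume "x \<in> Obj (Src (cproj \<odot> fib F (Dom C f)))"
    then have x: "x \<in> Obj (omap F (Dom C f))" by (simp add: fib_simps)
    note cx = category_simps[OF Cat_category[OF fibre_Cat[OF c]]]
    show "cmp (pt_ntr (rcone C) (Old f) \<star> id_ntr (to_one (omap F (Dom C f)))) x = cmp (id_ntr cproj \<star> fib_ntr F f) x"
      using x f d c M(3-9) by (simp add: fib_ntr_simps fib_simps cproj_simps groth_simps C_simps cx)
  qed
qed

text \<open>Both sides have the arrow from \<open>Old c\<close> to the apex as every component. It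
  is used to factor the map from a vertex to the apex through the square of the apex.\<close>

lemma transition_apex:
  assumes c: "c \<in> Obj C"
  shows "pt_ntr (rcone C) (Pair Pt c) \<star> id_ntr (to_one (omap F c)) = apex_ntr \<star> id_ntr (fib F c)"
proof -
  note R = rcone_Cat[OF small C]
  have old: "Pair Pt c \<in> Arr (rcone C)" "Dom (rcone C) (Pair Pt c) = Old c" "Cod (rcone C) (Pair Pt c) = Pt"
    using c by simp_all
  have oc: "Old c \<in> Obj (rcone C)" and oP: "Pt \<in> Obj (rcone C)" using c by simp_all
  note t = sfunc_to_one[OF small fibre_Cat[OF c]] and f = sfunc_fib[OF c]
  have l: "sntr sm (pt_ntr (rcone C) (Pair Pt c) \<star> id_ntr (to_one (omap F c))) (cproj \<odot> fib F c)
     (pt (rcone C) Pt \<odot> to_one (omap F c))"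
    using sntr_hcomp[OF t sfunc_pt[OF small R oc] sntr_id[OF t] sntr_pt[OF small R old(1), unfolded old(2,3)]] cproj_fib[OF c] by simp
  have "pt (rcone C) Pt \<odot> to_one E \<odot> fib F c = pt (rcone C) Pt \<odot> to_one (omap F c)"
    using comp_func_assoc[OF sfuncD(3)[OF f] sfuncD(3)[OF sfunc_to_one[OF small groth]] sfuncD(3)[OF sfunc_pt[OF small R oP]]]
      func_to_one[OF small sfunc_comp[OF f sfunc_to_one[OF small groth]]] by simp
  then have r: "sntr sm (apex_ntr \<star> id_ntr (fib F c)) (cproj \<odot> fib F c) (pt (rcone C) Pt \<odot> to_one (omap F c))"
    using sntr_hcomp[OF f sfunc_cproj sntr_id[OF f] sntr_apex] by simp
  note s = sfunc_comp[OF f sfunc_cproj]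
  show ?thesis
  proof (rule ntr_eqI[OF sntrD(1)[OF l s] sntrD(1)[OF r s]])
    fix x assume "x \<in> Obj (Src (cproj \<odot> fib F c))"
    then have x: "x \<in> Obj (omap F c)" by (simp add: fib_simps)
    show "cmp (pt_ntr (rcone C) (Pair Pt c) \<star> id_ntr (to_one (omap F c))) x = cmp (apex_ntr \<star> id_ntr (fib F c)) x"
      using x c by (simp add: fib_simps cproj_simps groth_simps C_simps apex_ntr_simps fibre_id category_simps[OF Cat_category[OF fibre_Cat[OF c]]])
  qed
qed

end

section \<open>Coherence of structure cells and comparison maps between colimits\<close>

context derivator_context
begin

lemma res_prod_id: "A \<in> Cat sm \<Longrightarrow> K \<in> Cat sm \<Longrightarrow> X \<in> Obj (onc D (A \<otimes> K)) \<Longrightarrow> res (id_func A \<otimes>\<^sub>f id_func K) X = X"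
  by (simp add: prod_func_id Cat_category onf_id prod_cat_Cat[OF small])

lemma resa_prod_id: "A \<in> Cat sm \<Longrightarrow> K \<in> Cat sm \<Longrightarrow> f \<in> hom (onc D (A \<otimes> K)) X Y \<Longrightarrow> resa (id_func A \<otimes>\<^sub>f id_func K) f = f"
  by (simp add: prod_func_id Cat_category onf_id prod_cat_Cat[OF small] hom_iff)

lemma pmate_id:
  assumes w: "sfunc sm w A B" and K: "K \<in> Cat sm" and X: "X \<in> Obj (onc D (A \<otimes> K))"
  shows "pmate (id_func A) w w (id_func B) (id_ntr w) (id_func K) X = Ident (onc D (B \<otimes> K)) (lo (w \<otimes>\<^sub>f id_func K) X)"
proof -
  note wD = sfuncD[OF w]
  show ?thesis
    using mate_id[OF sfunc_prod[OF small w sfunc_id[OF K]] X]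
    by (simp add: prod_func_id Cat_category[OF wD(1)] Cat_category[OF wD(2)] Cat_category[OF K]
        prod_ntr_id[OF wD(3) is_func_id[OF Cat_category[OF K]]])
qed

lemma pmate_push_comp:
  assumes w: "sfunc sm w A B" and v: "sfunc sm v K' K" and v': "sfunc sm v' K'' K'" and X: "X \<in> Obj (onc D (A \<otimes> K))"
  shows "pmate (id_func A) w w (id_func B) (id_ntr w) (v \<odot> v') X =
    resa (id_func B \<otimes>\<^sub>f v') (pmate (id_func A) w w (id_func B) (id_ntr w) v X) \<cdot>\<^bsub>onc D (B \<otimes> K'')\<^esub>
    pmate (id_func A) w w (id_func B) (id_ntr w) v' (res (id_func A \<otimes>\<^sub>f v) X)"
proof -
  note wD = sfuncD[OF w]
  note iA = is_func_id[OF Cat_category[OF wD(1)]] and iB = is_func_id[OF Cat_category[OF wD(2)]]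
  have "(id_ntr (id_func B) \<star> id_ntr w) \<bullet> (id_ntr w \<star> id_ntr (id_func A)) = id_ntr w"
    using hcomp_id_func[OF wD(3) is_ntr_id[OF wD(3)]] vcomp_id(1)[OF wD(3) is_ntr_id[OF wD(3)]] by simp
  then show ?thesis
    using pmate_paste[OF square_id[OF w] square_id[OF w] v v' X] comp_func_id(1)[OF iA] comp_func_id(1)[OF iB] by simp
qed

text \<open>Both composites are mates of one square, whose 2-cell is the product of the identity of
  w with \<alpha>. On the left \<alpha> is absorbed at the bottom, on the right at the top.\<close>

lemma pmate_push_two:
  assumes w: "sfunc sm w A B" and v: "sfunc sm v K' K" and a: "sntr sm \<alpha> v v'" and X: "X \<in> Obj (onc D (A \<otimes> K))"
  shows "two (id_ntr (id_func B) \<otimes>\<^sub>n \<alpha>) (lo (w \<otimes>\<^sub>f id_func K) X) \<cdot>\<^bsub>onc D (B \<otimes> K')\<^esub>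
      pmate (id_func A) w w (id_func B) (id_ntr w) v X =
    pmate (id_func A) w w (id_func B) (id_ntr w) v' X \<cdot>\<^bsub>onc D (B \<otimes> K')\<^esub>
      la (w \<otimes>\<^sub>f id_func K') (two (id_ntr (id_func A) \<otimes>\<^sub>n \<alpha>) X)"
proof -
  note wD = sfuncD[OF w] and vD = sfuncD[OF v]
  note v' = sntrD(2)[OF a v] note vD' = sfuncD[OF v']
  note n = sfuncD(3)
  note iA = sfunc_id[OF wD(1)] and iB = sfunc_id[OF wD(2)] and iK = sfunc_id[OF vD(2)] and iK' = sfunc_id[OF vD(1)]
  note aN = sntrD(1)[OF a v] and nw = is_ntr_id[OF wD(3)]
  note S = square_prod[OF square_id[OF w] v, unfolded vD(4,5)] and S' = square_prod[OF square_id[OF w] v', unfolded vD'(4,5)]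
  have 1: "((id_ntr (id_func B) \<otimes>\<^sub>n \<alpha>) \<star> id_ntr (w \<otimes>\<^sub>f id_func K')) \<bullet> (id_ntr w \<otimes>\<^sub>n id_ntr v) = id_ntr w \<otimes>\<^sub>n \<alpha>"
    unfolding prod_ntr_id[OF wD(3) n[OF iK'], symmetric]
      prod_ntr_hcomp[OF wD(3) n[OF iK'] nw is_ntr_id[OF n[OF iK']] n[OF iB] vD(3) is_ntr_id[OF n[OF iB]] aN]
      hcomp_id_func(1)[OF vD(3) aN] hcomp_id_func(2)[OF wD(3) nw]
      prod_ntr_vcomp[OF wD(3) vD(3) nw is_ntr_id[OF vD(3)] nw aN] vcomp_id(1)[OF wD(3) nw] vcomp_id(1)[OF vD(3) aN] ..
  have 2: "(id_ntr w \<otimes>\<^sub>n id_ntr v') \<bullet> (id_ntr (w \<otimes>\<^sub>f id_func K) \<star> (id_ntr (id_func A) \<otimes>\<^sub>n \<alpha>)) = id_ntr w \<otimes>\<^sub>n \<alpha>"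
    unfolding prod_ntr_id[OF wD(3) n[OF iK], symmetric]
      prod_ntr_hcomp[OF n[OF iA] vD(3) is_ntr_id[OF n[OF iA]] aN wD(3) n[OF iK] nw is_ntr_id[OF n[OF iK]]]
      hcomp_id_func(2)[OF vD(3) aN] hcomp_id_func(1)[OF wD(3) nw]
      prod_ntr_vcomp[OF wD(3) vD(3) nw aN nw is_ntr_id[OF vD'(3)]] vcomp_id(1)[OF wD(3) nw] vcomp_id(2)[OF vD(3) aN] ..
  show ?thesis
    using mate_change_base[OF S sntr_prod[OF small iB v sntr_id[OF iB] a] X]
      mate_change_top[OF S' sfunc_prod[OF small iA v] sntr_prod[OF small iA v sntr_id[OF iA] a] X]
    unfolding 1 2 by (simp add: vD vD')
qed

text \<open>Both sides are values of D at the product of the identity of w with \<alpha>, obtained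
  by whiskering on the two different sides.\<close>

lemma pull_two:
  assumes w: "sfunc sm w A B" and v: "sfunc sm v K' K" and a: "sntr sm \<alpha> v v'" and X: "X \<in> Obj (onc D (B \<otimes> K))"
  shows "resa (w \<otimes>\<^sub>f id_func K') (two (id_ntr (id_func B) \<otimes>\<^sub>n \<alpha>) X) = two (id_ntr (id_func A) \<otimes>\<^sub>n \<alpha>) (res (w \<otimes>\<^sub>f id_func K) X)"
proof -
  note wD = sfuncD[OF w] and vD = sfuncD[OF v]
  note n = sfuncD(3)
  note iA = sfunc_id[OF wD(1)] and iB = sfunc_id[OF wD(2)] and iK = sfunc_id[OF vD(2)] and iK' = sfunc_id[OF vD(1)]
  note aN = sntrD(1)[OF a v] and nw = is_ntr_id[OF wD(3)]
  have "(id_ntr (id_func B) \<otimes>\<^sub>n \<alpha>) \<star> id_ntr (w \<otimes>\<^sub>f id_func K') = id_ntr (w \<otimes>\<^sub>f id_func K) \<star> (id_ntr (id_func A) \<otimes>\<^sub>n \<alpha>)"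
    unfolding prod_ntr_id[OF wD(3) n[OF iK'], symmetric] prod_ntr_id[OF wD(3) n[OF iK], symmetric]
      prod_ntr_hcomp[OF wD(3) n[OF iK'] nw is_ntr_id[OF n[OF iK']] n[OF iB] vD(3) is_ntr_id[OF n[OF iB]] aN]
      prod_ntr_hcomp[OF n[OF iA] vD(3) is_ntr_id[OF n[OF iA]] aN wD(3) n[OF iK] nw is_ntr_id[OF n[OF iK]]]
      hcomp_id_func[OF vD(3) aN] hcomp_id_func[OF wD(3) nw] ..
  then show ?thesis
    using two_whisker_right[OF sfunc_prod[OF small w iK'] sfunc_prod[OF small iB v] sntr_prod[OF small iB v sntr_id[OF iB] a] X]
      two_whisker_left[OF sfunc_prod[OF small iA v] sfunc_prod[OF small w iK] sntr_prod[OF small iA v sntr_id[OF iA] a] X] by simp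
qed

lemma square_comparison:
  assumes w: "sfunc sm w J A"
  shows "square J A one one w (to_one A) (to_one J) (id_func one) (id_ntr (to_one J))"
proof -
  note wD = sfuncD[OF w]
  note t = sfunc_to_one[OF small wD(2)] and t' = sfunc_to_one[OF small wD(1)]
  show ?thesis
    unfolding square_def using w t t' sfunc_id[OF one_Cat[OF small]] sntr_id[OF t'] func_to_one[OF small sfunc_comp[OF w t]]
      comp_func_id(2)[OF sfuncD(3)[OF t']] by simp
qed

text \<open>Exhibits the canonical map of colimits as the mate of a square over \<open>one\<close>,
  so that it can be pasted and is compatible with change of parameters.\<close>

lemma comparison_pmate:
  assumes w: "sfunc sm w J A" and K: "K \<in> Cat sm"
  shows "colim_comparison D K w X = pmate w (to_one A) (to_one J) (id_func one) (id_ntr (to_one J)) (id_func K) X"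
proof -
  note wD = sfuncD[OF w]
  note t' = sfunc_to_one[OF small wD(1)]
  show ?thesis
    using prod_func_id[OF Cat_category[OF one_Cat[OF small]] Cat_category[OF K]]
      prod_ntr_id[OF sfuncD(3)[OF t'] is_func_id[OF Cat_category[OF K]]]
    by (simp add: colim_comparison_def wD)
qed

lemma comparison_hom:
  assumes w: "sfunc sm w J A" and K: "K \<in> Cat sm" and X: "X \<in> Obj (onc D (A \<otimes> K))"
  shows "colim_comparison D K w X \<in> hom (onc D (one \<otimes> K)) (lo (to_one J \<otimes>\<^sub>f id_func K) (res (w \<otimes>\<^sub>f id_func K) X))
     (lo (to_one A \<otimes>\<^sub>f id_func K) X)"
  using pmate_hom[OF square_comparison[OF w] sfunc_id[OF K] X]
    res_prod_id[OF one_Cat[OF small] K lo_obj[OF sfunc_prod[OF small sfunc_to_one[OF small sfuncD(2)[OF w]] sfunc_id[OF K]] X]]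
  by (simp add: comparison_pmate[OF w K])

text \<open>Pasting with the comparison square of w precomposes the index functor with w and
  whiskers the 2-cell; the vertical side over J' is again the projection to
  \<open>one\<close>.\<close>

lemma pmate_comparison:
  assumes s: "square J A one B p u (to_one J) b \<alpha>" and w: "sfunc sm w J' J" and K: "K \<in> Cat sm" and X: "X \<in> Obj (onc D (A \<otimes> K))"
  shows "pmate p u (to_one J) b \<alpha> (id_func K) X \<cdot>\<^bsub>onc D (one \<otimes> K)\<^esub> colim_comparison D K w (res (p \<otimes>\<^sub>f id_func K) X) =
    pmate (p \<odot> w) u (to_one J') b (\<alpha> \<star> id_ntr w) (id_func K) X"
proof -
  note sD = squareD[OF s] and wD = sfuncD[OF w]
  note n = sfuncD(3) and i = sfunc_id[OF K]
  note t = sfunc_to_one[OF small wD(1)] and tJ = sfunc_to_one[OF small wD(2)]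
  note o = one_Cat[OF small]
  have tw: "to_one J \<odot> w = to_one J'" using func_to_one[OF small sfunc_comp[OF w tJ]] .
  have "b \<odot> to_one J \<odot> w = b \<odot> to_one J'" using comp_func_assoc[OF wD(3) n[OF tJ] n[OF sD(4)]] tw by simp
  then have aw: "is_ntr (\<alpha> \<star> id_ntr w) (u \<odot> p \<odot> w) (b \<odot> to_one J')"
    using is_ntr_hcomp[OF wD(3) n[OF sD(6)] is_ntr_id[OF wD(3)] sntrD(1)[OF sD(5,6)]] by simp
  have "(id_ntr b \<star> id_ntr (to_one J')) \<bullet> (\<alpha> \<star> id_ntr w) = \<alpha> \<star> id_ntr w"
    unfolding id_ntr_hcomp[OF n[OF t] n[OF sD(4)]] by (rule vcomp_id(2)[OF n[OF sfunc_comp[OF w sD(6)]] aw])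
  then show ?thesis
    using pmate_paste[OF s square_comparison[OF w] i i X] comparison_pmate[OF w K] comp_func_id(1)[OF n[OF sD(4)]]
      comp_func_id(1)[OF n[OF i]] resa_prod_id[OF o K pmate_hom[OF s i X]] by simp
qed

text \<open>The case of the preceding pasting in which the given square is itself a comparison
  square.\<close>

lemma comparison_comp:
  assumes w: "sfunc sm w J A" and w': "sfunc sm w' J' J" and K: "K \<in> Cat sm" and X: "X \<in> Obj (onc D (A \<otimes> K))"
  shows "colim_comparison D K w X \<cdot>\<^bsub>onc D (one \<otimes> K)\<^esub> colim_comparison D K w' (res (w \<otimes>\<^sub>f id_func K) X) =
    colim_comparison D K (w \<odot> w') X"
proof -
  note tJ = sfunc_to_one[OF small sfuncD(1)[OF w]]
  have "id_ntr (to_one J) \<star> id_ntr w' = id_ntr (to_one J')"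
    using id_ntr_hcomp[OF sfuncD(3)[OF w'] sfuncD(3)[OF tJ]] func_to_one[OF small sfunc_comp[OF w' tJ]] by simp
  then show ?thesis
    using pmate_comparison[OF square_comparison[OF w] w' K X] comparison_pmate[OF w K] comparison_pmate[OF sfunc_comp[OF w' w] K] by simp
qed

end

section \<open>The decomposition of a colimit\<close>

text \<open>Homotopy finality of u enters only through its instance at the given derivator, stated
  for all parameter categories.\<close>

locale decomposition_context = derivator_context sm D + small_diagram sm C F
  for sm :: "'k elem set \<Rightarrow> bool" and D :: "('k, 'o, 'm) pder" and C :: "'k scat" and F :: "'k diag" +
  fixes A :: "'k scat" and u :: "'k sfunc"
  assumes u: "sfunc sm u (groth F) A"
    and comparison_iso: "\<And>K X. K \<in> Cat sm \<Longrightarrow> X \<in> Obj (onc D (A \<otimes> K)) \<Longrightarrow>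
      iso (onc D (one \<otimes> K)) (colim_comparison D K u X)"
begin

abbreviation "R \<equiv> rcone C"

lemma A_Cat: "A \<in> Cat sm"
  by (rule sfuncD(2)[OF u])

lemma R_Cat: "R \<in> Cat sm"
  by (rule rcone_Cat[OF small C])

lemma apex_obj: "Pt \<in> Obj R"
  by simp

definition cocone :: "('k, 'o, 'm) dmor" where
  "cocone = push D cproj \<odot>\<^sub>d pull D u"

lemma typed_cocone: "typed_dmor sm cocone (shift D A) (shift D R)"
  unfolding cocone_def
  by (rule typed_dmor_comp(1)[OF prederivator_shift[OF A_Cat] prederivator_shift[OF groth] prederivator_shift[OF R_Cat]
        typed_pull[OF u] typed_push[OF sfunc_cproj]])

lemma uK: "K \<in> Cat sm \<Longrightarrow> sfunc sm (u \<otimes>\<^sub>f id_func K) (E \<otimes> K) (A \<otimes> K)"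
  by (rule sfunc_prod[OF small u sfunc_id])

lemma cproj_K: "K \<in> Cat sm \<Longrightarrow> sfunc sm (cproj \<otimes>\<^sub>f id_func K) (E \<otimes> K) (R \<otimes> K)"
  by (rule sfunc_prod[OF small sfunc_cproj sfunc_id])

lemma at_cocone:
  assumes K: "K \<in> Cat sm"
  shows "X \<in> Obj (onc D (A \<otimes> K)) \<Longrightarrow> omap (at cocone K) X = lo (cproj \<otimes>\<^sub>f id_func K) (res (u \<otimes>\<^sub>f id_func K) X)"
    and "f \<in> Arr (onc D (A \<otimes> K)) \<Longrightarrow> amap (at cocone K) f = la (cproj \<otimes>\<^sub>f id_func K) (resa (u \<otimes>\<^sub>f id_func K) f)"
  using is_funcD(3)[OF D_func[OF uK[OF K]]] by (simp_all add: cocone_def comp_dmor_def push_def pull_def)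

lemma cell_cocone:
  assumes v: "sfunc sm v K' K" and X: "X \<in> Obj (onc D (A \<otimes> K))"
  shows "cmp (cell cocone v) X = pmate (id_func E) cproj cproj (id_func R) (id_ntr cproj) v (res (u \<otimes>\<^sub>f id_func K) X)"
  unfolding cocone_def cell_comp_pull[OF u prederivator_shift[OF R_Cat] typed_push[OF sfunc_cproj] v X]
  by (rule push_cell[OF sfunc_cproj v res_obj[OF uK[OF sfuncD(2)[OF v]] X]])

text \<open>Restriction along u is strict, so the structure cells are those of the push along
  \<open>cproj\<close> evaluated at the restriction of X. Each axiom is an instance of the
  corresponding coherence of these mates.\<close>

lemma is_dmor_cocone: "is_dmor sm cocone (shift D A) (shift D R)"
proof (rule is_dmorI[OF prederivator_shift[OF A_Cat] prederivator_shift[OF R_Cat] typed_cocone], unfold shift_simps)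
  fix v K' K X assume v: "sfunc sm v K' K" and X: "X \<in> Obj (onc D (A \<otimes> K))"
  show "iso (onc D (R \<otimes> K')) (cmp (cell cocone v) X)"
    unfolding cell_cocone[OF v X] by (rule pmate_push_exact[OF sfunc_cproj v res_obj[OF uK[OF sfuncD(2)[OF v]] X]])
next
  fix K X assume K: "K \<in> Cat sm" and X: "X \<in> Obj (onc D (A \<otimes> K))"
  show "cmp (cell cocone (id_func K)) X = Ident (onc D (R \<otimes> K)) (omap (at cocone K) X)"
    unfolding cell_cocone[OF sfunc_id[OF K] X] at_cocone(1)[OF K X]
    by (rule pmate_id[OF sfunc_cproj K res_obj[OF uK[OF K] X]])
next
  fix v w K'' K' K X assume v: "sfunc sm v K'' K'" and w: "sfunc sm w K' K" and X: "X \<in> Obj (onc D (A \<otimes> K))"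
  show "cmp (cell cocone (w \<odot> v)) X = resa (id_func R \<otimes>\<^sub>f v) (cmp (cell cocone w) X) \<cdot>\<^bsub>onc D (R \<otimes> K'')\<^esub>
      cmp (cell cocone v) (res (id_func A \<otimes>\<^sub>f w) X)"
    unfolding cell_cocone[OF sfunc_comp[OF v w] X] cell_cocone[OF w X]
      cell_cocone[OF v res_obj[OF sfunc_prod[OF small sfunc_id[OF A_Cat] w] X]] res_interchange[OF u w X]
    by (rule pmate_push_comp[OF sfunc_cproj w v res_obj[OF uK[OF sfuncD(2)[OF w]] X]])
next
  fix \<alpha> v w K' K X assume v: "sfunc sm v K' K" and a: "sntr sm \<alpha> v w" and X: "X \<in> Obj (onc D (A \<otimes> K))"
  note w = sntrD(2)[OF a v]
  have h: "two (id_ntr (id_func A) \<otimes>\<^sub>n \<alpha>) X \<in> hom (onc D (A \<otimes> K')) (res (id_func A \<otimes>\<^sub>f v) X) (res (id_func A \<otimes>\<^sub>f w) X)"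
    by (rule two_hom[OF sfunc_prod[OF small sfunc_id[OF A_Cat] v] sntr_prod[OF small sfunc_id[OF A_Cat] v sntr_id[OF sfunc_id[OF A_Cat]] a] X])
  have h': "two (id_ntr (id_func A) \<otimes>\<^sub>n \<alpha>) X \<in> Arr (onc D (A \<otimes> K'))" using h by (simp add: hom_iff)
  show "two (id_ntr (id_func R) \<otimes>\<^sub>n \<alpha>) (omap (at cocone K) X) \<cdot>\<^bsub>onc D (R \<otimes> K')\<^esub> cmp (cell cocone v) X =
      cmp (cell cocone w) X \<cdot>\<^bsub>onc D (R \<otimes> K')\<^esub> amap (at cocone K') (two (id_ntr (id_func A) \<otimes>\<^sub>n \<alpha>) X)"
    unfolding cell_cocone[OF v X] cell_cocone[OF w X] at_cocone(1)[OF sfuncD(2)[OF v] X] at_cocone(2)[OF sfuncD(1)[OF v] h']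
      pull_two[OF u v a X]
    by (rule pmate_push_two[OF sfunc_cproj v a res_obj[OF uK[OF sfuncD(2)[OF v]] X]])
qed

text \<open>The preimage in the diagrams over C is the left Kan extension of the restricted diagram
  along the projection from E to C; extending it further along the inclusion of C gives d X up to
  isomorphism.\<close>

lemma cocone_colimiting:
  assumes K: "K \<in> Cat sm" and X: "X \<in> Obj (onc D (A \<otimes> K))"
  shows "colimiting_cocone D C K (omap (at cocone K) X)"
proof -
  note i = sfunc_id[OF K]
  note p = sfunc_prod[OF small sfunc_proj i] and r = sfunc_prod[OF small sfunc_rcone_in[OF small C] i]
  have e: "(rcone_in C \<otimes>\<^sub>f id_func K) \<odot> (proj \<otimes>\<^sub>f id_func K) = cproj \<otimes>\<^sub>f id_func K"
    using prod_func_comp[OF sfuncD(3)[OF sfunc_proj] sfuncD(3)[OF i] sfuncD(3)[OF sfunc_rcone_in[OF small C]] sfuncD(3)[OF i]]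
      comp_func_id(1)[OF sfuncD(3)[OF i]] by (simp add: cproj_def)
  note Y = res_obj[OF uK[OF K] X]
  show ?thesis
    unfolding colimiting_cocone_def shift_simps at_cocone(1)[OF K X]
    using lan_comp_iso[OF p r Y] lo_obj[OF p Y] unfolding e by (auto simp add: push_def)
qed

section \<open>The value of the cocone at the apex\<close>

abbreviation at_apex :: "'k scat \<Rightarrow> 'o \<Rightarrow> 'm" where
  "at_apex K X \<equiv> pmate (id_func E) cproj (to_one E) (pt R Pt) apex_ntr (id_func K) (res (u \<otimes>\<^sub>f id_func K) X)"

lemma square_apex: "square E E one R (id_func E) cproj (to_one E) (pt R Pt) apex_ntr"
  unfolding square_def
  using sfunc_id[OF groth] sfunc_cproj sfunc_to_one[OF small groth] sfunc_pt[OF small R_Cat apex_obj] sntr_apex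
  by (simp add: comp_func_id(1)[OF sfuncD(3)[OF sfunc_cproj]])

lemma apex_K: "K \<in> Cat sm \<Longrightarrow> sfunc sm (pt R Pt \<otimes>\<^sub>f id_func K) (one \<otimes> K) (R \<otimes> K)"
  by (rule sfunc_prod[OF small sfunc_pt[OF small R_Cat apex_obj] sfunc_id])

lemma at_apex:
  assumes K: "K \<in> Cat sm" and X: "X \<in> Obj (onc D (A \<otimes> K))"
  shows "at_apex K X \<in> hom (onc D (one \<otimes> K)) (lo (to_one E \<otimes>\<^sub>f id_func K) (res (u \<otimes>\<^sub>f id_func K) X))
      (res (pt R Pt \<otimes>\<^sub>f id_func K) (omap (at cocone K) X))"
    and "iso (onc D (one \<otimes> K)) (at_apex K X)"
  using pmate_hom[OF square_apex sfunc_id[OF K] res_obj[OF uK[OF K] X]] res_prod_id[OF groth K res_obj[OF uK[OF K] X]]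
    pmate_point_exact(1)[OF reflective_cone_apex sfunc_cproj apex_obj sfunc_id[OF K] res_obj[OF uK[OF K] X]]
  by (simp_all add: at_cocone(1)[OF K X])

text \<open>The comparison along u composed with the inverse of \<open>at_apex\<close>. Fixing it by
  the equation it satisfies avoids naming that inverse, and properties of it can be proved after
  composing with \<open>at_apex\<close>.\<close>

definition apex_to_colim :: "'k scat \<Rightarrow> 'o \<Rightarrow> 'm" where
  "apex_to_colim K X = (SOME t. t \<in> hom (onc D (one \<otimes> K)) (res (pt R Pt \<otimes>\<^sub>f id_func K) (omap (at cocone K) X)) (lo (to_one A \<otimes>\<^sub>f id_func K) X) \<and>
     t \<cdot>\<^bsub>onc D (one \<otimes> K)\<^esub> at_apex K X = colim_comparison D K u X)"

lemma D_one_K: "K \<in> Cat sm \<Longrightarrow> category (onc D (one \<otimes> K))"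
  by (rule D_cat[OF prod_cat_Cat[OF small one_Cat[OF small]]])

lemma apex_to_colim:
  assumes K: "K \<in> Cat sm" and X: "X \<in> Obj (onc D (A \<otimes> K))"
  shows "apex_to_colim K X \<in> hom (onc D (one \<otimes> K)) (res (pt R Pt \<otimes>\<^sub>f id_func K) (omap (at cocone K) X)) (lo (to_one A \<otimes>\<^sub>f id_func K) X)"
    and "apex_to_colim K X \<cdot>\<^bsub>onc D (one \<otimes> K)\<^esub> at_apex K X = colim_comparison D K u X"
    and "iso (onc D (one \<otimes> K)) (apex_to_colim K X)"
proof -
  note m = at_apex[OF K X] and cc = comparison_hom[OF u K X] and DK = D_one_K[OF K]
  let ?T = "res (pt R Pt \<otimes>\<^sub>f id_func K) (omap (at cocone K) X)"
  let ?W = "lo (to_one E \<otimes>\<^sub>f id_func K) (res (u \<otimes>\<^sub>f id_func K) X)"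
  obtain m' where m': "m' \<in> hom (onc D (one \<otimes> K)) ?T ?W"
    "m' \<cdot>\<^bsub>onc D (one \<otimes> K)\<^esub> at_apex K X = Ident (onc D (one \<otimes> K)) ?W"
    using iso_iff[OF m(1)] m(2) by blast
  have "colim_comparison D K u X \<cdot>\<^bsub>onc D (one \<otimes> K)\<^esub> m' \<cdot>\<^bsub>onc D (one \<otimes> K)\<^esub> at_apex K X = colim_comparison D K u X"
    using hom_assoc[OF DK m(1) m'(1) cc] m'(2) hom_unit(2)[OF DK cc] by simp
  then have "\<exists>t. t \<in> hom (onc D (one \<otimes> K)) ?T (lo (to_one A \<otimes>\<^sub>f id_func K) X) \<and> t \<cdot>\<^bsub>onc D (one \<otimes> K)\<^esub> at_apex K X = colim_comparison D K u X"
    using hom_comp[OF DK m'(1) cc] by blast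
  from someI_ex[OF this] show h: "apex_to_colim K X \<in> hom (onc D (one \<otimes> K)) ?T (lo (to_one A \<otimes>\<^sub>f id_func K) X)"
    and e: "apex_to_colim K X \<cdot>\<^bsub>onc D (one \<otimes> K)\<^esub> at_apex K X = colim_comparison D K u X"
    unfolding apex_to_colim_def by blast+
  show "iso (onc D (one \<otimes> K)) (apex_to_colim K X)"
    using iso_cancel_left_factor[OF DK m(1) h m(2)] comparison_iso[OF K X] e by simp
qed

lemma typed_apex: "typed_dmor sm (pull D (pt R Pt) \<odot>\<^sub>d cocone) (shift D A) (shift D one)"
  by (rule typed_dmor_comp(1)[OF prederivator_shift[OF A_Cat] prederivator_shift[OF R_Cat] prederivator_shift[OF one_Cat[OF small]]
        typed_cocone typed_pull[OF sfunc_pt[OF small R_Cat apex_obj]]])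

lemma typed_colim: "B \<in> Cat sm \<Longrightarrow> typed_dmor sm (colim D B) (shift D B) (shift D one)"
  unfolding colim_def by (rule typed_push[OF sfunc_to_one[OF small]])

lemma at_pull_cocone:
  assumes K: "K \<in> Cat sm"
  shows "X \<in> Obj (onc D (A \<otimes> K)) \<Longrightarrow>
      omap (at (pull D w \<odot>\<^sub>d cocone) K) X = res (w \<otimes>\<^sub>f id_func K) (omap (at cocone K) X)"
    and "f \<in> Arr (onc D (A \<otimes> K)) \<Longrightarrow>
      amap (at (pull D w \<odot>\<^sub>d cocone) K) f = resa (w \<otimes>\<^sub>f id_func K) (la (cproj \<otimes>\<^sub>f id_func K) (resa (u \<otimes>\<^sub>f id_func K) f))"
  using at_cocone(2)[OF K] is_funcD(3)[OF typed_dmorD(1)[OF typed_cocone K]]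
  by (simp_all add: comp_dmor_def pull_def)

lemma at_colim: "omap (at (colim D B) K) X = lo (to_one B \<otimes>\<^sub>f id_func K) X" "amap (at (colim D B) K) f = la (to_one B \<otimes>\<^sub>f id_func K) f"
  by (simp_all add: colim_def push_def)

definition apex_iso :: "'k scat \<Rightarrow> ('o, 'm, 'o, 'm) ntr" where
  "apex_iso K = mk_ntr (at (pull D (pt R Pt) \<odot>\<^sub>d cocone) K) (at (colim D A) K) (apex_to_colim K)"

lemma apex_iso_cmp: "K \<in> Cat sm \<Longrightarrow> X \<in> Obj (onc D (A \<otimes> K)) \<Longrightarrow> cmp (apex_iso K) X = apex_to_colim K X"
  using is_funcD(3)[OF typed_dmorD(1)[OF typed_apex]] by (simp add: apex_iso_def)

text \<open>Both \<open>at_apex\<close> and the comparison map are natural and compatible with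
  parameters, because they are mates. Each property passes to \<open>apex_to_colim\<close> by
  composing with the invertible \<open>at_apex\<close>, substituting the defining equation and
  cancelling.\<close>

lemma apex_iso_modification:
  "is_iso_modification sm apex_iso (shift D A) (shift D one) (pull D (pt R Pt) \<odot>\<^sub>d cocone) (colim D A)"
proof -
  note pA = prederivator_shift[OF A_Cat] and p1 = prederivator_shift[OF one_Cat[OF small]]
  note sP = sfunc_pt[OF small R_Cat apex_obj]
  have "is_modification sm apex_iso (shift D A) (shift D one) (pull D (pt R Pt) \<odot>\<^sub>d cocone) (colim D A)"
    unfolding apex_iso_def
  proof (rule is_modificationI[OF pA p1 typed_apex typed_colim[OF A_Cat]], unfold shift_simps)
    fix K X assume "K \<in> Cat sm" "X \<in> Obj (onc D (A \<otimes> K))"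
    then show "apex_to_colim K X \<in> hom (onc D (one \<otimes> K)) (omap (at (pull D (pt R Pt) \<odot>\<^sub>d cocone) K) X) (omap (at (colim D A) K) X)"
      using apex_to_colim(1) by (simp add: at_pull_cocone at_colim)
  next
    fix K f X Y assume K: "K \<in> Cat sm" and f: "f \<in> hom (onc D (A \<otimes> K)) X Y"
    note DA = D_cat[OF prod_cat_Cat[OF small A_Cat K]] and DK = D_one_K[OF K]
    note X = hom_Obj(1)[OF DA f] and Y = hom_Obj(2)[OF DA f]
    note m = at_apex[OF K X] and mY = at_apex[OF K Y] and t = apex_to_colim[OF K X] and tY = apex_to_colim[OF K Y]
    note uf = resa_hom[OF uK[OF K] f]
    note lf = la_hom[OF sfunc_prod[OF small sfunc_to_one[OF small A_Cat] sfunc_id[OF K]] f]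
    note pf = resa_hom[OF apex_K[OF K] la_hom[OF cproj_K[OF K] uf], folded at_cocone(1)[OF K X] at_cocone(1)[OF K Y]]
    note ef = la_hom[OF sfunc_prod[OF small sfunc_to_one[OF small groth] sfunc_id[OF K]] uf]
    let ?c = "\<lambda>g f. g \<cdot>\<^bsub>onc D (one \<otimes> K)\<^esub> f"
    let ?p = "resa (pt R Pt \<otimes>\<^sub>f id_func K) (la (cproj \<otimes>\<^sub>f id_func K) (resa (u \<otimes>\<^sub>f id_func K) f))"
    let ?l = "la (to_one A \<otimes>\<^sub>f id_func K) f" and ?e = "la (to_one E \<otimes>\<^sub>f id_func K) (resa (u \<otimes>\<^sub>f id_func K) f)"
    have n1: "?c (at_apex K Y) ?e = ?c ?p (at_apex K X)"
      using mate_natural[OF square_prod[OF square_apex sfunc_id[OF K]] uf] resa_prod_id[OF groth K uf] by simp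
    have n2: "?c (colim_comparison D K u Y) ?e = ?c ?l (colim_comparison D K u X)"
      using mate_natural[OF square_prod[OF square_comparison[OF u] sfunc_id[OF K]] f] resa_prod_id[OF one_Cat[OF small] K lf]
      by (simp add: comparison_pmate[OF u K])
    have "?c (?c (apex_to_colim K Y) ?p) (at_apex K X) = ?c (apex_to_colim K Y) (?c (at_apex K Y) ?e)"
      unfolding n1 by (rule hom_assoc[OF DK m(1) pf tY(1), symmetric])
    also have "\<dots> = ?c ?l (colim_comparison D K u X)"
      unfolding hom_assoc[OF DK ef mY(1) tY(1)] tY(2) n2 ..
    also have "\<dots> = ?c (?c ?l (apex_to_colim K X)) (at_apex K X)"
      unfolding t(2)[symmetric] by (rule hom_assoc[OF DK m(1) t(1) lf])
    finally have "?c (apex_to_colim K Y) ?p = ?c ?l (apex_to_colim K X)"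
      by (rule iso_cancel_right[OF DK m hom_comp[OF DK pf tY(1)] hom_comp[OF DK t(1) lf]])
    then show "apex_to_colim K Y \<cdot>\<^bsub>onc D (one \<otimes> K)\<^esub> amap (at (pull D (pt R Pt) \<odot>\<^sub>d cocone) K) f =
        amap (at (colim D A) K) f \<cdot>\<^bsub>onc D (one \<otimes> K)\<^esub> apex_to_colim K X"
      using f by (simp add: at_pull_cocone[OF K] at_colim hom_iff)
  next
    fix v K' K X assume v: "sfunc sm v K' K" and X: "X \<in> Obj (onc D (A \<otimes> K))"
    note K = sfuncD(2)[OF v] and K' = sfuncD(1)[OF v]
    note av = sfunc_prod[OF small sfunc_id[OF A_Cat] v] and ov = sfunc_prod[OF small sfunc_id[OF one_Cat[OF small]] v]
    note vX = res_obj[OF av X] note Y = res_obj[OF uK[OF K] X]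
    note DK = D_one_K[OF K] and DK' = D_one_K[OF K']
    let ?c = "\<lambda>g f. g \<cdot>\<^bsub>onc D (one \<otimes> K')\<^esub> f"
    let ?v = "\<lambda>f. resa (id_func one \<otimes>\<^sub>f v) f"
    let ?vX = "res (id_func A \<otimes>\<^sub>f v) X" and ?Y = "res (u \<otimes>\<^sub>f id_func K) X"
    let ?t = "to_one A" and ?tE = "to_one E"
    \<comment> \<open>\<open>cd\<close>, \<open>cA\<close> and \<open>cE\<close> are the structure
      cells along v of, in this order, the apex value, the colimit over A and the colimit over E.
      The last one occurs in the modification axioms of both squares and mediates between the other
      two.\<close>
    define cd where "cd = resa (pt R Pt \<otimes>\<^sub>f id_func K') (cmp (cell cocone v) X)"
    define cA where "cA = pmate (id_func A) ?t ?t (id_func one) (id_ntr ?t) v X"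
    define cE where "cE = pmate (id_func E) ?tE ?tE (id_func one) (id_ntr ?tE) v ?Y"
    note tA = sfunc_to_one[OF small A_Cat] and tE = sfunc_to_one[OF small groth]
    have YY: "res (u \<otimes>\<^sub>f id_func K') ?vX = res (id_func E \<otimes>\<^sub>f v) ?Y" by (rule res_interchange[OF u v X])
    note Z = lo_obj[OF cproj_K[OF K] Y]
    have cd: "cd \<in> hom (onc D (one \<otimes> K')) (res (pt R Pt \<otimes>\<^sub>f id_func K') (omap (at cocone K') ?vX))
        (res (id_func one \<otimes>\<^sub>f v) (res (pt R Pt \<otimes>\<^sub>f id_func K) (omap (at cocone K) X)))"
      using resa_hom[OF apex_K[OF K'] pmate_hom[OF square_id[OF sfunc_cproj] v Y]]
      unfolding cd_def cell_cocone[OF v X] at_cocone(1)[OF K X] at_cocone(1)[OF K' vX] YY res_interchange[OF sP v Z] .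
    have cA: "cA \<in> hom (onc D (one \<otimes> K')) (lo (?t \<otimes>\<^sub>f id_func K') ?vX) (res (id_func one \<otimes>\<^sub>f v) (lo (?t \<otimes>\<^sub>f id_func K) X))"
      unfolding cA_def by (rule pmate_hom[OF square_id[OF tA] v X])
    have cE: "cE \<in> hom (onc D (one \<otimes> K')) (lo (?tE \<otimes>\<^sub>f id_func K') (res (u \<otimes>\<^sub>f id_func K') ?vX)) (res (id_func one \<otimes>\<^sub>f v) (lo (?tE \<otimes>\<^sub>f id_func K) ?Y))"
      unfolding cE_def YY by (rule pmate_hom[OF square_id[OF tE] v Y])
    note m = at_apex[OF K X] and m' = at_apex[OF K' vX] and t = apex_to_colim[OF K X] and t' = apex_to_colim[OF K' vX]
    note cc' = comparison_hom[OF u K' vX]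
    note vm = resa_hom[OF ov m(1)] and vt = resa_hom[OF ov t(1)]
    have 1: "?c cd (at_apex K' ?vX) = ?c (?v (at_apex K X)) cE"
      using pmate_modification[OF square_apex v Y] res_prod_id[OF groth K Y]
      by (simp add: cd_def cE_def cell_cocone[OF v X] YY)
    have 2: "?c cA (colim_comparison D K' u ?vX) = ?c (?v (colim_comparison D K u X)) cE"
      using pmate_modification[OF square_comparison[OF u] v X] resa_prod_id[OF one_Cat[OF small] K' cA]
      by (simp add: cA_def cE_def comparison_pmate[OF u K] comparison_pmate[OF u K'])
    have "?c (?c (?v (apex_to_colim K X)) cd) (at_apex K' ?vX) = ?c (?v (apex_to_colim K X)) (?c (?v (at_apex K X)) cE)"
      unfolding 1[symmetric] by (rule hom_assoc[OF DK' m'(1) cd vt, symmetric])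
    also have "\<dots> = ?c (?v (colim_comparison D K u X)) cE"
      unfolding hom_assoc[OF DK' cE vm vt] t(2)[symmetric] resa_comp[OF ov m(1) t(1)] ..
    also have "\<dots> = ?c (?c cA (apex_to_colim K' ?vX)) (at_apex K' ?vX)"
      unfolding 2[symmetric] t'(2)[symmetric] by (rule hom_assoc[OF DK' m'(1) t'(1) cA])
    finally have "?c (?v (apex_to_colim K X)) cd = ?c cA (apex_to_colim K' ?vX)"
      by (rule iso_cancel_right[OF DK' m' hom_comp[OF DK' cd vt] hom_comp[OF DK' t'(1) cA]])
    then show "resa (id_func one \<otimes>\<^sub>f v) (apex_to_colim K X) \<cdot>\<^bsub>onc D (one \<otimes> K')\<^esub> cmp (cell (pull D (pt R Pt) \<odot>\<^sub>d cocone) v) X =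
        cmp (cell (colim D A) v) X \<cdot>\<^bsub>onc D (one \<otimes> K')\<^esub> apex_to_colim K' (res (id_func A \<otimes>\<^sub>f v) X)"
      using cell_pull_comp[OF sP pA typed_cocone v, of X] X push_cell[OF tA v X]
      by (simp add: cd_def cA_def colim_def)
  qed
  then show ?thesis
    unfolding is_iso_modification_def using apex_to_colim(3) by (simp add: apex_iso_cmp)
qed

section \<open>The values of the cocone at the objects of C\<close>

abbreviation fibre_colim :: "'k elem \<Rightarrow> ('k, 'o, 'm) dmor" where
  "fibre_colim c \<equiv> colim D (omap F c) \<odot>\<^sub>d (pull D (fib F c) \<odot>\<^sub>d pull D u)"

text \<open>The mate of the fibre square already runs from the colimit over the fibre to the value
  of the cocone, so no inverse has to be taken here.\<close>

definition to_vertex :: "'k elem \<Rightarrow> 'k scat \<Rightarrow> 'o \<Rightarrow> 'm" where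
  "to_vertex c K X = pmate (fib F c) cproj (to_one (omap F c)) (pt R (Old c)) (id_ntr (cproj \<odot> fib F c)) (id_func K)
     (res (u \<otimes>\<^sub>f id_func K) X)"

definition vertex_iso :: "'k elem \<Rightarrow> 'k scat \<Rightarrow> ('o, 'm, 'o, 'm) ntr" where
  "vertex_iso c K = mk_ntr (at (fibre_colim c) K) (at (pull D (pt R (Old c)) \<odot>\<^sub>d cocone) K) (to_vertex c K)"

context
  fixes c :: "'k elem"
  assumes c: "c \<in> Obj C"
begin

lemma vertex_obj: "Old c \<in> Obj R"
  using c by simp

lemma square_vertex: "square (omap F c) E one R (fib F c) cproj (to_one (omap F c)) (pt R (Old c)) (id_ntr (cproj \<odot> fib F c))"
  unfolding square_def
  using sfunc_fib[OF c] sfunc_cproj sfunc_to_one[OF small fibre_Cat[OF c]] sfunc_pt[OF small R_Cat vertex_obj]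
    sntr_id[OF sfunc_comp[OF sfunc_fib[OF c] sfunc_cproj]] cproj_fib[OF c] by simp

lemma fib_K: "K \<in> Cat sm \<Longrightarrow> sfunc sm (fib F c \<otimes>\<^sub>f id_func K) (omap F c \<otimes> K) (E \<otimes> K)"
  by (rule sfunc_prod[OF small sfunc_fib[OF c] sfunc_id])

lemma vertex_K: "K \<in> Cat sm \<Longrightarrow> sfunc sm (pt R (Old c) \<otimes>\<^sub>f id_func K) (one \<otimes> K) (R \<otimes> K)"
  by (rule sfunc_prod[OF small sfunc_pt[OF small R_Cat vertex_obj] sfunc_id])

lemma typed_pull_fibre: "typed_dmor sm (pull D (fib F c) \<odot>\<^sub>d pull D u) (shift D A) (shift D (omap F c))"
  by (rule typed_dmor_comp(1)[OF prederivator_shift[OF A_Cat] prederivator_shift[OF groth] prederivator_shift[OF fibre_Cat[OF c]]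
        typed_pull[OF u] typed_pull[OF sfunc_fib[OF c]]])

lemma typed_fibre_colim: "typed_dmor sm (fibre_colim c) (shift D A) (shift D one)"
  by (rule typed_dmor_comp(1)[OF prederivator_shift[OF A_Cat] prederivator_shift[OF fibre_Cat[OF c]] prederivator_shift[OF one_Cat[OF small]]
        typed_pull_fibre typed_colim[OF fibre_Cat[OF c]]])

lemma typed_vertex: "typed_dmor sm (pull D (pt R (Old c)) \<odot>\<^sub>d cocone) (shift D A) (shift D one)"
  by (rule typed_dmor_comp(1)[OF prederivator_shift[OF A_Cat] prederivator_shift[OF R_Cat] prederivator_shift[OF one_Cat[OF small]]
        typed_cocone typed_pull[OF sfunc_pt[OF small R_Cat vertex_obj]]])

lemma at_pull_fibre:
  assumes K: "K \<in> Cat sm"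
  shows "X \<in> Obj (onc D (A \<otimes> K)) \<Longrightarrow> omap (at (pull D (fib F c) \<odot>\<^sub>d pull D u) K) X = res (fib F c \<otimes>\<^sub>f id_func K) (res (u \<otimes>\<^sub>f id_func K) X)"
    and "f \<in> Arr (onc D (A \<otimes> K)) \<Longrightarrow> amap (at (pull D (fib F c) \<odot>\<^sub>d pull D u) K) f = resa (fib F c \<otimes>\<^sub>f id_func K) (resa (u \<otimes>\<^sub>f id_func K) f)"
  using is_funcD(3)[OF D_func[OF uK[OF K]]] by (simp_all add: comp_dmor_def pull_def)

lemma at_fibre_colim:
  assumes K: "K \<in> Cat sm"
  shows "X \<in> Obj (onc D (A \<otimes> K)) \<Longrightarrow> omap (at (fibre_colim c) K) X =
      lo (to_one (omap F c) \<otimes>\<^sub>f id_func K) (res (fib F c \<otimes>\<^sub>f id_func K) (res (u \<otimes>\<^sub>f id_func K) X))"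
    and "f \<in> Arr (onc D (A \<otimes> K)) \<Longrightarrow> amap (at (fibre_colim c) K) f =
      la (to_one (omap F c) \<otimes>\<^sub>f id_func K) (resa (fib F c \<otimes>\<^sub>f id_func K) (resa (u \<otimes>\<^sub>f id_func K) f))"
  using is_funcD(3)[OF D_func[OF uK[OF K]]] by (simp_all add: comp_dmor_def pull_def colim_def push_def)

text \<open>Both restrictions are strict, so their composite has identities as structure cells, and
  only the cell of the colimit over the fibre remains.\<close>

lemma cell_fibre_colim:
  assumes v: "sfunc sm v K' K" and X: "X \<in> Obj (onc D (A \<otimes> K))"
  shows "cmp (cell (fibre_colim c) v) X =
    pmate (id_func (omap F c)) (to_one (omap F c)) (to_one (omap F c)) (id_func one) (id_ntr (to_one (omap F c))) v
      (res (fib F c \<otimes>\<^sub>f id_func K) (res (u \<otimes>\<^sub>f id_func K) X))"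
proof -
  note K = sfuncD(2)[OF v] and K' = sfuncD(1)[OF v] and Fc = fibre_Cat[OF c]
  note t = sfunc_to_one[OF small Fc]
  note tK' = sfunc_prod[OF small t sfunc_id[OF K']]
  note Y = res_obj[OF uK[OF K] X] note Z = res_obj[OF fib_K[OF K] Y]
  note vY = res_obj[OF sfunc_prod[OF small sfunc_id[OF groth] v] Y]
  note vZ = res_obj[OF sfunc_prod[OF small sfunc_id[OF Fc] v] Z]
  have pc: "cmp (cell (pull D (fib F c) \<odot>\<^sub>d pull D u) v) X =
      Ident (onc D (omap F c \<otimes> K')) (res (id_func (omap F c) \<otimes>\<^sub>f v) (res (fib F c \<otimes>\<^sub>f id_func K) (res (u \<otimes>\<^sub>f id_func K) X)))"
    using cell_pull_comp[OF sfunc_fib[OF c] prederivator_shift[OF A_Cat] typed_pull[OF u] v, of X] X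
      pull_cell[OF u v X] res_interchange[OF u v X] resa_ident[OF fib_K[OF K'] vY] res_interchange[OF sfunc_fib[OF c] v Y] by simp
  note M = pmate_hom[OF square_id[OF t] v Z]
  have "la (to_one (omap F c) \<otimes>\<^sub>f id_func K') (Ident (onc D (omap F c \<otimes> K')) (res (id_func (omap F c) \<otimes>\<^sub>f v) (res (fib F c \<otimes>\<^sub>f id_func K) (res (u \<otimes>\<^sub>f id_func K) X))))
    = Ident (onc D (one \<otimes> K')) (lo (to_one (omap F c) \<otimes>\<^sub>f id_func K') (res (id_func (omap F c) \<otimes>\<^sub>f v) (res (fib F c \<otimes>\<^sub>f id_func K) (res (u \<otimes>\<^sub>f id_func K) X))))"
    by (rule is_funcD(9)[OF lan_func[OF tK'] vZ])
  then show ?thesis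
    using typed_dmor_comp(2)[OF prederivator_shift[OF A_Cat] prederivator_shift[OF Fc] prederivator_shift[OF one_Cat[OF small]]
        typed_pull_fibre typed_colim[OF Fc] v, of X] X pc at_pull_fibre(1)[OF K X] push_cell[OF t v Z] hom_unit(2)[OF D_one_K[OF K'] M]
    by (simp add: at_colim) (simp add: colim_def)
qed

lemma to_vertex_hom:
  assumes K: "K \<in> Cat sm" and X: "X \<in> Obj (onc D (A \<otimes> K))"
  shows "to_vertex c K X \<in> hom (onc D (one \<otimes> K))
      (lo (to_one (omap F c) \<otimes>\<^sub>f id_func K) (res (fib F c \<otimes>\<^sub>f id_func K) (res (u \<otimes>\<^sub>f id_func K) X)))
      (res (pt R (Old c) \<otimes>\<^sub>f id_func K) (lo (cproj \<otimes>\<^sub>f id_func K) (res (u \<otimes>\<^sub>f id_func K) X)))"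
  unfolding to_vertex_def by (rule pmate_hom[OF square_vertex sfunc_id[OF K] res_obj[OF uK[OF K] X]])

lemma vertex_iso_cmp: "K \<in> Cat sm \<Longrightarrow> X \<in> Obj (onc D (A \<otimes> K)) \<Longrightarrow> cmp (vertex_iso c K) X = to_vertex c K X"
  using is_funcD(3)[OF typed_dmorD(1)[OF typed_fibre_colim]] by (simp add: vertex_iso_def)

text \<open>Naturality in X is that of mates, compatibility with parameters is the two-way pasting
  along v, and invertibility comes from the reflectivity of the fibre in its slice.\<close>

lemma vertex_iso_modification:
  "is_iso_modification sm (vertex_iso c) (shift D A) (shift D one) (fibre_colim c) (pull D (pt R (Old c)) \<odot>\<^sub>d cocone)"
proof -
  note pA = prederivator_shift[OF A_Cat] and p1 = prederivator_shift[OF one_Cat[OF small]]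
  note sP = sfunc_pt[OF small R_Cat vertex_obj]
  have "is_modification sm (vertex_iso c) (shift D A) (shift D one) (fibre_colim c) (pull D (pt R (Old c)) \<odot>\<^sub>d cocone)"
    unfolding vertex_iso_def
  proof (rule is_modificationI[OF pA p1 typed_fibre_colim typed_vertex], unfold shift_simps)
    fix K X assume K: "K \<in> Cat sm" and X: "X \<in> Obj (onc D (A \<otimes> K))"
    show "to_vertex c K X \<in> hom (onc D (one \<otimes> K)) (omap (at (fibre_colim c) K) X) (omap (at (pull D (pt R (Old c)) \<odot>\<^sub>d cocone) K) X)"
      unfolding at_fibre_colim(1)[OF K X] at_pull_cocone(1)[OF K X] at_cocone(1)[OF K X] by (rule to_vertex_hom[OF K X])
  next
    fix K f X Y assume K: "K \<in> Cat sm" and f: "f \<in> hom (onc D (A \<otimes> K)) X Y"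
    then have f': "f \<in> Arr (onc D (A \<otimes> K))" by (simp add: hom_iff)
    show "to_vertex c K Y \<cdot>\<^bsub>onc D (one \<otimes> K)\<^esub> amap (at (fibre_colim c) K) f =
        amap (at (pull D (pt R (Old c)) \<odot>\<^sub>d cocone) K) f \<cdot>\<^bsub>onc D (one \<otimes> K)\<^esub> to_vertex c K X"
      unfolding at_fibre_colim(2)[OF K f'] at_pull_cocone(2)[OF K f'] to_vertex_def
      using mate_natural[OF square_prod[OF square_vertex sfunc_id[OF K]] resa_hom[OF uK[OF K] f]] by simp
  next
    fix v K' K X assume v: "sfunc sm v K' K" and X: "X \<in> Obj (onc D (A \<otimes> K))"
    note K = sfuncD(2)[OF v] and K' = sfuncD(1)[OF v]
    show "resa (id_func one \<otimes>\<^sub>f v) (to_vertex c K X) \<cdot>\<^bsub>onc D (one \<otimes> K')\<^esub> cmp (cell (fibre_colim c) v) X =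
        cmp (cell (pull D (pt R (Old c)) \<odot>\<^sub>d cocone) v) X \<cdot>\<^bsub>onc D (one \<otimes> K')\<^esub> to_vertex c K' (res (id_func A \<otimes>\<^sub>f v) X)"
      using pmate_modification[OF square_vertex v res_obj[OF uK[OF K] X]] cell_pull_comp[OF sP pA typed_cocone v, of X] X
      by (simp add: to_vertex_def cell_fibre_colim[OF v X] cell_cocone[OF v X] res_interchange[OF u v X])
  qed
  moreover have "iso (onc D (one \<otimes> K)) (to_vertex c K X)" if "K \<in> Cat sm" "X \<in> Obj (onc D (A \<otimes> K))" for K X
    unfolding to_vertex_def
    by (rule pmate_point_exact(1)[OF reflective_cone_fib[OF c] sfunc_cproj vertex_obj sfunc_id[OF that(1)] res_obj[OF uK[OF that(1)] that(2)]])
  ultimately show ?thesis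
    unfolding is_iso_modification_def by (simp add: vertex_iso_cmp)
qed

text \<open>After the vertex isomorphism, the transition map is the mate of the apex transformation
  restricted to the fibre. That mate factors as \<open>at_apex\<close> after the comparison along
  the fibre inclusion; the defining equation of \<open>apex_to_colim\<close> and the composition law
  of comparison maps finish the computation.\<close>

lemma transition_to_apex:
  assumes K: "K \<in> Cat sm" and X: "X \<in> Obj (onc D (A \<otimes> K))"
  shows "apex_to_colim K X \<cdot>\<^bsub>onc D (one \<otimes> K)\<^esub> transition D R K (Pair Pt c) (omap (at cocone K) X)
      \<cdot>\<^bsub>onc D (one \<otimes> K)\<^esub> to_vertex c K X = colim_comparison D K (u \<odot> fib F c) X"
proof -
  note DK = D_one_K[OF K] and i = sfunc_id[OF K]
  note Y = res_obj[OF uK[OF K] X] note Z = lo_obj[OF cproj_K[OF K] Y]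
  have old: "Pair Pt c \<in> Arr R" "Dom R (Pair Pt c) = Old c" "Cod R (Pair Pt c) = Pt" using c by simp_all
  note p = sntr_pt[OF small R_Cat old(1), unfolded old(2,3)]
  let ?g = "pt_ntr R (Pair Pt c)"
  let ?c = "\<lambda>g f. g \<cdot>\<^bsub>onc D (one \<otimes> K)\<^esub> f"
  let ?Y = "res (u \<otimes>\<^sub>f id_func K) X"
  have t: "transition D R K (Pair Pt c) (omap (at cocone K) X) = two (?g \<otimes>\<^sub>n id_ntr (id_func K)) (lo (cproj \<otimes>\<^sub>f id_func K) ?Y)"
    by (simp add: transition_def at_cocone(1)[OF K X])
  note th = two_hom[OF vertex_K[OF K] sntr_prod[OF small sfunc_pt[OF small R_Cat vertex_obj] i p sntr_id[OF i]] Z]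
  note sq = squareD(5,6)[OF square_vertex]
  \<comment> \<open>The fibre square carries an identity 2-cell, so changing its base leaves just
    the whiskered transformation of points, which equals the restricted apex transformation.\<close>
  have n: "(?g \<star> id_ntr (to_one (omap F c))) \<bullet> id_ntr (cproj \<odot> fib F c) = apex_ntr \<star> id_ntr (fib F c)"
    unfolding transition_apex[OF c]
    by (rule vcomp_id(1)[OF sfuncD(3)[OF sq(2)] is_ntr_hcomp[OF sfuncD(3)[OF sfunc_fib[OF c]] sfuncD(3)[OF sfunc_cproj]
          is_ntr_id[OF sfuncD(3)[OF sfunc_fib[OF c]]] sntrD(1)[OF sntr_apex sfunc_cproj]]])
  have "?c (transition D R K (Pair Pt c) (omap (at cocone K) X)) (to_vertex c K X)
     = pmate (fib F c) cproj (to_one (omap F c)) (pt R Pt) (apex_ntr \<star> id_ntr (fib F c)) (id_func K) ?Y"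
    using pmate_change_base[OF square_vertex p i Y] by (simp add: t to_vertex_def n)
  also have "\<dots> = ?c (at_apex K X) (colim_comparison D K (fib F c) ?Y)"
    using pmate_comparison[OF square_apex sfunc_fib[OF c] K Y] res_prod_id[OF groth K Y]
      comp_func_id(2)[OF sfuncD(3)[OF sfunc_fib[OF c]]] by simp
  finally have e: "?c (transition D R K (Pair Pt c) (omap (at cocone K) X)) (to_vertex c K X) = ?c (at_apex K X) (colim_comparison D K (fib F c) ?Y)" .
  have tr: "transition D R K (Pair Pt c) (omap (at cocone K) X) \<in> hom (onc D (one \<otimes> K))
      (res (pt R (Old c) \<otimes>\<^sub>f id_func K) (lo (cproj \<otimes>\<^sub>f id_func K) ?Y)) (res (pt R Pt \<otimes>\<^sub>f id_func K) (omap (at cocone K) X))"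
    using th by (simp add: transition_def at_cocone(1)[OF K X])
  have "?c (?c (apex_to_colim K X) (transition D R K (Pair Pt c) (omap (at cocone K) X))) (to_vertex c K X)
    = ?c (apex_to_colim K X) (?c (at_apex K X) (colim_comparison D K (fib F c) ?Y))"
    unfolding e[symmetric] by (rule hom_assoc[OF DK to_vertex_hom[OF K X] tr apex_to_colim(1)[OF K X], symmetric])
  also have "\<dots> = ?c (colim_comparison D K u X) (colim_comparison D K (fib F c) ?Y)"
    unfolding hom_assoc[OF DK comparison_hom[OF sfunc_fib[OF c] K Y] at_apex(1)[OF K X] apex_to_colim(1)[OF K X]] apex_to_colim(2)[OF K X] ..
  also have "\<dots> = colim_comparison D K (u \<odot> fib F c) X" by (rule comparison_comp[OF u sfunc_fib[OF c] K X])
  finally show ?thesis .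
qed

end

text \<open>Both sides are the mate whose 2-cell is \<open>fib_ntr F f\<close> pushed forward along
  \<open>cproj\<close>. The left side reaches it by moving the base point along f. The right side
  restricts the fibre square of the codomain along F f and then absorbs the transformation of index
  functors at the top.\<close>

lemma transition_between_vertices:
  assumes f: "f \<in> Arr C" and K: "K \<in> Cat sm" and X: "X \<in> Obj (onc D (A \<otimes> K))"
  shows "transition D R K (Old f) (omap (at cocone K) X) \<cdot>\<^bsub>onc D (one \<otimes> K)\<^esub> to_vertex (Dom C f) K X =
    to_vertex (Cod C f) K X \<cdot>\<^bsub>onc D (one \<otimes> K)\<^esub> fib_colim_transition D F K f (omap (at (pull D u) K) X)"
proof -
  note d = C_simps(1)[OF f] and c = C_simps(2)[OF f] and m = fibre_func[OF f]
  note DK = D_one_K[OF K] and i = sfunc_id[OF K]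
  note Y = res_obj[OF uK[OF K] X] note Z = lo_obj[OF cproj_K[OF K] Y]
  have old: "Old f \<in> Arr R" "Dom R (Old f) = Old (Dom C f)" "Cod R (Old f) = Old (Cod C f)" using f by simp_all
  note p = sntr_pt[OF small R_Cat old(1), unfolded old(2,3)]
  let ?c = "\<lambda>g f. g \<cdot>\<^bsub>onc D (one \<otimes> K)\<^esub> f"
  let ?Y = "res (u \<otimes>\<^sub>f id_func K) X" and ?d = "Dom C f" and ?e = "Cod C f"
  note sd = square_vertex[OF d] and sc = square_vertex[OF c]
  note fd = sfunc_fib[OF d] and fc = sfunc_fib[OF c]
  have t: "transition D R K (Old f) (omap (at cocone K) X) = two (pt_ntr R (Old f) \<otimes>\<^sub>n id_ntr (id_func K)) (lo (cproj \<otimes>\<^sub>f id_func K) ?Y)"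
    by (simp add: transition_def at_cocone(1)[OF K X])
  have gf: "is_ntr (id_ntr cproj \<star> fib_ntr F f) (cproj \<odot> fib F ?d) (cproj \<odot> (fib F ?e \<odot> amap F f))"
    by (rule is_ntr_hcomp[OF sfuncD(3)[OF fd] sfuncD(3)[OF sfunc_cproj] sntrD(1)[OF sntr_fib[OF f] fd] is_ntr_id[OF sfuncD(3)[OF sfunc_cproj]]])
  have n1: "(pt_ntr R (Old f) \<star> id_ntr (to_one (omap F ?d))) \<bullet> id_ntr (cproj \<odot> fib F ?d) = id_ntr cproj \<star> fib_ntr F f"
    unfolding transition_fib[OF f] by (rule vcomp_id(1)[OF sfuncD(3)[OF squareD(6)[OF sd]] gf])
  have l: "?c (transition D R K (Old f) (omap (at cocone K) X)) (to_vertex ?d K X)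
     = pmate (fib F ?d) cproj (to_one (omap F ?d)) (pt R (Old ?e)) (id_ntr cproj \<star> fib_ntr F f) (id_func K) ?Y"
    using pmate_change_base[OF sd p i Y] by (simp add: t to_vertex_def n1)
  note fm = sfunc_comp[OF m fc]
  have idf: "id_ntr (cproj \<odot> fib F ?e) \<star> id_ntr (amap F f) = id_ntr (cproj \<odot> (fib F ?e \<odot> amap F f))"
    using id_ntr_hcomp[OF sfuncD(3)[OF m] sfuncD(3)[OF squareD(6)[OF sc]]] comp_func_assoc[OF sfuncD(3)[OF m] sfuncD(3)[OF fc] sfuncD(3)[OF sfunc_cproj]] by simp
  have tm: "to_one (omap F ?e) \<odot> amap F f = to_one (omap F ?d)"
    using func_to_one[OF small sfunc_comp[OF m sfunc_to_one[OF small fibre_Cat[OF c]]]] .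
  have oc: "Old ?e \<in> Obj R" using c by simp
  note po = sfunc_pt[OF small R_Cat oc]
  have cf: "cproj \<odot> (fib F ?e \<odot> amap F f) = pt R (Old ?e) \<odot> to_one (omap F ?d)"
    using comp_func_assoc[OF sfuncD(3)[OF m] sfuncD(3)[OF fc] sfuncD(3)[OF sfunc_cproj]]
      comp_func_assoc[OF sfuncD(3)[OF m] sfuncD(3)[OF sfunc_to_one[OF small fibre_Cat[OF c]]] sfuncD(3)[OF po]]
      cproj_fib[OF c] tm by simp
  have sf: "square (omap F ?d) E one R (fib F ?e \<odot> amap F f) cproj (to_one (omap F ?d)) (pt R (Old ?e)) (id_ntr (cproj \<odot> (fib F ?e \<odot> amap F f)))"
    unfolding square_def using fm sfunc_cproj sfunc_to_one[OF small fibre_Cat[OF d]] po sntr_id[OF sfunc_comp[OF fm sfunc_cproj]] cf by simp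
  let ?cc = "colim_comparison D K (amap F f) (res (fib F ?e \<otimes>\<^sub>f id_func K) ?Y)"
  let ?tw = "la (to_one (omap F ?d) \<otimes>\<^sub>f id_func K) (two (fib_ntr F f \<otimes>\<^sub>n id_ntr (id_func K)) ?Y)"
  note fcY = res_obj[OF fib_K[OF c K] Y]
  have cc: "?cc \<in> hom (onc D (one \<otimes> K)) (lo (to_one (omap F ?d) \<otimes>\<^sub>f id_func K) (res (amap F f \<otimes>\<^sub>f id_func K) (res (fib F ?e \<otimes>\<^sub>f id_func K) ?Y)))
     (lo (to_one (omap F ?e) \<otimes>\<^sub>f id_func K) (res (fib F ?e \<otimes>\<^sub>f id_func K) ?Y))"
    by (rule comparison_hom[OF m K fcY])
  have mf: "(fib F ?e \<otimes>\<^sub>f id_func K) \<odot> (amap F f \<otimes>\<^sub>f id_func K) = (fib F ?e \<odot> amap F f) \<otimes>\<^sub>f id_func K"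
    using prod_func_comp[OF sfuncD(3)[OF m] sfuncD(3)[OF i] sfuncD(3)[OF fc] sfuncD(3)[OF i]] comp_func_id(1)[OF sfuncD(3)[OF i]] by simp
  have rr: "res (amap F f \<otimes>\<^sub>f id_func K) (res (fib F ?e \<otimes>\<^sub>f id_func K) ?Y) = res ((fib F ?e \<odot> amap F f) \<otimes>\<^sub>f id_func K) ?Y"
    using res_comp[OF sfunc_prod[OF small m i] fib_K[OF c K] Y] mf by simp
  have tw: "?tw \<in> hom (onc D (one \<otimes> K)) (lo (to_one (omap F ?d) \<otimes>\<^sub>f id_func K) (res (fib F ?d \<otimes>\<^sub>f id_func K) ?Y))
      (lo (to_one (omap F ?d) \<otimes>\<^sub>f id_func K) (res (amap F f \<otimes>\<^sub>f id_func K) (res (fib F ?e \<otimes>\<^sub>f id_func K) ?Y)))"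
    unfolding rr
    by (rule la_hom[OF sfunc_prod[OF small sfunc_to_one[OF small fibre_Cat[OF d]] i] two_hom[OF fib_K[OF d K] sntr_prod[OF small fd i sntr_fib[OF f] sntr_id[OF i]] Y]])
  have "?c (to_vertex ?e K X) (?c ?cc ?tw) = ?c (?c (to_vertex ?e K X) ?cc) ?tw"
    by (rule hom_assoc[OF DK tw cc to_vertex_hom[OF c K X]])
  also have "\<dots> = ?c (pmate (fib F ?e \<odot> amap F f) cproj (to_one (omap F ?d)) (pt R (Old ?e)) (id_ntr (cproj \<odot> (fib F ?e \<odot> amap F f))) (id_func K) ?Y) ?tw"
    using pmate_comparison[OF sc m K Y] by (simp add: to_vertex_def idf)
  \<comment> \<open>The restricted square still has an identity 2-cell, so absorbing
    \<open>fib_ntr F f\<close> leaves its whiskering with \<open>cproj\<close> alone.\<close>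
  also have "\<dots> = pmate (fib F ?d) cproj (to_one (omap F ?d)) (pt R (Old ?e)) (id_ntr cproj \<star> fib_ntr F f) (id_func K) ?Y"
    using pmate_change_top[OF sf fd sntr_fib[OF f] i Y] vcomp_id(2)[OF sfuncD(3)[OF squareD(6)[OF sd]] gf] by simp
  finally have r: "?c (to_vertex ?e K X) (?c ?cc ?tw) = pmate (fib F ?d) cproj (to_one (omap F ?d)) (pt R (Old ?e)) (id_ntr cproj \<star> fib_ntr F f) (id_func K) ?Y" .
  show ?thesis
    unfolding l r[symmetric] by (simp add: fib_colim_transition_def Let_def Src_F at_colim pull_def)
qed

end

theorem theorem5p8:
  fixes sm :: "'k elem set \<Rightarrow> bool"
    and A C :: "'k scat"
    and F :: "'k diag"
    and u :: "'k sfunc"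
    and D :: "('k, 'o, 'm) pder"
  assumes "smallness sm"
    and "A \<in> Cat sm"
    and "left_decomposition TYPE('o \<times> 'm) sm A C F u"
    and "derivator sm D"
  shows "\<exists>d \<theta> \<kappa>.
    is_dmor sm d (shift D A) (shift D (rcone C)) \<and>
    (\<forall>K \<in> Cat sm. \<forall>X \<in> Obj (onc (shift D A) K). colimiting_cocone D C K (omap (at d K) X)) \<and>
    is_iso_modification sm \<theta> (shift D A) (shift D one)
      (pull D (pt (rcone C) Pt) \<odot>\<^sub>d d) (colim D A) \<and>
    (\<forall>c \<in> Obj C. is_iso_modification sm (\<kappa> c) (shift D A) (shift D one)
      (colim D (omap F c) \<odot>\<^sub>d (pull D (fib F c) \<odot>\<^sub>d pull D u))
      (pull D (pt (rcone C) (Old c)) \<odot>\<^sub>d d)) \<and>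
    (\<forall>K \<in> Cat sm. \<forall>X \<in> Obj (onc (shift D A) K).
      (\<forall>f \<in> Arr C.
        transition D (rcone C) K (Old f) (omap (at d K) X)
          \<cdot>\<^bsub>onc (shift D one) K\<^esub> cmp (\<kappa> (Dom C f) K) X =
        cmp (\<kappa> (Cod C f) K) X
          \<cdot>\<^bsub>onc (shift D one) K\<^esub> fib_colim_transition D F K f (omap (at (pull D u) K) X)) \<and>
      (\<forall>c \<in> Obj C.
        cmp (\<theta> K) X
          \<cdot>\<^bsub>onc (shift D one) K\<^esub> transition D (rcone C) K (Pair Pt c) (omap (at d K) X)
          \<cdot>\<^bsub>onc (shift D one) K\<^esub> cmp (\<kappa> c K) X =
        colim_comparison D K (u \<odot> fib F c) X))"
proof -
  from assms(3) have C: "C \<in> Cat sm" and F: "is_func F C (Cat1 sm)"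
    and hf: "homotopy_final TYPE('o \<times> 'm) sm u (groth F) A"
    by (auto simp add: left_decomposition_def)
  from hf have u: "sfunc sm u (groth F) A" by (simp add: homotopy_final_def)
  \<comment> \<open>Homotopy finality quantifies over the derivators with values in the CAT named by
    the type argument, and D is one of these.\<close>
  have ci: "iso (onc D (one \<otimes> K)) (colim_comparison D K u X)" if "K \<in> Cat sm" "X \<in> Obj (onc D (A \<otimes> K))" for K X
    using hf assms(4) that unfolding homotopy_final_def by (simp add: shift_def)
  interpret decomposition_context sm D C F A u
    by unfold_locales (use assms(1,4) C F u ci sfuncD(1)[OF u] in auto)
  show ?thesis
    by (intro exI[of _ cocone] exI[of _ apex_iso] exI[of _ vertex_iso] conjI ballI is_dmor_cocone apex_iso_modification vertex_iso_modification)
      (simp_all add: cocone_colimiting apex_iso_cmp vertex_iso_cmp C_simps transition_between_vertices transition_to_apex)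
qed

end
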